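(* Let $G$ be a discrete group, $n\geq 1$, and let $M_{t_1},\dots,M_{t_n}$ be unital completely positive Fourier multipliers on the group von Neumann algebra $VN(G)$, where the symbols $t_1,\dots,t_n\colon G\to\mathbb{C}$ are real-valued functions. Then there exist a von Neumann algebra $\mathcal{M}$ equipped with a normal semifinite faithful trace, a commuting tuple $(U_1,\dots,U_n)$ of unital trace preserving $*$-automorphisms of $\mathcal{M}$, and a unital normal trace preserving one-to-one $*$-homomorphism $J\colon VN(G)\to\mathcal{M}$ such that $$M_{t_1}^{k_1}\cdots M_{t_n}^{k_n}=E\,U_1^{k_1}\cdots U_n^{k_n}J$$ for all integers $k_1,\dots,k_n\geq 0$, where $E\colon\mathcal{M}\to VN(G)$ is the canonical faithful normal trace preserving conditional expectation associated with $J$.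
   Context: Let $g\mapsto\lambda(g)$ be the left regular representation of $G$ on $\ell^2_G$; $VN(G)$ is the von Neumann algebra generated by $\{\lambda(g):g\in G\}$, equipped with the normal faithful trace $\tau(x)=\langle \epsilon_{e_G},x\epsilon_{e_G}\rangle_{\ell^2_G}$, where $(\epsilon_g)_{g\in G}$ is the canonical basis of $\ell^2_G$ and $e_G$ is the identity of $G$. A Fourier multiplier on $VN(G)$ is a normal linear map $M\colon VN(G)\to VN(G)$ for which there is a function $t\colon G\to\mathbb{C}$ with $M(\lambda(g))=t_g\lambda(g)$ for all $g\in G$; it is then denoted $M_t$. Given a trace preserving unital injective normal $*$-homomorphism $J\colon \mathcal{N}\to\mathcal{M}$ between von Neumann algebras with normal semifinite faithful traces $\tau_{\mathcal N},\tau_{\mathcal M}$, the canonical conditional expectation associated with $J$ is the normal faithful positive map $E\colon\mathcal{M}\to\mathcal{N}$ determined by $\tau_{\mathcal N}(E(y)x)=\tau_{\mathcal M}(yJ(x))$ for $y\in\mathcal{M}$, $x\in \mathcal{N}\cap L^1(\mathcal{N})$; it satisfies $EJ=\mathrm{Id}_{\mathcal N}$. *)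

theory Defs
  imports "HOL-Analysis.Analysis"
begin

section \<open>Complex Hilbert spaces\<close>

class scaleC =
  fixes scaleC :: "complex \<Rightarrow> 'a \<Rightarrow> 'a"  (infixr \<open>*\<^sub>C\<close> 75)

text \<open>The underlying real structure is that of \<^class>\<open>real_inner\<close>; the inner product \<open>cinner\<close> is
  linear in the second variable.\<close>

class chilbert_space = real_inner + complete_space + scaleC +
  fixes cinner :: "'a \<Rightarrow> 'a \<Rightarrow> complex"
  assumes scaleR_scaleC: "scaleR r x = complex_of_real r *\<^sub>C x"
    and scaleC_add_right: "c *\<^sub>C (x + y) = c *\<^sub>C x + c *\<^sub>C y"
    and scaleC_add_left: "(c + d) *\<^sub>C x = c *\<^sub>C x + d *\<^sub>C x"
    and scaleC_scaleC: "c *\<^sub>C d *\<^sub>C x = (c * d) *\<^sub>C x"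
    and cinner_commute: "cinner x y = cnj (cinner y x)"
    and cinner_add_right: "cinner x (y + z) = cinner x y + cinner x z"
    and cinner_scaleC_right: "cinner x (c *\<^sub>C y) = c * cinner x y"
    and inner_eq_Re_cinner: "inner x y = Re (cinner x y)"
begin

subclass banach ..

lemma cinner_self: "cinner x x = complex_of_real ((norm x)\<^sup>2)"
proof -
  have "Im (cinner x x) = 0"
    using arg_cong[OF cinner_commute[of x x], of Im] by simp
  then show ?thesis
    by (simp add: complex_eq_iff power2_norm_eq_inner inner_eq_Re_cinner)
qed

lemma norm_scaleC: "norm (c *\<^sub>C x) = cmod c * norm x"
proof -
  have "cinner (c *\<^sub>C x) (c *\<^sub>C x) = (c * cnj c) * cinner x x"
    using cinner_commute[of "c *\<^sub>C x" x] cinner_commute[of x x] by (simp add: cinner_scaleC_right)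
  then have "complex_of_real ((norm (c *\<^sub>C x))\<^sup>2) = complex_of_real ((cmod c * norm x)\<^sup>2)"
    unfolding cinner_self complex_norm_square[symmetric] by (simp add: power_mult_distrib)
  then have "(norm (c *\<^sub>C x))\<^sup>2 = (cmod c * norm x)\<^sup>2"
    by (simp only: of_real_eq_iff)
  then show ?thesis
    by (simp add: power2_eq_iff_nonneg)
qed

lemma scaleC_scaleR_commute: "c *\<^sub>C (r *\<^sub>R x) = r *\<^sub>R (c *\<^sub>C x)"
  by (simp add: scaleR_scaleC scaleC_scaleC mult.commute)

end

lemma bounded_linear_scaleC: "bounded_linear (\<lambda>x :: 'a::chilbert_space. c *\<^sub>C x)"
  by (rule bounded_linear_intro[where K = "cmod c"])
     (simp_all add: scaleC_add_right scaleC_scaleR_commute norm_scaleC mult.commute)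

instantiation blinfun :: (real_normed_vector, chilbert_space) scaleC
begin

lift_definition scaleC_blinfun :: "complex \<Rightarrow> 'a \<Rightarrow>\<^sub>L 'b \<Rightarrow> 'a \<Rightarrow>\<^sub>L 'b"
  is "\<lambda>c T x. c *\<^sub>C T x"
  by (rule bounded_linear_compose[OF bounded_linear_scaleC])

instance ..

end


section \<open>The Hilbert space of square summable families\<close>

typedef 'a ell2 = "{f :: 'a \<Rightarrow> complex. (\<lambda>i. (cmod (f i))\<^sup>2) summable_on UNIV}"
  by (rule exI[of _ "\<lambda>_. 0"]) simp

setup_lifting type_definition_ell2

lemma ell2_prod_abs_summable:
  assumes "(\<lambda>i. (cmod (f i))\<^sup>2) summable_on A" "(\<lambda>i. (cmod (g i))\<^sup>2) summable_on A"
  shows "(\<lambda>i. norm (cnj (f i) * g i)) summable_on A"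
proof (rule abs_summable_product)
  show "(\<lambda>i. norm (cnj (f i) * cnj (f i))) summable_on A" "(\<lambda>i. norm (g i * g i)) summable_on A"
    using assms by (simp_all add: norm_mult power2_eq_square)
qed

lemma ell2_prod_summable:
  assumes "(\<lambda>i. (cmod (f i))\<^sup>2) summable_on A" "(\<lambda>i. (cmod (g i))\<^sup>2) summable_on A"
  shows "(\<lambda>i. cnj (f i) * g i) summable_on A"
  using ell2_prod_abs_summable[OF assms] by (rule abs_summable_summable)

lemma ell2_add_summable:
  assumes "(\<lambda>i. (cmod (f i))\<^sup>2) summable_on A" "(\<lambda>i. (cmod (g i))\<^sup>2) summable_on A"
  shows "(\<lambda>i. (cmod (f i + g i))\<^sup>2) summable_on A"
proof (rule summable_on_comparison_test)
  show "(\<lambda>i. 2 * (cmod (f i))\<^sup>2 + 2 * (cmod (g i))\<^sup>2) summable_on A"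
    by (intro summable_on_add summable_on_cmult_right assms)
  fix i
  have "(cmod (f i + g i))\<^sup>2 \<le> (cmod (f i) + cmod (g i))\<^sup>2"
    by (simp add: norm_triangle_ineq power_mono)
  also have "\<dots> \<le> 2 * (cmod (f i))\<^sup>2 + 2 * (cmod (g i))\<^sup>2"
    using zero_le_power2[of "cmod (f i) - cmod (g i)"]
    by (simp add: power2_eq_square algebra_simps)
  finally show "(cmod (f i + g i))\<^sup>2 \<le> 2 * (cmod (f i))\<^sup>2 + 2 * (cmod (g i))\<^sup>2" .
qed simp

lemma ell2_scale_summable:
  assumes "(\<lambda>i. (cmod (f i))\<^sup>2) summable_on A"
  shows "(\<lambda>i. (cmod (c * f i))\<^sup>2) summable_on A"
  using summable_on_cmult_right[OF assms, of "(cmod c)\<^sup>2"]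
  by (simp add: norm_mult power_mult_distrib)

instantiation ell2 :: (type) real_vector
begin

lift_definition zero_ell2 :: "'a ell2" is "\<lambda>_. 0" by simp

lift_definition plus_ell2 :: "'a ell2 \<Rightarrow> 'a ell2 \<Rightarrow> 'a ell2" is "\<lambda>f g i. f i + g i"
  by (rule ell2_add_summable)

lift_definition uminus_ell2 :: "'a ell2 \<Rightarrow> 'a ell2" is "\<lambda>f i. - f i" by simp

lift_definition minus_ell2 :: "'a ell2 \<Rightarrow> 'a ell2 \<Rightarrow> 'a ell2" is "\<lambda>f g i. f i - g i"
  subgoal for f g using ell2_add_summable[of f UNIV "\<lambda>i. - g i"] by simp
  done

lift_definition scaleR_ell2 :: "real \<Rightarrow> 'a ell2 \<Rightarrow> 'a ell2" is "\<lambda>r f i. complex_of_real r * f i"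
  by (rule ell2_scale_summable)

instance
  by standard (transfer; simp add: fun_eq_iff algebra_simps)+

end

instantiation ell2 :: (type) scaleC
begin

lift_definition scaleC_ell2 :: "complex \<Rightarrow> 'a ell2 \<Rightarrow> 'a ell2" is "\<lambda>c f i. c * f i"
  by (rule ell2_scale_summable)

instance ..

end

lift_definition cinner_ell2' :: "'a ell2 \<Rightarrow> 'a ell2 \<Rightarrow> complex"
  is "\<lambda>f g. \<Sum>\<^sub>\<infinity>i. cnj (f i) * g i" .

lemma cinner_ell2'_commute: "cinner_ell2' x y = cnj (cinner_ell2' y x)"
  by transfer (simp add: mult.commute flip: infsum_cnj)

lemma cinner_ell2'_add: "cinner_ell2' x (y + z) = cinner_ell2' x y + cinner_ell2' x z"
  by transfer (simp add: distrib_left infsum_add ell2_prod_summable)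

lemma cinner_ell2'_scale: "cinner_ell2' x (c *\<^sub>C y) = c * cinner_ell2' x y"
  by transfer (simp add: mult.left_commute infsum_cmult_right')

lemma cinner_ell2'_self:
  "cinner_ell2' x x = complex_of_real (\<Sum>\<^sub>\<infinity>i. (cmod (Rep_ell2 x i))\<^sup>2)"
proof -
  have "cinner_ell2' x x = (\<Sum>\<^sub>\<infinity>i. complex_of_real ((cmod (Rep_ell2 x i))\<^sup>2))"
    unfolding cinner_ell2'.rep_eq complex_norm_square by (simp add: mult.commute)
  also have "\<dots> = complex_of_real (\<Sum>\<^sub>\<infinity>i. (cmod (Rep_ell2 x i))\<^sup>2)"
    using Rep_ell2[of x] by (intro infsumI has_sum_of_real has_sum_infsum) simp
  finally show ?thesis .
qed

lemma ell2_norm_sq_summable: "(\<lambda>i. (cmod (Rep_ell2 x i))\<^sup>2) summable_on UNIV"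
  using Rep_ell2[of x] by simp

instantiation ell2 :: (type) real_inner
begin

definition inner_ell2 :: "'a ell2 \<Rightarrow> 'a ell2 \<Rightarrow> real"
  where "inner_ell2 x y = Re (cinner_ell2' x y)"

definition norm_ell2 :: "'a ell2 \<Rightarrow> real"
  where "norm_ell2 x = sqrt (inner x x)"

definition dist_ell2 :: "'a ell2 \<Rightarrow> 'a ell2 \<Rightarrow> real"
  where "dist_ell2 x y = norm (x - y)"

definition sgn_ell2 :: "'a ell2 \<Rightarrow> 'a ell2"
  where "sgn_ell2 x = x /\<^sub>R norm x"

definition uniformity_ell2 :: "('a ell2 \<times> 'a ell2) filter"
  where "uniformity_ell2 = (INF e\<in>{0<..}. principal {(x, y). dist x y < e})"

definition open_ell2 :: "'a ell2 set \<Rightarrow> bool"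
  where "open_ell2 U \<longleftrightarrow> (\<forall>x\<in>U. \<forall>\<^sub>F (x', y) in uniformity. x' = x \<longrightarrow> y \<in> U)"

instance
proof
  fix x y z :: "'a ell2" and r :: real and U :: "'a ell2 set"
  show "inner x y = inner y x"
    unfolding inner_ell2_def by (subst cinner_ell2'_commute) simp
  then have comm: "inner x y = inner y x" for x y :: "'a ell2"
    unfolding inner_ell2_def by (subst cinner_ell2'_commute) simp
  show "inner (x + y) z = inner x z + inner y z"
    unfolding comm[of _ z] by (simp add: inner_ell2_def cinner_ell2'_add)
  have "r *\<^sub>R x = complex_of_real r *\<^sub>C x"
    by transfer simp
  then show "inner (r *\<^sub>R x) y = r * inner x y"
    unfolding comm[of _ y] by (simp add: inner_ell2_def cinner_ell2'_scale)
  show "0 \<le> inner x x"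
    by (simp add: inner_ell2_def cinner_ell2'_self infsum_nonneg)
  show "(inner x x = 0) = (x = 0)"
  proof
    assume "inner x x = 0"
    then have "(\<Sum>\<^sub>\<infinity>i. (cmod (Rep_ell2 x i))\<^sup>2) \<le> 0"
      by (simp add: inner_ell2_def cinner_ell2'_self)
    from nonneg_infsum_le_0D[OF this ell2_norm_sq_summable]
    have "Rep_ell2 x i = 0" for i by simp
    then show "x = 0"
      by (simp add: Rep_ell2_inject[symmetric] zero_ell2.rep_eq fun_eq_iff)
  next
    assume "x = 0"
    then show "inner x x = 0"
      by (simp add: inner_ell2_def cinner_ell2'_self zero_ell2.rep_eq)
  qed
qed (rule norm_ell2_def dist_ell2_def sgn_ell2_def uniformity_ell2_def open_ell2_def)+

end

lemma norm_ell2_square: "(norm (x :: 'a ell2))\<^sup>2 = (\<Sum>\<^sub>\<infinity>i. (cmod (Rep_ell2 x i))\<^sup>2)"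
  by (simp add: norm_ell2_def inner_ell2_def infsum_nonneg cinner_ell2'_self)

lemma ell2_finite_sum_le: "finite F \<Longrightarrow> (\<Sum>i\<in>F. (cmod (Rep_ell2 x i))\<^sup>2) \<le> (norm x)\<^sup>2"
  unfolding norm_ell2_square by (rule finite_sum_le_infsum[OF ell2_norm_sq_summable]) auto

lemma ell2_coeff_le: "cmod (Rep_ell2 x i) \<le> norm x"
  using ell2_finite_sum_le[of "{i}" x] by (simp add: power2_le_iff_abs_le)

instance ell2 :: (type) complete_space
proof
  fix X :: "nat \<Rightarrow> 'a ell2"
  assume X: "Cauchy X"
  have "Cauchy (\<lambda>n. Rep_ell2 (X n) i)" for i
  proof (rule metric_CauchyI)
    fix e :: real assume "0 < e"
    then obtain N where N: "\<And>m n. m \<ge> N \<Longrightarrow> n \<ge> N \<Longrightarrow> dist (X m) (X n) < e"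
      using metric_CauchyD[OF X] by meson
    have "dist (Rep_ell2 (X m) i) (Rep_ell2 (X n) i) \<le> dist (X m) (X n)" for m n
      using ell2_coeff_le[of "X m - X n" i] by (simp add: dist_norm minus_ell2.rep_eq)
    with N show "\<exists>M. \<forall>m\<ge>M. \<forall>n\<ge>M. dist (Rep_ell2 (X m) i) (Rep_ell2 (X n) i) < e"
      by (meson order_le_less_trans)
  qed
  then have "\<exists>l. (\<lambda>n. Rep_ell2 (X n) i) \<longlonglongrightarrow> l" for i
    using Cauchy_convergent convergent_def by blast
  then obtain L where L: "\<And>i. (\<lambda>n. Rep_ell2 (X n) i) \<longlonglongrightarrow> L i"
    by metis
  have key: "\<exists>N. \<forall>m\<ge>N. \<forall>F. finite F \<longrightarrow> (\<Sum>i\<in>F. (cmod (Rep_ell2 (X m) i - L i))\<^sup>2) \<le> e\<^sup>2"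
    if "0 < e" for e
  proof -
    obtain N where N: "\<And>m n. m \<ge> N \<Longrightarrow> n \<ge> N \<Longrightarrow> dist (X m) (X n) < e"
      using metric_CauchyD[OF X \<open>0 < e\<close>] by meson
    have "(\<Sum>i\<in>F. (cmod (Rep_ell2 (X m) i - L i))\<^sup>2) \<le> e\<^sup>2" if "m \<ge> N" "finite F" for m F
    proof (rule LIMSEQ_le_const2)
      show "(\<lambda>n. \<Sum>i\<in>F. (cmod (Rep_ell2 (X m) i - Rep_ell2 (X n) i))\<^sup>2)
        \<longlonglongrightarrow> (\<Sum>i\<in>F. (cmod (Rep_ell2 (X m) i - L i))\<^sup>2)"
        by (intro tendsto_intros L)
      have "(\<Sum>i\<in>F. (cmod (Rep_ell2 (X m) i - Rep_ell2 (X n) i))\<^sup>2) \<le> e\<^sup>2" if "n \<ge> N" for n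
      proof -
        have "(\<Sum>i\<in>F. (cmod (Rep_ell2 (X m - X n) i))\<^sup>2) \<le> (norm (X m - X n))\<^sup>2"
          using \<open>finite F\<close> by (rule ell2_finite_sum_le)
        also have "\<dots> \<le> e\<^sup>2"
          using N[OF \<open>m \<ge> N\<close> that] by (intro power_mono) (auto simp: dist_norm)
        finally show ?thesis by (simp add: minus_ell2.rep_eq)
      qed
      then show "\<exists>N. \<forall>n\<ge>N. (\<Sum>i\<in>F. (cmod (Rep_ell2 (X m) i - Rep_ell2 (X n) i))\<^sup>2) \<le> e\<^sup>2"
        by blast
    qed
    then show ?thesis by blast
  qed
  have diff: "(\<lambda>i. (cmod (Rep_ell2 (X m) i - L i))\<^sup>2) summable_on UNIV"
    if "\<And>F. finite F \<Longrightarrow> (\<Sum>i\<in>F. (cmod (Rep_ell2 (X m) i - L i))\<^sup>2) \<le> e\<^sup>2" for m e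
    using that by (intro nonneg_bdd_above_summable_on bdd_aboveI2[where M = "e\<^sup>2"]) auto
  obtain m where m: "\<And>F. finite F \<Longrightarrow> (\<Sum>i\<in>F. (cmod (Rep_ell2 (X m) i - L i))\<^sup>2) \<le> 1\<^sup>2"
    using key[of 1] by auto
  have "(\<lambda>i. (cmod (Rep_ell2 (X m) i + - (Rep_ell2 (X m) i - L i)))\<^sup>2) summable_on UNIV"
    using diff[OF m]
    by (intro ell2_add_summable ell2_norm_sq_summable) (simp add: norm_minus_commute)
  then have L2: "(\<lambda>i. (cmod (L i))\<^sup>2) summable_on UNIV" by simp
  define x where "x = Abs_ell2 L"
  have x: "Rep_ell2 x = L"
    unfolding x_def using L2 by (intro Abs_ell2_inverse) simp
  have "X \<longlonglongrightarrow> x"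
  proof (rule metric_LIMSEQ_I)
    fix e :: real assume "0 < e"
    then obtain N where N: "\<And>m F. m \<ge> N \<Longrightarrow> finite F \<Longrightarrow>
        (\<Sum>i\<in>F. (cmod (Rep_ell2 (X m) i - L i))\<^sup>2) \<le> (e/2)\<^sup>2"
      using key[of "e/2"] by auto
    have "dist (X m) x < e" if "m \<ge> N" for m
    proof -
      have "(norm (X m - x))\<^sup>2 \<le> (e/2)\<^sup>2"
        unfolding norm_ell2_square minus_ell2.rep_eq x
        by (rule infsum_le_finite_sums[OF diff[OF N[OF that]]]) (use N[OF that] in auto)
      then have "norm (X m - x) \<le> e/2"
        using \<open>0 < e\<close> by (simp add: power2_le_iff_abs_le)
      then show ?thesis using \<open>0 < e\<close> by (simp add: dist_norm)
    qed
    then show "\<exists>N. \<forall>m\<ge>N. dist (X m) x < e" by blast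
  qed
  then show "convergent X" by (rule convergentI)
qed

instantiation ell2 :: (type) chilbert_space
begin

definition cinner_ell2 :: "'a ell2 \<Rightarrow> 'a ell2 \<Rightarrow> complex"
  where "cinner_ell2 = cinner_ell2'"

instance
proof
  fix x y z :: "'a ell2" and c d :: complex and r :: real
  show "r *\<^sub>R x = complex_of_real r *\<^sub>C x" by transfer simp
  show "c *\<^sub>C (x + y) = c *\<^sub>C x + c *\<^sub>C y" by transfer (simp add: distrib_left)
  show "(c + d) *\<^sub>C x = c *\<^sub>C x + d *\<^sub>C x" by transfer (simp add: distrib_right)
  show "c *\<^sub>C d *\<^sub>C x = (c * d) *\<^sub>C x" by transfer (simp add: mult.assoc)
  show "cinner x y = cnj (cinner y x)"
    unfolding cinner_ell2_def by (rule cinner_ell2'_commute)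
  show "cinner x (y + z) = cinner x y + cinner x z"
    unfolding cinner_ell2_def by (rule cinner_ell2'_add)
  show "cinner x (c *\<^sub>C y) = c * cinner x y"
    unfolding cinner_ell2_def by (rule cinner_ell2'_scale)
  show "inner x y = Re (cinner x y)"
    by (simp add: inner_ell2_def cinner_ell2_def)
qed

end

lift_definition ell2_basis :: "'a \<Rightarrow> 'a ell2" is "\<lambda>i j. if j = i then 1 else 0"
  subgoal for i
    by (rule summable_on_cong_neutral[THEN iffD1, of UNIV "{i}"]) auto
  done


section \<open>Von Neumann algebras\<close>

definition clinear_ops :: "('h::chilbert_space \<Rightarrow>\<^sub>L 'h) set"
  where "clinear_ops = {T :: 'h \<Rightarrow>\<^sub>L 'h. \<forall>c x. T (c *\<^sub>C x) = c *\<^sub>C T x}"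

definition adj :: "'h::chilbert_space \<Rightarrow>\<^sub>L 'h \<Rightarrow> 'h \<Rightarrow>\<^sub>L 'h"
  where "adj T = (THE S :: 'h \<Rightarrow>\<^sub>L 'h. \<forall>x y. cinner (S x) y = cinner x (T y))"

definition commutant :: "('h::chilbert_space \<Rightarrow>\<^sub>L 'h) set \<Rightarrow> ('h \<Rightarrow>\<^sub>L 'h) set"
  where "commutant A = {T \<in> clinear_ops. \<forall>S\<in>A. T o\<^sub>L S = S o\<^sub>L T}"

text \<open>A self-adjoint set that equals its bicommutant is automatically a unital subalgebra.
  Every Hilbert space is isomorphic to some \<^typ>\<open>'a ell2\<close>.\<close>

definition von_neumann_algebra :: "('h::chilbert_space \<Rightarrow>\<^sub>L 'h) set \<Rightarrow> bool"
  where "von_neumann_algebra A \<longleftrightarrow>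
    A \<subseteq> clinear_ops \<and> (\<forall>x\<in>A. adj x \<in> A) \<and> commutant (commutant A) = A"

text \<open>The ultraweak (\<open>\<sigma>\<close>-weak) topology, which is the weak* topology of the algebra of bounded
  operators; its restriction to a von Neumann algebra is the weak* topology of that algebra.\<close>

definition ultraweak :: "('h::chilbert_space \<Rightarrow>\<^sub>L 'h) topology"
  where "ultraweak = topology_generated_by
    {{T :: 'h \<Rightarrow>\<^sub>L 'h. (\<Sum>k. cinner (\<xi> k) (T (\<eta> k))) \<in> U} | \<xi> \<eta> U.
      summable (\<lambda>k. (norm (\<xi> k))\<^sup>2) \<and> summable (\<lambda>k. (norm (\<eta> k))\<^sup>2) \<and> open U}"

definition positive_op :: "'h::chilbert_space \<Rightarrow>\<^sub>L 'h \<Rightarrow> bool"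
  where "positive_op T \<longleftrightarrow> T \<in> clinear_ops \<and> (\<forall>x. cinner x (T x) \<in> \<real>\<^sub>\<ge>\<^sub>0)"

definition op_le :: "'h::chilbert_space \<Rightarrow>\<^sub>L 'h \<Rightarrow> 'h \<Rightarrow>\<^sub>L 'h \<Rightarrow> bool"
  where "op_le S T \<longleftrightarrow> positive_op (T - S)"

definition positive_part :: "('h::chilbert_space \<Rightarrow>\<^sub>L 'h) set \<Rightarrow> ('h \<Rightarrow>\<^sub>L 'h) set"
  where "positive_part A = {x \<in> A. positive_op x}"

text \<open>\<open>X\<close> is a positive element of the algebra of \<open>m \<times> m\<close> matrices over the bounded operators on
  \<open>H\<close>, acting on the direct sum of \<open>m\<close> copies of \<open>H\<close>.\<close>

definition positive_matrix :: "nat \<Rightarrow> (nat \<Rightarrow> nat \<Rightarrow> 'h::chilbert_space \<Rightarrow>\<^sub>L 'h) \<Rightarrow> bool"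
  where "positive_matrix m X \<longleftrightarrow>
    (\<forall>i<m. \<forall>j<m. X i j \<in> clinear_ops) \<and>
    (\<forall>\<xi>. (\<Sum>i<m. \<Sum>j<m. cinner (\<xi> i) (X i j (\<xi> j))) \<in> \<real>\<^sub>\<ge>\<^sub>0)"


section \<open>Maps between von Neumann algebras\<close>

text \<open>Maps between algebras \<open>A\<close> and \<open>B\<close> are represented by functions between the ambient operator
  spaces, of which only the values on \<open>A\<close> are relevant.\<close>

definition linear_map ::
  "('h::chilbert_space \<Rightarrow>\<^sub>L 'h) set \<Rightarrow> ('k::chilbert_space \<Rightarrow>\<^sub>L 'k) set
    \<Rightarrow> (('h \<Rightarrow>\<^sub>L 'h) \<Rightarrow> ('k \<Rightarrow>\<^sub>L 'k)) \<Rightarrow> bool"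
  where "linear_map A B T \<longleftrightarrow> T \<in> A \<rightarrow> B \<and>
    (\<forall>x\<in>A. \<forall>y\<in>A. T (x + y) = T x + T y) \<and> (\<forall>c. \<forall>x\<in>A. T (c *\<^sub>C x) = c *\<^sub>C T x)"

definition normal_map ::
  "('h::chilbert_space \<Rightarrow>\<^sub>L 'h) set \<Rightarrow> ('k::chilbert_space \<Rightarrow>\<^sub>L 'k) set
    \<Rightarrow> (('h \<Rightarrow>\<^sub>L 'h) \<Rightarrow> ('k \<Rightarrow>\<^sub>L 'k)) \<Rightarrow> bool"
  where "normal_map A B T \<longleftrightarrow> linear_map A B T \<and>
    continuous_map (subtopology ultraweak A) (subtopology ultraweak B) T"

definition unital_map :: "(('h::chilbert_space \<Rightarrow>\<^sub>L 'h) \<Rightarrow> ('k::chilbert_space \<Rightarrow>\<^sub>L 'k)) \<Rightarrow> bool"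
  where "unital_map T \<longleftrightarrow> T id_blinfun = id_blinfun"

definition completely_positive ::
  "('h::chilbert_space \<Rightarrow>\<^sub>L 'h) set \<Rightarrow> (('h \<Rightarrow>\<^sub>L 'h) \<Rightarrow> ('k::chilbert_space \<Rightarrow>\<^sub>L 'k)) \<Rightarrow> bool"
  where "completely_positive A T \<longleftrightarrow>
    (\<forall>m X. (\<forall>i<m. \<forall>j<m. X i j \<in> A) \<and> positive_matrix m X
      \<longrightarrow> positive_matrix m (\<lambda>i j. T (X i j)))"

definition star_hom ::
  "('h::chilbert_space \<Rightarrow>\<^sub>L 'h) set \<Rightarrow> ('k::chilbert_space \<Rightarrow>\<^sub>L 'k) set
    \<Rightarrow> (('h \<Rightarrow>\<^sub>L 'h) \<Rightarrow> ('k \<Rightarrow>\<^sub>L 'k)) \<Rightarrow> bool"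
  where "star_hom A B J \<longleftrightarrow> linear_map A B J \<and>
    (\<forall>x\<in>A. \<forall>y\<in>A. J (x o\<^sub>L y) = J x o\<^sub>L J y) \<and> (\<forall>x\<in>A. J (adj x) = adj (J x))"

definition star_automorphism ::
  "('h::chilbert_space \<Rightarrow>\<^sub>L 'h) set \<Rightarrow> (('h \<Rightarrow>\<^sub>L 'h) \<Rightarrow> ('h \<Rightarrow>\<^sub>L 'h)) \<Rightarrow> bool"
  where "star_automorphism A U \<longleftrightarrow> star_hom A A U \<and> bij_betw U A A"


section \<open>Traces and conditional expectations\<close>

text \<open>Traces are functions on the positive part; values elsewhere are irrelevant.  Normality is
  preservation of suprema of upward directed sets that have a least upper bound.\<close>

definition normal_semifinite_faithful_trace ::
  "('h::chilbert_space \<Rightarrow>\<^sub>L 'h) set \<Rightarrow> (('h \<Rightarrow>\<^sub>L 'h) \<Rightarrow> ennreal) \<Rightarrow> bool"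
  where "normal_semifinite_faithful_trace A \<tau> \<longleftrightarrow>
    (\<forall>x\<in>positive_part A. \<forall>y\<in>positive_part A. \<tau> (x + y) = \<tau> x + \<tau> y) \<and>
    (\<forall>r\<ge>0. \<forall>x\<in>positive_part A. \<tau> (r *\<^sub>R x) = ennreal r * \<tau> x) \<and>
    (\<forall>x\<in>A. \<tau> (adj x o\<^sub>L x) = \<tau> (x o\<^sub>L adj x)) \<and>
    (\<forall>D s. D \<subseteq> positive_part A \<and> D \<noteq> {} \<and> (\<forall>x\<in>D. \<forall>y\<in>D. \<exists>z\<in>D. op_le x z \<and> op_le y z) \<and>
        s \<in> positive_part A \<and> (\<forall>x\<in>D. op_le x s) \<and>
        (\<forall>u\<in>positive_part A. (\<forall>x\<in>D. op_le x u) \<longrightarrow> op_le s u)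
      \<longrightarrow> \<tau> s = (SUP x\<in>D. \<tau> x)) \<and>
    (\<forall>x\<in>positive_part A. x \<noteq> 0 \<longrightarrow>
      (\<exists>y\<in>positive_part A. y \<noteq> 0 \<and> op_le y x \<and> \<tau> y < \<infinity>)) \<and>
    (\<forall>x\<in>positive_part A. \<tau> x = 0 \<longrightarrow> x = 0)"

definition finite_positive ::
  "('h::chilbert_space \<Rightarrow>\<^sub>L 'h) set \<Rightarrow> (('h \<Rightarrow>\<^sub>L 'h) \<Rightarrow> ennreal) \<Rightarrow> ('h \<Rightarrow>\<^sub>L 'h) set"
  where "finite_positive A \<tau> = {x \<in> positive_part A. \<tau> x < \<infinity>}"

text \<open>The ideal spanned by the positive elements of finite trace, that is, the intersection of \<open>A\<close>
  with \<open>L\<^sup>1(A)\<close>, and the linear extension of the trace to it.\<close>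

definition trace_ideal ::
  "('h::chilbert_space \<Rightarrow>\<^sub>L 'h) set \<Rightarrow> (('h \<Rightarrow>\<^sub>L 'h) \<Rightarrow> ennreal) \<Rightarrow> ('h \<Rightarrow>\<^sub>L 'h) set"
  where "trace_ideal A \<tau> = {(a - b) + \<i> *\<^sub>C (c - d) | a b c d.
    a \<in> finite_positive A \<tau> \<and> b \<in> finite_positive A \<tau> \<and>
    c \<in> finite_positive A \<tau> \<and> d \<in> finite_positive A \<tau>}"

definition trace_ext ::
  "('h::chilbert_space \<Rightarrow>\<^sub>L 'h) set \<Rightarrow> (('h \<Rightarrow>\<^sub>L 'h) \<Rightarrow> ennreal) \<Rightarrow> ('h \<Rightarrow>\<^sub>L 'h) \<Rightarrow> complex"
  where "trace_ext A \<tau> x = (THE z. \<exists>a b c d.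
    a \<in> finite_positive A \<tau> \<and> b \<in> finite_positive A \<tau> \<and>
    c \<in> finite_positive A \<tau> \<and> d \<in> finite_positive A \<tau> \<and>
    x = (a - b) + \<i> *\<^sub>C (c - d) \<and>
    z = Complex (enn2real (\<tau> a) - enn2real (\<tau> b)) (enn2real (\<tau> c) - enn2real (\<tau> d)))"

definition trace_preserving ::
  "('h::chilbert_space \<Rightarrow>\<^sub>L 'h) set \<Rightarrow> (('h \<Rightarrow>\<^sub>L 'h) \<Rightarrow> ennreal) \<Rightarrow>
    (('k::chilbert_space \<Rightarrow>\<^sub>L 'k) \<Rightarrow> ennreal) \<Rightarrow> (('h \<Rightarrow>\<^sub>L 'h) \<Rightarrow> ('k \<Rightarrow>\<^sub>L 'k)) \<Rightarrow> bool"
  where "trace_preserving A \<tau>\<^sub>A \<tau>\<^sub>B T \<longleftrightarrow> (\<forall>x\<in>positive_part A. \<tau>\<^sub>B (T x) = \<tau>\<^sub>A x)"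

definition canonical_expectation ::
  "('h::chilbert_space \<Rightarrow>\<^sub>L 'h) set \<Rightarrow> (('h \<Rightarrow>\<^sub>L 'h) \<Rightarrow> ennreal) \<Rightarrow>
   ('k::chilbert_space \<Rightarrow>\<^sub>L 'k) set \<Rightarrow> (('k \<Rightarrow>\<^sub>L 'k) \<Rightarrow> ennreal) \<Rightarrow>
   (('h \<Rightarrow>\<^sub>L 'h) \<Rightarrow> ('k \<Rightarrow>\<^sub>L 'k)) \<Rightarrow> (('k \<Rightarrow>\<^sub>L 'k) \<Rightarrow> ('h \<Rightarrow>\<^sub>L 'h)) \<Rightarrow> bool"
  where "canonical_expectation N \<tau>\<^sub>N M \<tau>\<^sub>M J E \<longleftrightarrow> normal_map M N E \<and>
    E \<in> positive_part M \<rightarrow> positive_part N \<and>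
    (\<forall>y\<in>positive_part M. E y = 0 \<longrightarrow> y = 0) \<and>
    (\<forall>y\<in>M. \<forall>x\<in>trace_ideal N \<tau>\<^sub>N. trace_ext N \<tau>\<^sub>N (E y o\<^sub>L x) = trace_ext M \<tau>\<^sub>M (y o\<^sub>L J x))"


section \<open>Group von Neumann algebras and Fourier multipliers\<close>

text \<open>A discrete group is a type of class \<^class>\<open>group_add\<close>: written additively, but not assumed
  commutative.\<close>

lift_definition translate :: "'g::group_add \<Rightarrow> 'g ell2 \<Rightarrow> 'g ell2" is "\<lambda>g f h. f (- g + h)"
  subgoal for g f
    using summable_on_reindex_bij_betw[OF bij_plus[of "- g"], of "\<lambda>i. (cmod (f i))\<^sup>2"] by simp
  done

lemma norm_translate: "norm (translate g f) = norm f"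
proof -
  have "(norm (translate g f))\<^sup>2 = (norm f)\<^sup>2"
    unfolding norm_ell2_square translate.rep_eq
    by (rule infsum_reindex_bij_betw[OF bij_plus[of "- g"], of "\<lambda>i. (cmod (Rep_ell2 f i))\<^sup>2"])
  then show ?thesis by simp
qed

lift_definition left_regular :: "'g::group_add \<Rightarrow> 'g ell2 \<Rightarrow>\<^sub>L 'g ell2" is translate
  subgoal for g
  proof (rule bounded_linear_intro[where K = 1])
    show "translate g (x + y) = translate g x + translate g y" for x y by transfer simp
    show "translate g (r *\<^sub>R x) = r *\<^sub>R translate g x" for r x by transfer simp
  qed (simp add: norm_translate)
  done

lemma left_regular_basis: "left_regular g (ell2_basis h) = ell2_basis (g + h)"
proof -
  have "- g + k = h \<longleftrightarrow> k = g + h" for k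
    using neg_equal_iff_equal minus_add_cancel add_minus_cancel by auto
  then show ?thesis
    by (simp add: left_regular.rep_eq Rep_ell2_inject[symmetric] translate.rep_eq ell2_basis.rep_eq)
qed

definition VN :: "('g::group_add ell2 \<Rightarrow>\<^sub>L 'g ell2) set"
  where "VN = von_neumann_algebra hull (range left_regular)"

definition VN_trace :: "('g::group_add ell2 \<Rightarrow>\<^sub>L 'g ell2) \<Rightarrow> complex"
  where "VN_trace x = cinner (ell2_basis 0) (x (ell2_basis 0))"

text \<open>The restriction of \<^const>\<open>VN_trace\<close> to the positive part, where it is nonnegative.\<close>

definition VN_trace_pos :: "('g::group_add ell2 \<Rightarrow>\<^sub>L 'g ell2) \<Rightarrow> ennreal"
  where "VN_trace_pos x = ennreal (Re (VN_trace x))"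

definition fourier_multiplier ::
  "('g::group_add \<Rightarrow> complex) \<Rightarrow> (('g ell2 \<Rightarrow>\<^sub>L 'g ell2) \<Rightarrow> ('g ell2 \<Rightarrow>\<^sub>L 'g ell2)) \<Rightarrow> bool"
  where "fourier_multiplier t T \<longleftrightarrow>
    normal_map VN VN T \<and> (\<forall>g. T (left_regular g) = t g *\<^sub>C left_regular g)"

type_synonym 'g dilation_index = "('g \<times> nat) list"

text \<open>A quantifier cannot range over types, so an existentially quantified von Neumann algebra has to
  live on a fixed Hilbert space.  The dimension of \<^typ>\<open>'g dilation_index ell2\<close> is the maximum of
  \<open>|G|\<close> and \<open>\<aleph>\<^sub>0\<close>.  By amplification it carries a faithful copy of every von Neumann algebra on a
  nonzero Hilbert space of at most that dimension.  This is no restriction for dilations: the von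
  Neumann algebra generated by the images of \<open>J(VN(G))\<close> under the words in the automorphisms and
  their inverses is generated by at most \<open>max(|G|, \<aleph>\<^sub>0)\<close> elements and has a normal faithful tracial
  state, so its GNS space has at most that dimension.\<close>

text \<open>The composition \<open>F\<^sub>1\<^bsup>k\<^sub>1\<^esup> \<circ> \<dots> \<circ> F\<^sub>n\<^bsup>k\<^sub>n\<^esup>\<close>.\<close>

definition power_product :: "nat \<Rightarrow> (nat \<Rightarrow> 'a \<Rightarrow> 'a) \<Rightarrow> (nat \<Rightarrow> nat) \<Rightarrow> 'a \<Rightarrow> 'a"
  where "power_product n F k = foldr (\<circ>) (map (\<lambda>i. F i ^^ k i) [1..<Suc n]) id"

end

(* For a single symbol t the dilating algebra is a crossed product by G of a Clifford algebra. A real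
   positive definite function is a Gram matrix of unit vectors xi_g in a real Hilbert space on which G
   acts orthogonally, with <xi_0, xi_g> = t g. The Clifford generator s(xi_0) is a self-adjoint unitary
   and s(xi_0) lambda_g s(xi_0) = s(xi_0) s(xi_g) lambda_g, whose conditional expectation is
   t g lambda_g. To obtain all powers at once, take independent (orthogonal) copies of the vectors,
   indexed by the integers for each of the symbols, and let the i-th automorphism be conjugation by
   s(xi_0) of the zeroth copy for the i-th symbol, followed by the shift of the copies of the i-th
   symbol. The automorphisms commute because orthogonal generators anticommute. *)

theory Submission
  imports Defs "HOL-Library.FSet"
begin

section \<open>Hilbert space geometry\<close>

text \<open>Multipliers are only known on the unitaries \<open>left_regular g\<close>, and products
  of automorphisms of a crossed product are unwieldy as operators. Both sides are therefore compared
  through matrix coefficients against \<open>ell2_basis a\<close> and \<open>ell2_basis b\<close>.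
  By normality a multiplier acts on these as multiplication by \<open>t (a - b)\<close>. On the
  other side the expectation is the compression to vectors tensored with the vacuum, and each
  automorphism is moved onto the two vectors as one creation followed by a backward shift. Powers
  come out right because every new vector leaves the zeroth copy before the next one is created
  there, so the inner products split into one factor per automorphism. The trace comes from the
  vacuum: left Clifford multiplications and translations have partners in the commutant, namely
  graded right multiplications and twisted right translations, which agree with them on the vacuum
  vector. Real symbols give a real symmetric kernel, and this is the Gram matrix of vectors with
  self-adjoint Clifford generators.\<close>

lemma subspace_closure:
  fixes S :: "'a::real_normed_vector set"
  assumes "subspace S"
  shows "subspace (closure S)"
  unfolding subspace_def
proof (intro conjI ballI allI)
  show "0 \<in> closure S" using subspace_0[OF assms] closure_subset by blast
next
  fix x y assume "x \<in> closure S" "y \<in> closure S"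
  then obtain s t where "\<And>n. s n \<in> S" "s \<longlonglongrightarrow> x" "\<And>n. t n \<in> S" "t \<longlonglongrightarrow> y"
    unfolding closure_sequential by metis
  then have "\<forall>n. s n + t n \<in> S" "(\<lambda>n. s n + t n) \<longlonglongrightarrow> x + y"
    using assms by (auto intro: subspace_add tendsto_add)
  then show "x + y \<in> closure S" unfolding closure_sequential by (intro exI conjI)
next
  fix c x assume "x \<in> closure S"
  then obtain s where "\<And>n. s n \<in> S" "s \<longlonglongrightarrow> x"
    unfolding closure_sequential by metis
  then have "\<forall>n. c *\<^sub>R s n \<in> S" "(\<lambda>n. c *\<^sub>R s n) \<longlonglongrightarrow> c *\<^sub>R x"
    using assms by (auto intro: subspace_scale tendsto_intros)
  then show "c *\<^sub>R x \<in> closure S" unfolding closure_sequential by (intro exI conjI)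
qed

text \<open>By the parallelogram identity, the midpoint of two almost nearest points would be too
  close to \<open>x\<close> if the two points were far apart.\<close>

lemma Cauchy_minimizing:
  fixes x :: "'a::chilbert_space"
  assumes "subspace S" and s: "\<And>n. s n \<in> S"
    and d: "\<And>y. y \<in> S \<Longrightarrow> d \<le> (norm (x - y))\<^sup>2"
    and lim: "(\<lambda>n. (norm (x - s n))\<^sup>2) \<longlonglongrightarrow> d"
  shows "Cauchy s"
proof (rule metric_CauchyI)
  fix e :: real assume "0 < e"
  then have "d < d + e\<^sup>2 / 4" by simp
  from order_tendstoD(2)[OF lim this] obtain N
    where N: "\<And>n. n \<ge> N \<Longrightarrow> (norm (x - s n))\<^sup>2 < d + e\<^sup>2 / 4"
    by (auto simp: eventually_sequentially)
  have "dist (s m) (s n) < e" if "m \<ge> N" "n \<ge> N" for m n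
  proof -
    let ?h = "(1/2) *\<^sub>R (s m + s n)"
    have "?h \<in> S" using assms(1) s by (intro subspace_scale subspace_add)
    then have h: "d \<le> (norm (x - ?h))\<^sup>2" by (rule d)
    have "(norm (s m - s n))\<^sup>2 = 2 * (norm (x - s m))\<^sup>2 + 2 * (norm (x - s n))\<^sup>2 - 4 * (norm (x - ?h))\<^sup>2"
      unfolding power2_norm_eq_inner
      by (simp add: inner_diff_left inner_diff_right inner_add_left inner_add_right inner_commute algebra_simps)
    with h N[OF that(1)] N[OF that(2)] have "(norm (s m - s n))\<^sup>2 < e\<^sup>2" by simp
    then show ?thesis using \<open>0 < e\<close> by (simp add: dist_norm power2_less_imp_less)
  qed
  then show "\<exists>M. \<forall>m\<ge>M. \<forall>n\<ge>M. dist (s m) (s n) < e" by blast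
qed

text \<open>The nearest point exists by completeness; the remainder is orthogonal because moving the
  point along \<open>y\<close> cannot shorten the distance.\<close>

lemma orthogonal_projection_exists:
  fixes x :: "'a::chilbert_space"
  assumes S: "subspace S" "closed S"
  obtains p where "p \<in> S" "\<And>y. y \<in> S \<Longrightarrow> inner (x - p) y = 0"
proof -
  let ?D = "(\<lambda>y. (norm (x - y))\<^sup>2) ` S"
  define d where "d = Inf ?D"
  have ne: "?D \<noteq> {}" using subspace_0[OF S(1)] by blast
  have bdd: "bdd_below ?D" by (rule bdd_belowI2[where m = 0]) simp
  have d: "d \<le> (norm (x - y))\<^sup>2" if "y \<in> S" for y
    unfolding d_def by (rule cInf_lower[OF _ bdd]) (use that in blast)
  have "\<exists>y\<in>S. (norm (x - y))\<^sup>2 < d + 1 / real (Suc n)" for n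
  proof -
    have "d < d + 1 / real (Suc n)" by simp
    then show ?thesis
      unfolding d_def using cInf_lessD[OF ne] by blast
  qed
  then obtain s where s: "\<And>n. s n \<in> S" and sl: "\<And>n. (norm (x - s n))\<^sup>2 < d + 1 / real (Suc n)"
    by metis
  have lim: "(\<lambda>n. (norm (x - s n))\<^sup>2) \<longlonglongrightarrow> d"
  proof (rule tendsto_sandwich)
    show "(\<lambda>n. d) \<longlonglongrightarrow> d" by simp
    show "(\<lambda>n. d + 1 / real (Suc n)) \<longlonglongrightarrow> d"
      using tendsto_add[OF tendsto_const LIMSEQ_inverse_real_of_nat, of d] by (simp add: inverse_eq_divide)
  qed (use s d sl in \<open>auto intro!: eventuallyI less_imp_le\<close>)
  from Cauchy_minimizing[OF S(1) s d lim] obtain p where p: "s \<longlonglongrightarrow> p"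
    using Cauchy_convergent convergent_def by blast
  have pS: "p \<in> S" using S(2) s p by (metis closed_sequentially)
  have "(\<lambda>n. (norm (x - s n))\<^sup>2) \<longlonglongrightarrow> (norm (x - p))\<^sup>2"
    by (intro tendsto_intros p)
  then have pd: "(norm (x - p))\<^sup>2 = d" using lim LIMSEQ_unique by blast
  have "inner (x - p) y = 0" if "y \<in> S" for y
  proof (cases "y = 0")
    case False
    \<comment> \<open>The coefficient minimizing the distance from \<open>x\<close> to the line
      through \<open>p\<close> in direction \<open>y\<close>.\<close>
    define r where "r = inner (x - p) y / (norm y)\<^sup>2"
    have "p + r *\<^sub>R y \<in> S" using S(1) pS that by (intro subspace_add subspace_scale)
    from d[OF this] have "(norm (x - p))\<^sup>2 \<le> (norm ((x - p) - r *\<^sub>R y))\<^sup>2"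
      by (simp add: pd diff_diff_eq)
    also have "\<dots> = (norm (x - p))\<^sup>2 - 2 * r * inner (x - p) y + r\<^sup>2 * (norm y)\<^sup>2"
      unfolding power2_norm_eq_inner
      by (simp add: inner_diff_left inner_diff_right inner_commute power2_eq_square algebra_simps)
    also have "\<dots> = (norm (x - p))\<^sup>2 - (inner (x - p) y)\<^sup>2 / (norm y)\<^sup>2"
      using False by (simp add: r_def power2_eq_square field_simps)
    finally have "(inner (x - p) y)\<^sup>2 / (norm y)\<^sup>2 \<le> 0" by simp
    then show ?thesis using False by (simp add: divide_le_0_iff zero_less_power2)
  qed simp
  with pS show ?thesis by (rule that)
qed

lemma Riesz_representation:
  fixes f :: "'a::chilbert_space \<Rightarrow> real"
  assumes f: "bounded_linear f"
  obtains y where "\<And>x. f x = inner y x"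
proof (cases "\<forall>x. f x = 0")
  case True
  then show ?thesis using that[of 0] by simp
next
  case False
  then obtain a where a: "f a \<noteq> 0" by blast
  interpret f: bounded_linear f by (rule f)
  let ?S = "{x. f x = 0}"
  have "subspace ?S" by (simp add: subspace_def f.add f.scaleR f.zero)
  moreover have "closed ?S"
    by (intro closed_Collect_eq continuous_on_const linear_continuous_on f)
  ultimately obtain p where p: "f p = 0" "\<And>y. f y = 0 \<Longrightarrow> inner (a - p) y = 0"
    using orthogonal_projection_exists[of ?S a] by auto
  define u where "u = a - p"
  have fu: "f u \<noteq> 0" using a p(1) by (simp add: u_def f.diff)
  then have u: "u \<noteq> 0" using f.zero by auto
  have "f x = inner ((f u / inner u u) *\<^sub>R u) x" for x
  proof -
    have "f (x - (f x / f u) *\<^sub>R u) = 0" using fu by (simp add: f.diff f.scaleR)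
    from p(2)[OF this] have "inner u x = f x / f u * inner u u"
      by (simp add: u_def[symmetric] inner_diff_right)
    then show ?thesis using fu u by simp
  qed
  then show ?thesis by (rule that)
qed

text \<open>A linear relation dominated by a bound is closable, and its closure is the graph of a bounded
  operator on the closure of its domain.\<close>

lemma bounded_extension:
  fixes S :: "('a::chilbert_space \<times> 'b::banach) set"
  assumes S: "subspace S" and C: "\<And>x y. (x, y) \<in> S \<Longrightarrow> norm y \<le> C * norm x"
    and V: "fst ` S = V"
  shows "\<exists>T :: 'a \<Rightarrow>\<^sub>L 'b. (\<forall>(x, y)\<in>S. T x = y) \<and>
    (\<forall>z. (\<forall>x\<in>closure V. inner z x = 0) \<longrightarrow> T z = 0) \<and>
    (\<forall>x\<in>closure V. (x, T x) \<in> closure S)"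
proof -
  let ?K = "closure S" let ?D = "closure V"
  have K: "subspace ?K" using S by (rule subspace_closure) 
  have "subspace V" unfolding V[symmetric] using S by (rule linear_subspace_image[OF bounded_linear.linear[OF bounded_linear_fst]])
  then have D: "subspace ?D" by (rule subspace_closure)
  have CK: "norm y \<le> C * norm x" if "(x, y) \<in> ?K" for x y
  proof -
    have "?K \<subseteq> {p. norm (snd p) \<le> C * norm (fst p)}"
      by (rule closure_minimal) (use C in \<open>auto intro!: closed_Collect_le continuous_intros\<close>)
    then show ?thesis using that by auto
  qed
  have uniq: "y = y'" if "(x, y) \<in> ?K" "(x, y') \<in> ?K" for x y y'
  proof -
    have "(x - x, y - y') \<in> ?K" using subspace_diff[OF K that] by simp
    from CK[OF this] show ?thesis by simp
  qed
  have ex: "\<exists>y. (x, y) \<in> ?K" if "x \<in> ?D" for x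
  proof -
    from that obtain s where "\<And>n. s n \<in> fst ` S" and sx: "s \<longlonglongrightarrow> x"
      unfolding closure_sequential V[symmetric] by blast
    then have "\<forall>n. \<exists>y. (s n, y) \<in> S" by force
    then obtain t where t: "\<And>n. (s n, t n) \<in> S" by metis
    have "Cauchy t"
    proof (rule metric_CauchyI)
      fix e :: real assume e: "0 < e"
      have C1: "0 < \<bar>C\<bar> + 1" by simp
      have "Cauchy s" using sx by (rule LIMSEQ_imp_Cauchy)
      then obtain N where N: "\<And>m n. m \<ge> N \<Longrightarrow> n \<ge> N \<Longrightarrow> dist (s m) (s n) < e / (\<bar>C\<bar> + 1)"
        using metric_CauchyD[of s "e / (\<bar>C\<bar> + 1)"] e C1 by (meson divide_pos_pos)
      have "dist (t m) (t n) < e" if "m \<ge> N" "n \<ge> N" for m n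
      proof -
        have "(s m - s n, t m - t n) \<in> S" using subspace_diff[OF S t t, of m n] by simp
        then have "norm (t m - t n) \<le> C * norm (s m - s n)" by (rule C)
        also have "\<dots> \<le> (\<bar>C\<bar> + 1) * norm (s m - s n)" by (intro mult_right_mono) auto
        also have "\<dots> < e" using N[OF that] C1 by (simp add: dist_norm field_simps)
        finally show ?thesis by (simp add: dist_norm)
      qed
      then show "\<exists>M. \<forall>m\<ge>M. \<forall>n\<ge>M. dist (t m) (t n) < e" by blast
    qed
    then obtain y where "t \<longlonglongrightarrow> y" using Cauchy_convergent convergent_def by blast
    then have "(\<lambda>n. (s n, t n)) \<longlonglongrightarrow> (x, y)" using sx by (intro tendsto_Pair)
    then have "(x, y) \<in> ?K" unfolding closure_sequential using t by (intro exI conjI allI)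
    then show ?thesis ..
  qed
  \<comment> \<open>\<open>P\<close> is the orthogonal projection onto the closed domain; composing
    with it extends the operator by zero on the orthogonal complement.\<close>
  define P where "P x = (SOME p. p \<in> ?D \<and> (\<forall>y\<in>?D. inner (x - p) y = 0))" for x
  have P: "P x \<in> ?D" "\<And>y. y \<in> ?D \<Longrightarrow> inner (x - P x) y = 0" for x
  proof -
    have "\<exists>p. p \<in> ?D \<and> (\<forall>y\<in>?D. inner (x - p) y = 0)"
      using orthogonal_projection_exists[OF D closed_closure, of x] by metis
    from someI_ex[OF this] have "P x \<in> ?D \<and> (\<forall>y\<in>?D. inner (x - P x) y = 0)"
      unfolding P_def .
    then show "P x \<in> ?D" "\<And>y. y \<in> ?D \<Longrightarrow> inner (x - P x) y = 0"
      by simp_all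
  qed
  have P_eq: "P x = p" if "p \<in> ?D" "\<And>y. y \<in> ?D \<Longrightarrow> inner (x - p) y = 0" for x p
  proof -
    have m: "P x - p \<in> ?D" using D P(1) that(1) by (rule subspace_diff)
    from P(2)[OF m, of x] that(2)[OF m] have "inner (P x - p) (P x - p) = 0"
      unfolding inner_diff_left by simp
    then show ?thesis by simp
  qed
  define T where "T x = (THE y. (P x, y) \<in> ?K)" for x
  have T: "(P x, T x) \<in> ?K" for x
    unfolding T_def using theI'[of "\<lambda>y. (P x, y) \<in> ?K"] ex[OF P(1)] uniq by blast
  have T_eq: "T x = y" if "(P x, y) \<in> ?K" for x y using uniq[OF T that] .
  have P_add: "P (x + y) = P x + P y" for x y
    by (rule P_eq) (use P D in \<open>auto intro: subspace_add simp: add_diff_add inner_add_left\<close>)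
  have P_scale: "P (r *\<^sub>R x) = r *\<^sub>R P x" for r x
    by (rule P_eq) (use P D in \<open>auto intro: subspace_scale simp: scaleR_diff_right[symmetric]\<close>)
  have P_norm: "norm (P x) \<le> norm x" for x
  proof -
    have "(norm x)\<^sup>2 = (norm (P x))\<^sup>2 + (norm (x - P x))\<^sup>2"
      using P(2)[OF P(1), of x x] unfolding power2_norm_eq_inner
      by (simp add: inner_diff_left inner_diff_right inner_commute)
    then have "(norm (P x))\<^sup>2 \<le> (norm x)\<^sup>2" by simp
    then show ?thesis by (rule power2_le_imp_le) simp
  qed
  have bl: "bounded_linear T"
  proof (rule bounded_linear_intro[where K = "\<bar>C\<bar>"])
    show "T (x + y) = T x + T y" for x y
      by (rule T_eq) (use subspace_add[OF K T T, of x y] in \<open>simp add: P_add\<close>)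
    show "T (r *\<^sub>R x) = r *\<^sub>R T x" for r x
      by (rule T_eq) (use subspace_scale[OF K T, of r x] in \<open>simp add: P_scale\<close>)
    fix x
    have "norm (T x) \<le> C * norm (P x)" by (rule CK[OF T])
    also have "\<dots> \<le> \<bar>C\<bar> * norm x" by (intro mult_mono P_norm) auto
    finally show "norm (T x) \<le> norm x * \<bar>C\<bar>" by (simp add: mult.commute)
  qed
  have PD: "P x = x" if "x \<in> ?D" for x by (rule P_eq) (use that in simp_all)
  have 1: "T x = y" if "(x, y) \<in> S" for x y
  proof (rule T_eq)
    have "x \<in> ?D" using that closure_subset[of V] by (force simp: V[symmetric])
    then show "(P x, y) \<in> ?K" using that closure_subset[of S] by (auto simp: PD)
  qed
  have 2: "T z = 0" if "\<forall>x\<in>?D. inner z x = 0" for z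
  proof (rule T_eq)
    have "P z = 0" by (rule P_eq) (use that D in \<open>auto intro: subspace_0\<close>)
    then show "(P z, 0) \<in> ?K" using subspace_0[OF K] by (simp add: zero_prod_def)
  qed
  have 3: "(x, T x) \<in> ?K" if "x \<in> ?D" for x using T[of x] PD[OF that] by simp
  from 1 2 3 show ?thesis
    by (intro exI[of _ "Blinfun T"]) (auto simp: bounded_linear_Blinfun_apply[OF bl])
qed

text \<open>The linear span is taken over the reals.\<close>

definition dense_span :: "'a::chilbert_space set \<Rightarrow> bool"
  where "dense_span V \<longleftrightarrow> closure (span V) = UNIV"

lemma dense_spanI:
  assumes "\<And>x. (\<And>v. v \<in> V \<Longrightarrow> inner v x = 0) \<Longrightarrow> x = 0"
  shows "dense_span V"
proof -
  have "x \<in> closure (span V)" for x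
  proof -
    obtain p where p: "p \<in> closure (span V)" "\<And>y. y \<in> closure (span V) \<Longrightarrow> inner (x - p) y = 0"
      using orthogonal_projection_exists[OF subspace_closure[OF subspace_span] closed_closure]
      by blast
    have "x - p = 0"
    proof (rule assms)
      fix v assume "v \<in> V"
      then have "v \<in> closure (span V)" using span_base closure_subset by blast
      from p(2)[OF this] show "inner v (x - p) = 0" by (simp add: inner_commute)
    qed
    then show ?thesis using p(1) by simp
  qed
  then show ?thesis unfolding dense_span_def by blast
qed

lemma dense_span_mono: "dense_span V \<Longrightarrow> V \<subseteq> W \<Longrightarrow> dense_span W"
  unfolding dense_span_def using closure_mono[OF span_mono] by blast

lemma dense_span_eqI:
  fixes S T :: "'a::chilbert_space \<Rightarrow>\<^sub>L 'b::real_normed_vector"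
  assumes "dense_span V" "\<And>v. v \<in> V \<Longrightarrow> S v = T v"
  shows "S = T"
proof (rule blinfun_eqI)
  fix x
  have "span V \<subseteq> {x. S x = T x}"
    by (rule span_minimal) (auto simp: assms(2) subspace_def blinfun.add_right blinfun.scaleR_right)
  then have "closure (span V) \<subseteq> {x. S x = T x}"
    by (rule closure_minimal) (auto intro!: closed_Collect_eq continuous_intros)
  then show "S x = T x" using assms(1) by (auto simp: dense_span_def)
qed

lemma dense_span_inner_eqI:
  fixes x y :: "'a::chilbert_space"
  assumes "dense_span V" "\<And>v. v \<in> V \<Longrightarrow> inner v x = inner v y"
  shows "x = y"
proof -
  have "blinfun_inner_left x = blinfun_inner_left y"
    by (rule dense_span_eqI[OF assms(1)]) (simp add: assms(2) inner_commute)
  then have "blinfun_inner_left x (x - y) = blinfun_inner_left y (x - y)" by simp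
  then have "inner (x - y) (x - y) = 0" by (simp add: inner_diff_left inner_diff_right inner_commute)
  then show ?thesis by simp
qed

text \<open>Equality of the Gram matrices makes the real span of the pairs \<open>(v i, w i)\<close>
  the graph of an isometry. Symmetries given only on a generating family thereby become operators:
  the adjoint map on tracial vectors, second quantizations and orthogonal actions all arise this
  way.\<close>

lemma isometric_extension:
  fixes v :: "'i \<Rightarrow> 'a::chilbert_space" and w :: "'i \<Rightarrow> 'b::chilbert_space"
  assumes gram: "\<And>i j. inner (v i) (v j) = inner (w i) (w j)"
  shows "\<exists>T :: 'a \<Rightarrow>\<^sub>L 'b. (\<forall>i. T (v i) = w i) \<and> (\<forall>z. (\<forall>i. inner z (v i) = 0) \<longrightarrow> T z = 0) \<and>
    (\<forall>x\<in>closure (span (range v)). \<forall>y\<in>closure (span (range v)). inner (T x) (T y) = inner x y) \<and>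
    (\<forall>x. T x \<in> closure (span (range w)))"
proof -
  let ?G = "range (\<lambda>i. (v i, w i))" 
  let ?S = "span ?G"
  have g1: "inner (fst p) (v j) = inner (snd p) (w j)" if "p \<in> ?S" for p j
  proof -
    have "?S \<subseteq> {p. inner (fst p) (v j) = inner (snd p) (w j)}"
      by (rule span_minimal) (auto simp: gram subspace_def inner_add_left)
    then show ?thesis using that by blast
  qed
  have g2: "inner (fst p) (fst q) = inner (snd p) (snd q)" if "p \<in> ?S" "q \<in> ?S" for p q
  proof -
    have "?S \<subseteq> {q. inner (fst p) (fst q) = inner (snd p) (snd q)}"
      by (rule span_minimal) (auto simp: g1[OF that(1)] subspace_def inner_add_right)
    then show ?thesis using that by blast
  qed
  have fstS: "fst ` ?S = span (range v)"
    using span_linear_image[OF bounded_linear.linear[OF bounded_linear_fst], of ?G]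
    by (simp add: image_image)
  have sndS: "snd ` ?S = span (range w)"
    using span_linear_image[OF bounded_linear.linear[OF bounded_linear_snd], of ?G]
    by (simp add: image_image)
  have bound: "norm y \<le> 1 * norm x" if "(x, y) \<in> ?S" for x y
    using g2[OF that that] by (simp add: norm_eq_sqrt_inner)
  obtain T :: "'a \<Rightarrow>\<^sub>L 'b" where
    T: "\<forall>(x, y)\<in>?S. T x = y"
      "\<forall>z. (\<forall>x\<in>closure (span (range v)). inner z x = 0) \<longrightarrow> T z = 0"
      "\<forall>x\<in>closure (span (range v)). (x, T x) \<in> closure ?S"
    using bounded_extension[OF subspace_span bound fstS] by auto
  have Tv: "T (v i) = w i" for i
    using T(1) span_base[of "(v i, w i)" ?G] by auto
  have iso: "inner (T x) (T y) = inner x y" if "x \<in> closure (span (range v))" "y \<in> closure (span (range v))" for x y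
  proof -
    have 1: "inner (T a) (T (v i)) = inner a (v i)" if "a \<in> closure (span (range v))" for a i
    proof -
      have "span (range v) \<subseteq> {a. inner (T a) (T (v i)) = inner a (v i)}"
        by (rule span_minimal) (auto simp: gram Tv subspace_def blinfun.add_right blinfun.scaleR_right inner_add_left)
      then have "closure (span (range v)) \<subseteq> {a. inner (T a) (T (v i)) = inner a (v i)}"
        by (rule closure_minimal) (auto intro!: closed_Collect_eq continuous_intros)
      then show ?thesis using that by blast
    qed
    have "span (range v) \<subseteq> {b. inner (T x) (T b) = inner x b}"
      by (rule span_minimal) (auto simp: 1[OF that(1)] subspace_def blinfun.add_right blinfun.scaleR_right inner_add_right)
    then have "closure (span (range v)) \<subseteq> {b. inner (T x) (T b) = inner x b}"
      by (rule closure_minimal) (auto intro!: closed_Collect_eq continuous_intros)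
    then show ?thesis using that by blast
  qed
  have orth: "T z = 0" if "\<And>i. inner z (v i) = 0" for z
  proof (rule T(2)[rule_format])
    fix x assume x: "x \<in> closure (span (range v))"
    have "span (range v) \<subseteq> {x. inner z x = 0}"
      by (rule span_minimal) (auto simp: that subspace_def inner_add_right)
    then have "closure (span (range v)) \<subseteq> {x. inner z x = 0}"
      by (rule closure_minimal) (auto intro!: closed_Collect_eq continuous_intros)
    then show "inner z x = 0" using x by blast
  qed
  have ran: "T x \<in> closure (span (range w))" for x
  proof -
    obtain p where p: "p \<in> closure (span (range v))" "\<And>y. y \<in> closure (span (range v)) \<Longrightarrow> inner (x - p) y = 0"
      using orthogonal_projection_exists[OF subspace_closure[OF subspace_span] closed_closure] by blast
    have "T (x - p) = 0" by (rule T(2)[rule_format]) (rule p(2))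
    then have "T x = T p" by (simp add: blinfun.diff_right)
    moreover have "snd (p, T p) \<in> closure (snd ` ?S)"
    proof -
      have "snd ` closure ?S \<subseteq> closure (snd ` ?S)"
        by (intro image_closure_subset closure_subset closed_closure continuous_intros)
      then show ?thesis using T(3)[rule_format, OF p(1)] by blast
    qed
    ultimately show ?thesis by (simp add: sndS)
  qed
  from Tv orth iso ran show ?thesis by blast
qed

section \<open>Operators on complex Hilbert spaces\<close>

lemma scaleC_one [simp]: "1 *\<^sub>C (x :: 'a::chilbert_space) = x"
  using scaleR_scaleC[of 1 x] by simp

lemma scaleC_zero_left [simp]: "0 *\<^sub>C (x :: 'a::chilbert_space) = 0"
  using scaleR_scaleC[of 0 x] by simp

lemma scaleC_of_real: "complex_of_real r *\<^sub>C (x :: 'a::chilbert_space) = r *\<^sub>R x"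
  by (simp add: scaleR_scaleC)

lemma scaleC_zero_right [simp]: "c *\<^sub>C (0 :: 'a::chilbert_space) = 0"
  using bounded_linear.linear[OF bounded_linear_scaleC[of c]] by (rule linear_0)

lemma scaleC_diff_right: "c *\<^sub>C (x - y :: 'a::chilbert_space) = c *\<^sub>C x - c *\<^sub>C y"
  using bounded_linear.linear[OF bounded_linear_scaleC[of c]] by (rule linear_diff)

lemma cinner_add_left: "cinner (x + y) z = cinner x z + cinner y (z :: 'a::chilbert_space)"
  by (metis cinner_add_right cinner_commute complex_cnj_add)

lemma cinner_scaleC_left: "cinner (c *\<^sub>C x) (y :: 'a::chilbert_space) = cnj c * cinner x y"
  by (metis cinner_commute cinner_scaleC_right complex_cnj_mult)

lemma cinner_scaleR_right: "cinner x (r *\<^sub>R y :: 'a::chilbert_space) = complex_of_real r * cinner x y"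
  by (simp add: scaleR_scaleC cinner_scaleC_right)

lemma cinner_scaleR_left: "cinner (r *\<^sub>R x :: 'a::chilbert_space) y = complex_of_real r * cinner x y"
  by (simp add: scaleR_scaleC cinner_scaleC_left)

lemma cinner_zero_right [simp]: "cinner x (0 :: 'a::chilbert_space) = 0"
  using cinner_scaleC_right[of x 0 0] by simp

lemma cinner_zero_left [simp]: "cinner (0 :: 'a::chilbert_space) x = 0"
  using cinner_scaleC_left[of 0 0 x] by simp

lemma cinner_minus_right: "cinner x (- y :: 'a::chilbert_space) = - cinner x y"
  using cinner_scaleR_right[of x "- 1" y] by simp

lemma cinner_minus_left: "cinner (- x :: 'a::chilbert_space) y = - cinner x y"
  using cinner_scaleR_left[of "- 1" x y] by simp

lemma cinner_diff_right: "cinner x (y - z :: 'a::chilbert_space) = cinner x y - cinner x z"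
  using cinner_add_right[of x y "- z"] by (simp add: cinner_minus_right)

lemma cinner_diff_left: "cinner (x - y :: 'a::chilbert_space) z = cinner x z - cinner y z"
  using cinner_add_left[of x "- y" z] by (simp add: cinner_minus_left)

lemma cinner_sum_right: "cinner x (\<Sum>i\<in>F. f i :: 'a::chilbert_space) = (\<Sum>i\<in>F. cinner x (f i))"
  by (induction F rule: infinite_finite_induct) (simp_all add: cinner_add_right)

lemma cinner_sum_left: "cinner (\<Sum>i\<in>F. f i :: 'a::chilbert_space) x = (\<Sum>i\<in>F. cinner (f i) x)"
  by (induction F rule: infinite_finite_induct) (simp_all add: cinner_add_left)

lemma Re_cinner: "Re (cinner x y) = inner x (y :: 'a::chilbert_space)"
  by (simp add: inner_eq_Re_cinner)

lemma Im_cinner: "Im (cinner x y) = - inner x (\<i> *\<^sub>C y :: 'a::chilbert_space)"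
  by (simp add: inner_eq_Re_cinner cinner_scaleC_right)

lemma cinner_eq_iff_inner:
  "cinner x y = cinner (z :: 'a::chilbert_space) (w :: 'a) \<longleftrightarrow>
    inner x y = inner z w \<and> inner x (\<i> *\<^sub>C y) = inner z (\<i> *\<^sub>C w)"
  by (auto simp: complex_eq_iff Re_cinner Im_cinner)

text \<open>A phase \<open>c\<close> makes the inner product real and nonnegative, after which the
  real Cauchy-Schwarz inequality applies.\<close>

lemma norm_cinner_le: "cmod (cinner x y) \<le> norm x * norm (y :: 'a::chilbert_space)"
proof -
  obtain c where c: "cmod c = 1" "c * cinner x y = complex_of_real (cmod (cinner x y))"
  proof (cases "cinner x y = 0")
    case False
    show ?thesis
    proof (rule that[of "cnj (sgn (cinner x y))"])
      show "cmod (cnj (sgn (cinner x y))) = 1" using False by (simp add: norm_sgn)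
      show "cnj (sgn (cinner x y)) * cinner x y = complex_of_real (cmod (cinner x y))"
        using False complex_norm_square[of "cinner x y"]
        by (simp add: sgn_eq field_simps power2_eq_square)
    qed
  qed (use that[of 1] in simp)
  have "cmod (cinner x y) = Re (cinner x (c *\<^sub>C y))" by (simp add: cinner_scaleC_right c)
  also have "\<dots> \<le> norm x * norm (c *\<^sub>C y)"
    unfolding Re_cinner by (rule order_trans[OF abs_ge_self Cauchy_Schwarz_ineq2])
  finally show ?thesis by (simp add: norm_scaleC c)
qed

lemma bounded_linear_cinner_right: "bounded_linear (\<lambda>y. cinner (x :: 'a::chilbert_space) y)"
  by (rule bounded_linear_intro[where K = "norm x"])
     (simp_all add: cinner_add_right cinner_scaleR_right scaleR_conv_of_real norm_cinner_le mult.commute[of "norm _" "norm x"])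

lemma bounded_linear_cinner_left: "bounded_linear (\<lambda>x. cinner x (y :: 'a::chilbert_space))"
  by (rule bounded_linear_intro[where K = "norm y"])
     (simp_all add: cinner_add_left cinner_scaleR_left scaleR_conv_of_real norm_cinner_le)

lemmas tendsto_cinner_right = bounded_linear.tendsto[OF bounded_linear_cinner_right]
lemmas tendsto_scaleC = bounded_linear.tendsto[OF bounded_linear_scaleC]

lemma cinner_eqI:
  assumes "\<And>z. cinner z x = cinner z (y :: 'a::chilbert_space)"
  shows "x = y"
proof -
  have "cinner (x - y) (x - y) = 0" by (simp add: cinner_diff_right assms)
  then show ?thesis unfolding cinner_self by simp
qed

lemma clinear_opsD: "T \<in> clinear_ops \<Longrightarrow> blinfun_apply T (c *\<^sub>C x) = c *\<^sub>C T x"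
  by (simp add: clinear_ops_def)

lemma clinear_opsI: "(\<And>c x. blinfun_apply T (c *\<^sub>C x) = c *\<^sub>C T x) \<Longrightarrow> T \<in> clinear_ops"
  by (simp add: clinear_ops_def)

lemma clinear_ops_id [simp, intro]: "id_blinfun \<in> clinear_ops"
  by (simp add: clinear_ops_def)

lemma clinear_ops_compose [intro]: "S \<in> clinear_ops \<Longrightarrow> T \<in> clinear_ops \<Longrightarrow> S o\<^sub>L T \<in> clinear_ops"
  by (simp add: clinear_ops_def)

lemma clinear_ops_add [intro]: "S \<in> clinear_ops \<Longrightarrow> T \<in> clinear_ops \<Longrightarrow> S + T \<in> clinear_ops"
  by (simp add: clinear_ops_def blinfun.add_left scaleC_add_right)

lemma clinear_ops_diff [intro]: "S \<in> clinear_ops \<Longrightarrow> T \<in> clinear_ops \<Longrightarrow> S - T \<in> clinear_ops"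
  by (simp add: clinear_ops_def blinfun.diff_left scaleC_diff_right)

lemma clinear_ops_scaleC [intro]: "T \<in> clinear_ops \<Longrightarrow> c *\<^sub>C T \<in> clinear_ops"
  by (simp add: clinear_ops_def scaleC_blinfun.rep_eq scaleC_scaleC mult.commute)

lemma clinear_ops_zero [simp, intro]: "0 \<in> clinear_ops"
  by (simp add: clinear_ops_def)

lemma adj_unique:
  fixes S S' T :: "'h::chilbert_space \<Rightarrow>\<^sub>L 'h"
  assumes "\<forall>x y. cinner (S x) y = cinner x (T y)" "\<forall>x y. cinner (S' x) y = cinner x (T y)"
  shows "S = S'"
proof (rule blinfun_eqI, rule cinner_eqI)
  fix x z
  have "cinner (S x) z = cinner (S' x) z" using assms by simp
  then show "cinner z (S x) = cinner z (S' x)" by (metis cinner_commute)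
qed

text \<open>Riesz representation for the real inner product determines the real part; inserting
  \<open>\<i> *\<^sub>C y\<close> recovers the imaginary part. Two different spaces are allowed
  because the embedding \<open>V\<close> of the group space needs an adjoint.\<close>

lemma adjoint_exists:
  fixes T :: "'h::chilbert_space \<Rightarrow>\<^sub>L 'k::chilbert_space"
  assumes clin: "\<And>c x. T (c *\<^sub>C x) = c *\<^sub>C T x"
  shows "\<exists>S :: 'k \<Rightarrow>\<^sub>L 'h. \<forall>x y. cinner (S x) y = cinner x (T y)"
proof -
  have "\<exists>z. \<forall>y. inner x (T y) = inner z y" for x
  proof -
    have "bounded_linear (\<lambda>y. inner x (T y))"
      by (rule bounded_linear_compose[OF bounded_linear_inner_right blinfun.bounded_linear_right])
    from Riesz_representation[OF this] show ?thesis by metis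
  qed
  then obtain S where S: "\<And>x y. inner (S x) y = inner x (T y)" by metis
  have uniq: "a = b" if "\<And>y. inner a y = inner b y" for a b :: 'h
    using that[of "a - b"] by (metis inner_diff_left inner_eq_zero_iff right_minus_eq)
  have bl: "bounded_linear S"
  proof (rule bounded_linear_intro[where K = "norm T"])
    show "S (x + y) = S x + S y" for x y by (rule uniq) (simp add: S inner_add_left)
    show "S (r *\<^sub>R x) = r *\<^sub>R S x" for r x by (rule uniq) (simp add: S)
    fix x
    have "norm (S x) * norm (S x) = inner x (T (S x))"
      using S[of x "S x"] by (simp add: power2_norm_eq_inner flip: power2_eq_square)
    also have "\<dots> \<le> norm x * norm (T (S x))"
      by (rule order_trans[OF abs_ge_self Cauchy_Schwarz_ineq2])
    also have "\<dots> \<le> norm x * (norm T * norm (S x))" by (intro mult_left_mono norm_blinfun) simp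
    finally show "norm (S x) \<le> norm x * norm T"
      by (cases "norm (S x) = 0") (auto simp: mult.assoc[symmetric] mult_le_cancel_right)
  qed
  have "cinner (S x) y = cinner x (T y)" for x y
    using S[of x y] S[of x "\<i> *\<^sub>C y"] by (simp add: cinner_eq_iff_inner clin)
  then show ?thesis
    by (intro exI[of _ "Blinfun S"]) (simp add: bounded_linear_Blinfun_apply[OF bl])
qed

lemma adj_exists:
  fixes T :: "'h::chilbert_space \<Rightarrow>\<^sub>L 'h"
  assumes "T \<in> clinear_ops"
  shows "\<exists>S :: 'h \<Rightarrow>\<^sub>L 'h. \<forall>x y. cinner (S x) y = cinner x (T y)"
  by (rule adjoint_exists) (rule clinear_opsD[OF assms])

lemma adj_left:
  fixes T :: "'h::chilbert_space \<Rightarrow>\<^sub>L 'h"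
  assumes "T \<in> clinear_ops"
  shows "cinner (adj T x) y = cinner x (T y)"
proof -
  have "\<forall>x y. cinner (adj T x) y = cinner x (T y)"
    unfolding adj_def by (rule theI'[of "\<lambda>S. \<forall>x y. cinner (blinfun_apply S x) y = cinner x (T y)"])
      (use adj_exists[OF assms] adj_unique in blast)
  then show ?thesis by blast
qed

lemma adj_right: "T \<in> clinear_ops \<Longrightarrow> cinner x (adj T y) = cinner (blinfun_apply T x) y"
  by (metis adj_left cinner_commute)

lemma adj_eqI: "(\<And>x y. cinner (blinfun_apply S x) y = cinner x (blinfun_apply T y)) \<Longrightarrow> T \<in> clinear_ops \<Longrightarrow> adj T = S"
  by (rule adj_unique[of _ T]) (simp_all add: adj_left)

lemma clinear_ops_adj [intro]: "T \<in> clinear_ops \<Longrightarrow> adj T \<in> clinear_ops"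
  by (rule clinear_opsI, rule cinner_eqI) (simp add: adj_right cinner_scaleC_right)

lemma adj_adj [simp]: "T \<in> clinear_ops \<Longrightarrow> adj (adj T) = T"
  by (rule adj_eqI) (auto simp: adj_right)

lemma adj_compose: "S \<in> clinear_ops \<Longrightarrow> T \<in> clinear_ops \<Longrightarrow> adj (S o\<^sub>L T) = adj T o\<^sub>L adj S"
  by (rule adj_eqI) (auto simp: adj_left)

lemma adj_add: "S \<in> clinear_ops \<Longrightarrow> T \<in> clinear_ops \<Longrightarrow> adj (S + T) = adj S + adj T"
  by (rule adj_eqI) (auto simp: adj_left blinfun.add_left cinner_add_left cinner_add_right)

lemma adj_scaleC: "T \<in> clinear_ops \<Longrightarrow> adj (c *\<^sub>C T) = cnj c *\<^sub>C adj T"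
  by (rule adj_eqI) (auto simp: adj_left scaleC_blinfun.rep_eq cinner_scaleC_left cinner_scaleC_right)

lemma bounded_linear_compose_left: "bounded_linear (\<lambda>T. S o\<^sub>L (T :: 'a::real_normed_vector \<Rightarrow>\<^sub>L 'a))"
  by (rule bounded_bilinear.bounded_linear_right[OF bounded_bilinear_blinfun_compose])

lemma commutantI:
  "T \<in> clinear_ops \<Longrightarrow> (\<And>S. S \<in> A \<Longrightarrow> T o\<^sub>L S = S o\<^sub>L T) \<Longrightarrow> T \<in> commutant A"
  by (simp add: commutant_def)

lemma commutant_clinear: "T \<in> commutant A \<Longrightarrow> T \<in> clinear_ops"
  by (simp add: commutant_def)

lemma commutant_commute: "T \<in> commutant A \<Longrightarrow> S \<in> A \<Longrightarrow> T o\<^sub>L S = S o\<^sub>L T"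
  by (simp add: commutant_def)

lemma commutant_apply: "T \<in> commutant A \<Longrightarrow> S \<in> A \<Longrightarrow> blinfun_apply T (blinfun_apply S x) = S (T x)"
  using commutant_commute[of T A S] by (metis blinfun_apply_blinfun_compose)

lemma commutant_antimono: "A \<subseteq> B \<Longrightarrow> commutant B \<subseteq> commutant A"
  by (auto simp: commutant_def)

lemma subset_bicommutant: "A \<subseteq> clinear_ops \<Longrightarrow> A \<subseteq> commutant (commutant A)"
  by (auto simp: commutant_def)

lemma commutant_compose: "S \<in> commutant A \<Longrightarrow> T \<in> commutant A \<Longrightarrow> S o\<^sub>L T \<in> commutant A"
  by (rule commutantI) (auto simp: commutant_clinear commutant_apply intro!: blinfun_eqI)

lemma commutant_id: "id_blinfun \<in> commutant A"
  by (auto simp: commutant_def intro!: blinfun_eqI)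

lemma commutant_add: "S \<in> commutant A \<Longrightarrow> T \<in> commutant A \<Longrightarrow> S + T \<in> commutant A"
  by (rule commutantI)
    (auto simp: commutant_clinear commutant_apply blinfun.add_left blinfun.add_right intro!: blinfun_eqI)

lemma commutant_scaleC:
  assumes "A \<subseteq> clinear_ops" "S \<in> commutant A"
  shows "c *\<^sub>C S \<in> commutant A"
proof (rule commutantI)
  show "c *\<^sub>C S o\<^sub>L T = T o\<^sub>L c *\<^sub>C S" if "T \<in> A" for T
    using assms that by (intro blinfun_eqI)
      (auto simp: scaleC_blinfun.rep_eq commutant_apply[OF assms(2)] clinear_opsD[OF subsetD[OF assms(1)]])
qed (use assms in \<open>auto simp: commutant_clinear\<close>)

lemma commutant_adj:
  assumes "A \<subseteq> clinear_ops" "\<And>S. S \<in> A \<Longrightarrow> adj S \<in> A" "T \<in> commutant A"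
  shows "adj T \<in> commutant A"
proof (rule commutantI)
  have T: "T \<in> clinear_ops" using assms(3) by (rule commutant_clinear)
  then show "adj T \<in> clinear_ops" by auto
  fix S assume "S \<in> A"
  then have S: "S \<in> clinear_ops" "adj S \<in> A" using assms by auto
  have "adj (adj S o\<^sub>L T) = adj (T o\<^sub>L adj S)"
    using commutant_commute[OF assms(3) S(2)] by simp
  then show "adj T o\<^sub>L S = S o\<^sub>L adj T"
    using S T by (simp add: adj_compose clinear_ops_adj)
qed

text \<open>Commutants reverse inclusions, so the third commutant equals the first. Any self-adjoint
  set of operators thus generates an algebra without taking a topological closure.\<close>

lemma von_neumann_algebra_bicommutant:
  assumes A: "A \<subseteq> clinear_ops" "\<And>S. S \<in> A \<Longrightarrow> adj S \<in> A"
  shows "von_neumann_algebra (commutant (commutant A))"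
  unfolding von_neumann_algebra_def
proof (intro conjI ballI)
  have c: "commutant B \<subseteq> clinear_ops" for B :: "('a \<Rightarrow>\<^sub>L 'a) set" using commutant_clinear by blast
  show "commutant (commutant A) \<subseteq> clinear_ops" by (rule c)
  show "adj T \<in> commutant (commutant A)" if "T \<in> commutant (commutant A)" for T
    using c commutant_adj[OF A] that by (rule commutant_adj)
  show "commutant (commutant (commutant (commutant A))) = commutant (commutant A)"
    using subset_bicommutant[OF c] commutant_antimono by blast
qed

lemma positive_op_clinear: "positive_op T \<Longrightarrow> T \<in> clinear_ops"
  by (simp add: positive_op_def)

lemma positive_opD: "positive_op T \<Longrightarrow> cinner x (blinfun_apply T x) = complex_of_real (inner x (T x))"
  "positive_op T \<Longrightarrow> 0 \<le> inner x (blinfun_apply T x)"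
  by (auto simp: positive_op_def complex_nonneg_Reals_iff complex_eq_iff Re_cinner)

lemma positive_opI:
  fixes T :: "'h::chilbert_space \<Rightarrow>\<^sub>L 'h"
  assumes "T \<in> clinear_ops" "\<And>x. Im (cinner x (T x)) = 0" "\<And>x. 0 \<le> inner x (T x)"
  shows "positive_op T"
  using assms by (simp add: positive_op_def complex_nonneg_Reals_iff Re_cinner)

text \<open>Polarization: the forms at \<open>x + y\<close> and at
  \<open>x + \<i> *\<^sub>C y\<close> give the imaginary and the real part of the symmetry
  relation.\<close>

lemma self_adjointI:
  fixes T :: "'h::chilbert_space \<Rightarrow>\<^sub>L 'h"
  assumes T: "T \<in> clinear_ops" and im: "\<And>x. Im (cinner x (T x)) = 0"
  shows "adj T = T"
proof (rule adj_eqI[OF _ T])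
  fix x y
  have 1: "Im (cinner x (T y)) + Im (cinner y (T x)) = 0"
    using im[of "x + y"] im[of x] im[of y] by (simp add: blinfun.add_right cinner_add_left cinner_add_right)
  have 2: "Re (cinner x (T y)) - Re (cinner y (T x)) = 0"
    using im[of "x + \<i> *\<^sub>C y"] im[of x] im[of "y"]
    by (simp add: blinfun.add_right cinner_add_left cinner_add_right cinner_scaleC_left cinner_scaleC_right clinear_opsD[OF T])
  have "cinner x (T y) = cnj (cinner y (T x))" using 1 2 by (simp add: complex_eq_iff)
  then show "cinner (T x) y = cinner x (T y)" by (metis cinner_commute)
qed

lemma positive_op_adj: "positive_op T \<Longrightarrow> adj T = T"
  by (rule self_adjointI) (simp_all add: positive_op_clinear positive_opD(1))

text \<open>Positivity of the form at \<open>x - (1 / norm T) *\<^sub>R T x\<close> yields the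
  bound. It is what upgrades convergence of quadratic forms to convergence of vectors.\<close>

lemma positive_op_norm_le:
  fixes T :: "'h::chilbert_space \<Rightarrow>\<^sub>L 'h"
  assumes T: "positive_op T"
  shows "(norm (T x))\<^sup>2 \<le> norm T * inner x (T x)"
proof (cases "T = 0")
  case False
  let ?y = "T x" and ?r = "1 / norm T"
  have sym: "inner ?y z = inner x (T z)" for z
    using adj_left[OF positive_op_clinear[OF T], of x z] by (simp add: positive_op_adj[OF T] inner_eq_Re_cinner)
  have n: "0 < norm T" using False by simp
  have "0 \<le> inner (x - ?r *\<^sub>R ?y) (T (x - ?r *\<^sub>R ?y))" by (rule positive_opD(2)[OF T])
  also have "\<dots> = inner x (T x) - 2 * (?r * (norm ?y)\<^sup>2) + ?r * (?r * inner ?y (T ?y))"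
    unfolding power2_norm_eq_inner blinfun.diff_right blinfun.scaleR_right inner_diff_left inner_diff_right
      inner_scaleR_left inner_scaleR_right sym[of "?y", symmetric]
    by (simp only: algebra_simps)
  also have "?r * (?r * inner ?y (T ?y)) \<le> ?r * (?r * (norm T * (norm ?y)\<^sup>2))"
  proof -
    have "inner ?y (T ?y) \<le> norm ?y * norm (T ?y)" by (rule order_trans[OF abs_ge_self Cauchy_Schwarz_ineq2])
    also have "\<dots> \<le> norm ?y * (norm T * norm ?y)" by (intro mult_left_mono norm_blinfun) simp
    finally show ?thesis using n by (intro mult_left_mono) (auto simp: power2_eq_square mult_ac)
  qed
  also have "?r * (?r * (norm T * (norm ?y)\<^sup>2)) = ?r * (norm ?y)\<^sup>2" using n by simp
  finally have "?r * (norm ?y)\<^sup>2 \<le> inner x (T x)" by simp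
  then show ?thesis using n by (simp add: pos_divide_le_eq mult.commute)
qed simp

section \<open>Monotone limits and tracial vectors\<close>

lemma op_le_refl: "op_le x x"
  by (simp add: op_le_def positive_op_def)

lemma op_le_inner: "op_le x y \<Longrightarrow> inner \<xi> (blinfun_apply x \<xi>) \<le> inner \<xi> (y \<xi>)"
  unfolding op_le_def using positive_opD(2)[of "y - x" \<xi>] by (simp add: blinfun.diff_left inner_diff_right)

lemma op_leI:
  fixes x y :: "'h::chilbert_space \<Rightarrow>\<^sub>L 'h"
  assumes "positive_op x" "positive_op y" "\<And>\<xi>. inner \<xi> (x \<xi>) \<le> inner \<xi> (y \<xi>)"
  shows "op_le x y"
  unfolding op_le_def
proof (rule positive_opI)
  show "y - x \<in> clinear_ops" using assms positive_op_clinear by blast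
qed (use assms in \<open>simp_all add: blinfun.diff_left inner_diff_right cinner_diff_right positive_opD(1)\<close>)

lemma op_le_trans:
  assumes "positive_op x" "positive_op z" "op_le x y" "op_le y z"
  shows "op_le x z"
  using assms(1,2) by (rule op_leI) (meson assms(3,4) op_le_inner order_trans)

lemma positive_op_norm_mono:
  assumes x: "positive_op x" and xs: "op_le x s"
  shows "norm x \<le> norm s"
proof (cases "x = 0")
  case False
  have "norm (x \<xi>) \<le> sqrt (norm x * norm s) * norm \<xi>" for \<xi>
  proof -
    have "(norm (x \<xi>))\<^sup>2 \<le> norm x * inner \<xi> (x \<xi>)" by (rule positive_op_norm_le[OF x])
    also have "\<dots> \<le> norm x * (norm \<xi> * (norm s * norm \<xi>))"
    proof (rule mult_left_mono)
      have "inner \<xi> (x \<xi>) \<le> inner \<xi> (s \<xi>)" using xs by (rule op_le_inner)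
      also have "\<dots> \<le> norm \<xi> * norm (s \<xi>)" by (rule order_trans[OF abs_ge_self Cauchy_Schwarz_ineq2])
      also have "\<dots> \<le> norm \<xi> * (norm s * norm \<xi>)" by (intro mult_left_mono norm_blinfun) simp
      finally show "inner \<xi> (x \<xi>) \<le> norm \<xi> * (norm s * norm \<xi>)" .
    qed simp
    also have "\<dots> = (sqrt (norm x * norm s) * norm \<xi>)\<^sup>2"
      by (simp add: power_mult_distrib) (simp add: power2_eq_square)
    finally show ?thesis by (rule power2_le_imp_le) simp
  qed
  then have "norm x \<le> sqrt (norm x * norm s)" by (intro norm_blinfun_bound) auto
  then have "(norm x)\<^sup>2 \<le> norm x * norm s" by (metis norm_ge_zero power_mono real_sqrt_pow2_iff zero_le_mult_iff)
  then show ?thesis using False by (simp add: power2_eq_square)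
qed simp

text \<open>Along the directed set the quadratic forms increase and are bounded, and
  \<open>positive_op_norm_le\<close> applied to differences turns this into a Cauchy condition for
  the vectors \<open>y \<xi>\<close>. The strong limit inherits commutation relations, which later
  places it in the algebra.\<close>

lemma directed_positive_limit:
  fixes D :: "('h::chilbert_space \<Rightarrow>\<^sub>L 'h) set"
  assumes ne: "D \<noteq> {}" and pos: "\<And>x. x \<in> D \<Longrightarrow> positive_op x"
    and dir: "\<And>x y. x \<in> D \<Longrightarrow> y \<in> D \<Longrightarrow> \<exists>z\<in>D. op_le x z \<and> op_le y z"
    and s: "\<And>x. x \<in> D \<Longrightarrow> op_le x s"
  shows "\<exists>u. positive_op u \<and> (\<forall>x\<in>D. op_le x u) \<and>
    (\<forall>\<xi> c. (\<forall>x\<in>D. inner \<xi> (x \<xi>) \<le> c) \<longrightarrow> inner \<xi> (u \<xi>) \<le> c) \<and>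
    (\<forall>T\<in>clinear_ops. (\<forall>x\<in>D. T o\<^sub>L x = x o\<^sub>L T) \<longrightarrow> T o\<^sub>L u = u o\<^sub>L T)"
proof -
  \<comment> \<open>The filter of tails of the directed set, in place of a net.\<close>
  define F where "F = (INF x\<in>D. principal {y \<in> D. op_le x y})"
  have evF: "eventually P F \<longleftrightarrow> (\<exists>x\<in>D. \<forall>y\<in>D. op_le x y \<longrightarrow> P y)" for P
    unfolding F_def
  proof (subst eventually_INF_base[OF ne])
    fix a b assume ab: "a \<in> D" "b \<in> D"
    from dir[OF ab] obtain z where z: "z \<in> D" "op_le a z" "op_le b z" by blast
    have "{y \<in> D. op_le z y} \<subseteq> {y \<in> D. op_le a y} \<inter> {y \<in> D. op_le b y}"
      using z ab pos op_le_trans by blast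
    then show "\<exists>x\<in>D. principal {y \<in> D. op_le x y}
        \<le> inf (principal {y \<in> D. op_le a y}) (principal {y \<in> D. op_le b y})"
      using z(1) by (intro bexI[of _ z]) auto
  qed (auto simp: eventually_principal)
  have nb: "F \<noteq> bot" 
  proof
    assume "F = bot"
    then have "eventually (\<lambda>_. False) F" by simp
    then show False unfolding evF using op_le_refl by blast
  qed
  have evD: "eventually (\<lambda>y. y \<in> D) F" using ne evF by blast
  have evge: "eventually (\<lambda>y. op_le x y) F" if "x \<in> D" for x using that evF by blast
  have "\<exists>l. ((\<lambda>y. blinfun_apply y \<xi>) \<longlongrightarrow> l) F" for \<xi>
  proof -
    let ?q = "\<lambda>x. inner \<xi> (blinfun_apply x \<xi>)"
    have bdd: "bdd_above (?q ` D)"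
      by (rule bdd_aboveI2[where M = "?q s"]) (use s op_le_inner in blast)
    have near: "norm (y \<xi> - x \<xi>) \<le> sqrt (norm s * (Sup (?q ` D) - ?q x))"
      if "x \<in> D" "y \<in> D" "op_le x y" for x y
    proof -
      have p: "positive_op (y - x)" using that(3) by (simp add: op_le_def)
      have ps: "op_le (y - x) s"
      proof -
        have sp: "positive_op s"
          unfolding positive_op_def
        proof (intro conjI allI)
          have "s = (s - x) + x" by simp
          then show "s \<in> clinear_ops" using s[OF that(1)] pos[OF that(1)] unfolding op_le_def
            by (metis clinear_ops_add positive_op_clinear)
          fix \<eta>
          have "cinner \<eta> (s \<eta>) = cinner \<eta> ((s - x) \<eta>) + cinner \<eta> (x \<eta>)"
            by (simp add: blinfun.diff_left cinner_diff_right)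
          then show "cinner \<eta> (s \<eta>) \<in> \<real>\<^sub>\<ge>\<^sub>0"
            using s[OF that(1)] pos[OF that(1)] by (simp add: op_le_def positive_op_def)
        qed
        show ?thesis
        proof (rule op_leI[OF p sp])
          fix \<eta>
          show "inner \<eta> ((y - x) \<eta>) \<le> inner \<eta> (s \<eta>)"
            using op_le_inner[OF s[OF that(2)], of \<eta>] positive_opD(2)[OF pos[OF that(1)], of \<eta>]
            by (simp add: blinfun.diff_left inner_diff_right)
        qed
      qed
      have "(norm ((y - x) \<xi>))\<^sup>2 \<le> norm (y - x) * inner \<xi> ((y - x) \<xi>)" by (rule positive_op_norm_le[OF p])
      also have "\<dots> \<le> norm s * inner \<xi> ((y - x) \<xi>)"
        by (intro mult_right_mono positive_op_norm_mono[OF p ps] positive_opD(2)[OF p])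
      also have "\<dots> \<le> norm s * (Sup (?q ` D) - ?q x)"
        using cSup_upper[OF imageI[OF that(2)] bdd]
        by (intro mult_left_mono) (auto simp: blinfun.diff_left inner_diff_right)
      finally show ?thesis by (intro real_le_rsqrt) (simp add: blinfun.diff_left)
    qed
    have "cauchy_filter (filtermap (\<lambda>y. blinfun_apply y \<xi>) F)"
      unfolding cauchy_filter_metric_filtermap
    proof (intro allI impI)
      fix e :: real assume e: "0 < e"
      \<comment> \<open>Chosen so that \<open>norm s * \<delta>\<close> is at most
        \<open>(e/3)\<^sup>2\<close>; the summand 1 avoids division by zero.\<close>
      define \<delta> where "\<delta> = (e/3)\<^sup>2 / (norm s + 1)"
      have \<delta>: "0 < \<delta>" unfolding \<delta>_def using e by (intro divide_pos_pos) (auto simp: add_nonneg_pos)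
      obtain x where x: "x \<in> D" "Sup (?q ` D) - \<delta> < ?q x"
        using less_cSupD[of "?q ` D" "Sup (?q ` D) - \<delta>"] ne \<delta> by auto
      have "norm s * (Sup (?q ` D) - ?q x) \<le> norm s * \<delta>" using x by (intro mult_left_mono) auto
      also have "\<dots> \<le> (e/3)\<^sup>2"
        unfolding \<delta>_def by (simp add: pos_divide_le_eq add_nonneg_pos) (simp add: mult_right_mono mult.commute)
      finally have "sqrt (norm s * (Sup (?q ` D) - ?q x)) \<le> e/3"
        using e by (intro real_le_lsqrt) auto
      then have n: "norm (y \<xi> - x \<xi>) \<le> e/3" if "y \<in> D" "op_le x y" for y
        using near[OF x(1) that] by linarith
      show "\<exists>P. eventually P F \<and> (\<forall>y z. P y \<and> P z \<longrightarrow> dist (y \<xi>) (z \<xi>) < e)"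
      proof (intro exI conjI allI impI)
        show "eventually (\<lambda>y. y \<in> D \<and> op_le x y) F" using evD evge[OF x(1)] by (rule eventually_conj)
        fix y z assume *: "(y \<in> D \<and> op_le x y) \<and> (z \<in> D \<and> op_le x z)"
        have "dist (y \<xi>) (z \<xi>) \<le> norm (y \<xi> - x \<xi>) + norm (z \<xi> - x \<xi>)"
          using dist_triangle[of "y \<xi>" "z \<xi>" "x \<xi>"] by (simp add: dist_norm norm_minus_commute)
        also have "\<dots> \<le> e/3 + e/3" using * by (intro add_mono n) auto
        finally show "dist (y \<xi>) (z \<xi>) < e" using e by simp
      qed
    qed
    from cauchy_filter_complete_converges[OF this complete_UNIV_cuspace] nb
    show ?thesis by (auto simp: filterlim_def filtermap_bot_iff)
  qed
  then obtain L where L: "\<And>\<xi>. ((\<lambda>y. blinfun_apply y \<xi>) \<longlongrightarrow> L \<xi>) F" by metis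
  have L_eqI: "L \<xi> = l" if "((\<lambda>y. blinfun_apply y \<xi>) \<longlongrightarrow> l) F" for \<xi> l
    using tendsto_unique[OF nb L that] .
  have bl: "bounded_linear L"
  proof (rule bounded_linear_intro[where K = "norm s"])
    show "L (x + y) = L x + L y" for x y
      by (rule L_eqI) (simp add: blinfun.add_right tendsto_add L)
    show "L (r *\<^sub>R x) = r *\<^sub>R L x" for r x
      by (rule L_eqI) (simp add: blinfun.scaleR_right tendsto_scaleR L)
    fix \<xi>
    show "norm (L \<xi>) \<le> norm \<xi> * norm s"
    proof (rule tendsto_upperbound[OF tendsto_norm[OF L] _ nb])
      show "\<forall>\<^sub>F y in F. norm (blinfun_apply y \<xi>) \<le> norm \<xi> * norm s"
      proof (rule eventually_mono[OF evD])
        fix y assume "y \<in> D"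
        then have "norm y \<le> norm s" by (intro positive_op_norm_mono pos s)
        then have "norm y * norm \<xi> \<le> norm s * norm \<xi>" by (rule mult_right_mono) simp
        then show "norm (y \<xi>) \<le> norm \<xi> * norm s" using norm_blinfun[of y \<xi>] by (simp add: mult.commute)
      qed
    qed
  qed
  define u where "u = Blinfun L"
  have u: "((\<lambda>y. blinfun_apply y \<xi>) \<longlongrightarrow> u \<xi>) F" for \<xi>
    using L[of \<xi>] by (simp add: u_def bounded_linear_Blinfun_apply[OF bl])
  have u_eqI: "u \<xi> = l" if "((\<lambda>y. blinfun_apply y \<xi>) \<longlongrightarrow> l) F" for \<xi> l
    using tendsto_unique[OF nb u that] .
  have cl: "u \<in> clinear_ops"
  proof (rule clinear_opsI, rule u_eqI)
    fix c x
    show "((\<lambda>y. blinfun_apply y (c *\<^sub>C x)) \<longlongrightarrow> c *\<^sub>C u x) F"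
    proof (rule Lim_transform_eventually[OF tendsto_scaleC[OF u]])
      show "\<forall>\<^sub>F y in F. c *\<^sub>C blinfun_apply y x = blinfun_apply y (c *\<^sub>C x)"
        using evD by eventually_elim (simp add: pos positive_op_clinear clinear_opsD)
    qed
  qed
  have lim: "((\<lambda>y. inner \<xi> (blinfun_apply y \<xi>)) \<longlongrightarrow> inner \<xi> (u \<xi>)) F" for \<xi>
    by (intro tendsto_intros u)
  have limc: "((\<lambda>y. Im (cinner \<xi> (blinfun_apply y \<xi>))) \<longlongrightarrow> Im (cinner \<xi> (u \<xi>))) F" for \<xi>
    by (intro tendsto_Im tendsto_cinner_right u)
  have pu: "positive_op u"
  proof (rule positive_opI[OF cl])
    fix \<xi>
    show "0 \<le> inner \<xi> (u \<xi>)"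
      by (rule tendsto_lowerbound[OF lim _ nb], rule eventually_mono[OF evD]) (simp add: pos positive_opD)
    have "((\<lambda>y. Im (cinner \<xi> (blinfun_apply y \<xi>))) \<longlongrightarrow> 0) F"
      by (rule tendsto_eventually, rule eventually_mono[OF evD]) (simp add: pos positive_opD(1))
    with tendsto_unique[OF nb limc] show "Im (cinner \<xi> (u \<xi>)) = 0" by blast
  qed
  have "op_le x u" if "x \<in> D" for x
  proof (rule op_leI[OF pos[OF that] pu])
    show "inner \<xi> (x \<xi>) \<le> inner \<xi> (u \<xi>)" for \<xi>
      by (rule tendsto_lowerbound[OF lim _ nb], rule eventually_mono[OF evge[OF that]]) (rule op_le_inner)
  qed
  moreover have "inner \<xi> (u \<xi>) \<le> c" if "\<forall>x\<in>D. inner \<xi> (x \<xi>) \<le> c" for \<xi> c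
    by (rule tendsto_upperbound[OF lim _ nb], rule eventually_mono[OF evD]) (use that in blast)
  moreover have "T o\<^sub>L u = u o\<^sub>L T" if "\<forall>x\<in>D. T o\<^sub>L x = x o\<^sub>L T" for T
  proof (rule blinfun_eqI)
    fix \<xi>
    have "((\<lambda>y. blinfun_apply T (blinfun_apply y \<xi>)) \<longlongrightarrow> T (u \<xi>)) F"
      by (intro tendsto_intros u)
    then have "((\<lambda>y. blinfun_apply y (blinfun_apply T \<xi>)) \<longlongrightarrow> T (u \<xi>)) F"
      by (rule Lim_transform_eventually, intro eventually_mono[OF evD])
        (use that in \<open>metis blinfun_apply_blinfun_compose\<close>)
    from u_eqI[OF this] show "(T o\<^sub>L u) \<xi> = (u o\<^sub>L T) \<xi>" by simp
  qed
  ultimately show ?thesis using pu by blast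
qed

definition vector_trace :: "'h::chilbert_space \<Rightarrow> ('h \<Rightarrow>\<^sub>L 'h) \<Rightarrow> ennreal"
  where "vector_trace \<Omega> x = ennreal (Re (cinner \<Omega> (x \<Omega>)))"

lemma von_neumann_algebra_closed:
  assumes "von_neumann_algebra A"
  shows "A \<subseteq> clinear_ops" "id_blinfun \<in> A"
    and "x \<in> A \<Longrightarrow> adj x \<in> A"
    and "x \<in> A \<Longrightarrow> y \<in> A \<Longrightarrow> x o\<^sub>L y \<in> A"
    and "x \<in> A \<Longrightarrow> y \<in> A \<Longrightarrow> x + y \<in> A"
    and "x \<in> A \<Longrightarrow> c *\<^sub>C x \<in> A"
proof -
  have A: "commutant (commutant A) = A" "A \<subseteq> clinear_ops" "x \<in> A \<Longrightarrow> adj x \<in> A"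
    using assms by (auto simp: von_neumann_algebra_def)
  have c: "commutant A \<subseteq> clinear_ops" using commutant_clinear by blast
  show "A \<subseteq> clinear_ops" "x \<in> A \<Longrightarrow> adj x \<in> A" by fact+
  show "id_blinfun \<in> A" "x \<in> A \<Longrightarrow> y \<in> A \<Longrightarrow> x o\<^sub>L y \<in> A" "x \<in> A \<Longrightarrow> y \<in> A \<Longrightarrow> x + y \<in> A"
      "x \<in> A \<Longrightarrow> c *\<^sub>C x \<in> A"
    using commutant_id commutant_compose commutant_add commutant_scaleC[OF c]
    by (metis A(1))+
qed

text \<open>Adding the scalar \<open>norm x\<close> to a self-adjoint \<open>x\<close> makes it
  positive; subtracting the scalar again gives the decomposition without functional
  calculus.\<close>

lemma self_adjoint_decomposition:
  fixes A :: "('h::chilbert_space \<Rightarrow>\<^sub>L 'h) set"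
  assumes A: "von_neumann_algebra A" and x: "x \<in> A" and sa: "adj x = x"
  shows "\<exists>a\<in>positive_part A. \<exists>b\<in>positive_part A. x = a - b"
proof -
  have cl: "x \<in> clinear_ops" using von_neumann_algebra_closed(1)[OF A] x by blast
  have real: "Im (cinner \<xi> (x \<xi>)) = 0" for \<xi>
  proof -
    have "cinner \<xi> (x \<xi>) = cnj (cinner \<xi> (x \<xi>))"
      using adj_left[OF cl, of \<xi> \<xi>] cinner_commute[of \<xi> "x \<xi>"] by (simp add: sa)
    from arg_cong[OF this, of Im] show ?thesis by simp
  qed
  let ?n = "complex_of_real (norm x) *\<^sub>C id_blinfun :: 'h \<Rightarrow>\<^sub>L 'h"
  have n: "?n \<in> A" by (rule von_neumann_algebra_closed(6)[OF A von_neumann_algebra_closed(2)[OF A]])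
  have nap: "?n \<xi> = norm x *\<^sub>R \<xi>" for \<xi> by (simp add: scaleC_blinfun.rep_eq scaleC_of_real)
  have ncl: "?n \<in> clinear_ops" by blast
  have "positive_op ?n"
    by (rule positive_opI[OF ncl]) (simp_all add: nap cinner_scaleR_right cinner_self)
  then have 1: "?n \<in> positive_part A" using n by (simp add: positive_part_def)
  have "positive_op (?n + x)"
  proof (rule positive_opI)
    show "?n + x \<in> clinear_ops" using ncl cl by (rule clinear_ops_add)
    fix \<xi>
    show "Im (cinner \<xi> ((?n + x) \<xi>)) = 0"
      by (simp add: blinfun.add_left nap cinner_add_right cinner_scaleR_right cinner_self real)
    have "\<bar>inner \<xi> (x \<xi>)\<bar> \<le> norm \<xi> * (norm x * norm \<xi>)"
      by (intro order_trans[OF Cauchy_Schwarz_ineq2] mult_left_mono norm_blinfun) simp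
    also have "\<dots> = inner \<xi> (norm x *\<^sub>R \<xi>)" by (simp add: power2_eq_square flip: power2_norm_eq_inner)
    finally show "0 \<le> inner \<xi> ((?n + x) \<xi>)"
      unfolding blinfun.add_left nap inner_add_right by linarith
  qed
  then have 2: "?n + x \<in> positive_part A"
    using n x von_neumann_algebra_closed(5)[OF A] by (simp add: positive_part_def)
  have "x = (?n + x) - ?n" by simp
  then show ?thesis using 1 2 by blast
qed

lemma finite_positive_vector_trace: "finite_positive A (vector_trace \<Omega>) = positive_part A"
  by (auto simp: finite_positive_def vector_trace_def)

text \<open>The trace is finite on all positive elements, so the ideal contains every difference of
  positives; real and imaginary parts then reach all of \<open>A\<close>.\<close>

lemma trace_ideal_vector_trace:
  assumes A: "von_neumann_algebra A"
  shows "trace_ideal A (vector_trace \<Omega>) = A"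
proof
  show "trace_ideal A (vector_trace \<Omega>) \<subseteq> A"
  proof
    fix x assume "x \<in> trace_ideal A (vector_trace \<Omega>)"
    then obtain a b c d where "a \<in> A" "b \<in> A" "c \<in> A" "d \<in> A" and x: "x = (a - b) + \<i> *\<^sub>C (c - d)"
      unfolding trace_ideal_def finite_positive_def positive_part_def by blast
    moreover have "a - b \<in> A" if "a \<in> A" "b \<in> A" for a b
    proof -
      have "a - b = a + (-1) *\<^sub>C b"
        using that by (intro blinfun_eqI) (simp add: blinfun.diff_left blinfun.add_left scaleC_blinfun.rep_eq
            scaleC_of_real[of "-1", simplified])
      then show ?thesis using that von_neumann_algebra_closed[OF A] by metis
    qed
    ultimately show "x \<in> A" using von_neumann_algebra_closed[OF A] by metis
  qed
  show "A \<subseteq> trace_ideal A (vector_trace \<Omega>)"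
  proof
    fix x assume x: "x \<in> A"
    note cl = von_neumann_algebra_closed[OF A]
    have xc: "x \<in> clinear_ops" using cl x by blast
    let ?r = "(1/2) *\<^sub>C (x + adj x)" and ?i = "(- \<i>/2) *\<^sub>C (x + (-1) *\<^sub>C adj x)"
    have "?r \<in> A" "?i \<in> A" using cl x by metis+
    moreover have "adj ?r = ?r" "adj ?i = ?i"
      using xc clinear_ops_adj[OF xc]
      by (auto intro!: blinfun_eqI simp: adj_scaleC adj_add clinear_ops_add clinear_ops_scaleC
          scaleC_blinfun.rep_eq blinfun.add_left scaleC_add_right scaleC_scaleC add.commute)
    ultimately obtain a b c d where "a \<in> positive_part A" "b \<in> positive_part A" "c \<in> positive_part A"
        "d \<in> positive_part A" and ri: "?r = a - b" "?i = c - d"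
      using self_adjoint_decomposition[OF A] by metis
    moreover have "x = ?r + \<i> *\<^sub>C ?i"
      by (intro blinfun_eqI) (simp add: scaleC_blinfun.rep_eq blinfun.add_left scaleC_add_right scaleC_scaleC
           scaleC_add_left[symmetric] add.commute add.left_commute add.assoc)
    ultimately show "x \<in> trace_ideal A (vector_trace \<Omega>)"
      unfolding trace_ideal_def finite_positive_vector_trace ri by blast
  qed
qed

text \<open>Linearity of the vector functional gives every decomposition the same value, which makes
  the definite description meaningful.\<close>

lemma trace_ext_vector_trace:
  fixes A :: "('h::chilbert_space \<Rightarrow>\<^sub>L 'h) set"
  assumes A: "von_neumann_algebra A" and x: "x \<in> A"
  shows "trace_ext A (vector_trace \<Omega>) x = cinner \<Omega> (x \<Omega>)"
  unfolding trace_ext_def finite_positive_vector_trace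
proof (rule the_equality)
  have val: "enn2real (vector_trace \<Omega> a) = inner \<Omega> (a \<Omega>)" "cinner \<Omega> (a \<Omega>) = complex_of_real (inner \<Omega> (a \<Omega>))"
    if "a \<in> positive_part A" for a
    using that positive_opD[of a \<Omega>] by (auto simp: positive_part_def vector_trace_def Re_cinner)
  have sum: "Complex (enn2real (vector_trace \<Omega> a) - enn2real (vector_trace \<Omega> b))
      (enn2real (vector_trace \<Omega> c) - enn2real (vector_trace \<Omega> d)) = cinner \<Omega> (x \<Omega>)"
    if "a \<in> positive_part A" "b \<in> positive_part A" "c \<in> positive_part A" "d \<in> positive_part A"
      "x = (a - b) + \<i> *\<^sub>C (c - d)" for a b c d
    using that(1-4) unfolding that(5)
    by (simp add: val blinfun.add_left blinfun.diff_left scaleC_blinfun.rep_eq cinner_add_right cinner_diff_right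
        cinner_scaleC_right complex_eq_iff)
  obtain a b c d where abcd: "a \<in> positive_part A" "b \<in> positive_part A" "c \<in> positive_part A"
      "d \<in> positive_part A" "x = (a - b) + \<i> *\<^sub>C (c - d)"
    using x trace_ideal_vector_trace[OF A, of \<Omega>] unfolding trace_ideal_def finite_positive_vector_trace by blast
  show "\<exists>a b c d. a \<in> positive_part A \<and> b \<in> positive_part A \<and> c \<in> positive_part A \<and> d \<in> positive_part A \<and>
      x = (a - b) + \<i> *\<^sub>C (c - d) \<and> cinner \<Omega> (x \<Omega>) = Complex (enn2real (vector_trace \<Omega> a) - enn2real (vector_trace \<Omega> b))
      (enn2real (vector_trace \<Omega> c) - enn2real (vector_trace \<Omega> d))"
    using abcd sum[OF abcd] by metis
  show "z = cinner \<Omega> (x \<Omega>)" if "\<exists>a b c d. a \<in> positive_part A \<and> b \<in> positive_part A \<and> c \<in> positive_part A \<and> d \<in> positive_part A \<and>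
      x = (a - b) + \<i> *\<^sub>C (c - d) \<and> z = Complex (enn2real (vector_trace \<Omega> a) - enn2real (vector_trace \<Omega> b))
      (enn2real (vector_trace \<Omega> c) - enn2real (vector_trace \<Omega> d))" for z
    using that sum by metis
qed

section \<open>Bicommutants with a cyclic tracial vector\<close>

inductive_set words :: "('h::chilbert_space \<Rightarrow>\<^sub>L 'h) set \<Rightarrow> ('h \<Rightarrow>\<^sub>L 'h) set" for B where
  words_id: "id_blinfun \<in> words B"
| words_step: "y \<in> B \<Longrightarrow> w \<in> words B \<Longrightarrow> y o\<^sub>L w \<in> words B"

text \<open>Every generator acts on the vector like an operator of the commutant; this is the abstract form
  of left and right multiplications in an algebra with a trace.\<close>

locale tracial_vector =
  fixes B :: "('h::chilbert_space \<Rightarrow>\<^sub>L 'h) set" and \<Omega> :: 'h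
  assumes B_clinear: "B \<subseteq> clinear_ops"
    and B_adj: "y \<in> B \<Longrightarrow> adj y \<in> B"
    and mirror: "y \<in> B \<Longrightarrow> \<exists>y'\<in>commutant B. blinfun_apply y' \<Omega> = y \<Omega> \<and> adj y' \<Omega> = adj y \<Omega>"
    and dense_words: "dense_span {c *\<^sub>C blinfun_apply w \<Omega> | c w. w \<in> words B}"
begin

abbreviation M :: "('h \<Rightarrow>\<^sub>L 'h) set" where "M \<equiv> commutant (commutant B)"

lemma M: "von_neumann_algebra M"
  using B_clinear B_adj by (rule von_neumann_algebra_bicommutant)

lemmas M_closed = von_neumann_algebra_closed[OF M]

lemma B_subset_M: "B \<subseteq> M"
  using B_clinear by (rule subset_bicommutant)

text \<open>The mirror of a product is the product of the mirrors in reverse order: \<open>y (w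
  \<Omega>) = y (w' \<Omega>) = w' (y \<Omega>) = w' (y' \<Omega>)\<close>.\<close>

lemma words_mirror:
  assumes "w \<in> words B"
  shows "w \<in> M \<and> (\<exists>w'\<in>commutant B. blinfun_apply w' \<Omega> = w \<Omega> \<and> adj w' \<Omega> = adj w \<Omega>)"
  using assms
proof induction
  case words_id
  show ?case using commutant_id by (intro conjI bexI[of _ id_blinfun]) auto
next
  case (words_step y w)
  then obtain w' where w: "w \<in> M" and w': "w' \<in> commutant B" "w' \<Omega> = w \<Omega>" "adj w' \<Omega> = adj w \<Omega>" by blast
  obtain y' where y': "y' \<in> commutant B" "y' \<Omega> = y \<Omega>" "adj y' \<Omega> = adj y \<Omega>" using mirror words_step(1) by blast
  have y: "y \<in> M" "y \<in> B" using words_step(1) B_subset_M by auto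
  have cl: "y \<in> clinear_ops" "w \<in> clinear_ops" "w' \<in> clinear_ops" "y' \<in> clinear_ops"
    using y w w' y' commutant_clinear by blast+
  have "(w' o\<^sub>L y') \<Omega> = (y o\<^sub>L w) \<Omega>"
    using commutant_apply[OF w'(1) y(2)] by (simp add: y' w')
  moreover have "adj (w' o\<^sub>L y') \<Omega> = adj (y o\<^sub>L w) \<Omega>"
  proof -
    have "adj y' \<in> commutant B" by (rule commutant_adj[OF B_clinear B_adj y'(1)])
    from commutant_apply[OF M_closed(3)[OF w] this, of \<Omega>]
    show ?thesis using cl by (simp add: adj_compose y' w')
  qed
  ultimately show ?case
    using M_closed(4)[OF y(1) w] commutant_compose[OF w'(1) y'(1)] by blast
qed

text \<open>The trace identity for the products of the adjoint of \<open>w\<close> with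
  \<open>x\<close> in the two orders: the mirror of \<open>w\<close> is moved past
  \<open>x\<close>.\<close>

lemma cinner_word:
  assumes "w \<in> words B" "x \<in> M"
  shows "cinner (blinfun_apply w \<Omega>) (x \<Omega>) = cinner (adj x \<Omega>) (adj w \<Omega>)"
proof -
  obtain w' where w': "w' \<in> commutant B" "w' \<Omega> = w \<Omega>" "adj w' \<Omega> = adj w \<Omega>"
    using words_mirror[OF assms(1)] by blast
  have aw: "adj w' \<in> commutant B" by (rule commutant_adj[OF B_clinear B_adj w'(1)])
  have cl: "w' \<in> clinear_ops" "x \<in> clinear_ops" using w'(1) assms(2) commutant_clinear by blast+
  have "cinner (w' \<Omega>) (x \<Omega>) = cinner \<Omega> (adj w' (x \<Omega>))" using cl by (simp add: adj_right)
  also have "adj w' (x \<Omega>) = x (adj w' \<Omega>)" using commutant_apply[OF assms(2) aw] by simp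
  also have "cinner \<Omega> (x (adj w' \<Omega>)) = cinner (adj x \<Omega>) (adj w' \<Omega>)" using cl by (simp add: adj_left)
  finally show ?thesis by (simp add: w')
qed

text \<open>The map from \<open>w \<Omega>\<close> to \<open>adj w \<Omega>\<close> extends to an
  antilinear isometry by \<open>cinner_word\<close>, and this extension \<open>T\<close> satisfies
  \<open>key\<close> for all of \<open>M\<close>. Taking \<open>z = y \<Omega>\<close> there and
  applying Cauchy-Schwarz bounds one norm by the other; using this for \<open>x\<close> and for its
  adjoint gives equality.\<close>

lemma norm_adj:
  assumes x: "x \<in> M"
  shows "norm (adj x \<Omega>) = norm (blinfun_apply x \<Omega>)"
proof -
  \<comment> \<open>Pairs that do not contain a word are sent to 0 in both families, which leaves
    the Gram matrices equal and the span unchanged.\<close>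
  define v where "v p = (case p of (c, w) \<Rightarrow> if w \<in> words B then c *\<^sub>C w \<Omega> else 0)" for p :: "complex \<times> ('h \<Rightarrow>\<^sub>L 'h)"
  define v' where "v' p = (case p of (c, w) \<Rightarrow> if w \<in> words B then cnj c *\<^sub>C adj w \<Omega> else 0)" for p :: "complex \<times> ('h \<Rightarrow>\<^sub>L 'h)"
  have gram: "inner (v p) (v q) = inner (v' p) (v' q)" for p q
  proof -
    obtain c w d z where pq: "p = (c, w)" "q = (d, z)" by fastforce
    show ?thesis
    proof (cases "w \<in> words B \<and> z \<in> words B")
      case True
      have "Re (cinner (c *\<^sub>C w \<Omega>) (d *\<^sub>C z \<Omega>)) = Re (cinner (cnj c *\<^sub>C adj w \<Omega>) (cnj d *\<^sub>C adj z \<Omega>))"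
      proof -
        have "cinner (c *\<^sub>C w \<Omega>) (d *\<^sub>C z \<Omega>) = cnj (cinner (cnj c *\<^sub>C adj w \<Omega>) (cnj d *\<^sub>C adj z \<Omega>))"
          using True cinner_word[of w z] words_mirror[of z] cinner_commute[of "adj z \<Omega>" "adj w \<Omega>"]
          by (simp add: cinner_scaleC_left cinner_scaleC_right)
        then show ?thesis by simp
      qed
      then show ?thesis using True by (simp add: pq v_def v'_def Re_cinner)
    qed (auto simp: pq v_def v'_def)
  qed
  have tot: "dense_span (range v)"
  proof (rule dense_span_mono[OF dense_words], rule subsetI)
    fix u assume "u \<in> {c *\<^sub>C blinfun_apply w \<Omega> | c w. w \<in> words B}"
    then obtain c w where "w \<in> words B" "u = c *\<^sub>C blinfun_apply w \<Omega>" by blast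
    then have "u = v (c, w)" by (simp add: v_def)
    then show "u \<in> range v" by blast
  qed
  from isometric_extension[of v v', OF gram] obtain T :: "'h \<Rightarrow>\<^sub>L 'h"
    where T: "\<forall>p. T (v p) = v' p" and iso: "\<forall>x y. inner (T x) (T y) = inner x y"
    using tot unfolding dense_span_def by auto
  have nT: "norm (T x) = norm x" for x using iso by (simp add: norm_eq_sqrt_inner)
  have key: "inner z (y \<Omega>) = inner (adj y \<Omega>) (T z)" if y: "y \<in> M" for z y
  proof -
    have "blinfun_inner_left (y \<Omega>) = blinfun_inner_left (adj y \<Omega>) o\<^sub>L T"
    proof (rule dense_span_eqI[OF tot])
      fix u assume "u \<in> range v"
      then obtain c w where u: "u = v (c, w)" by auto
      show "blinfun_inner_left (y \<Omega>) u = (blinfun_inner_left (adj y \<Omega>) o\<^sub>L T) u"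
      proof (cases "w \<in> words B")
        case True
        have "Re (cinner (c *\<^sub>C w \<Omega>) (y \<Omega>)) = Re (cinner (adj y \<Omega>) (cnj c *\<^sub>C adj w \<Omega>))"
          by (simp add: cinner_scaleC_left cinner_scaleC_right cinner_word[OF True y])
        then show ?thesis using True T[rule_format, of "(c, w)"] 
          by (simp add: u v_def v'_def Re_cinner inner_commute)
      next
        case False
        then show ?thesis using T[rule_format, of "(c, w)"] by (simp add: u v_def v'_def)
      qed
    qed
    then have "blinfun_inner_left (y \<Omega>) z = (blinfun_inner_left (adj y \<Omega>) o\<^sub>L T) z" by simp
    then show ?thesis by (simp add: inner_commute)
  qed
  have le: "norm (y \<Omega>) \<le> norm (adj y \<Omega>)" if y: "y \<in> M" for y
  proof -
    have "norm (y \<Omega>) * norm (y \<Omega>) = inner (adj y \<Omega>) (T (y \<Omega>))"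
      using key[OF y, of "y \<Omega>"] power2_norm_eq_inner[of "y \<Omega>"] by (simp only: power2_eq_square)
    also have "\<dots> \<le> norm (adj y \<Omega>) * norm (y \<Omega>)"
      using Cauchy_Schwarz_ineq2[of "adj y \<Omega>" "T (y \<Omega>)"] by (simp add: nT)
    finally show ?thesis by (cases "norm (y \<Omega>) = 0") (auto simp: mult_le_cancel_right)
  qed
  have "x \<in> clinear_ops" using x M_closed(1) by blast
  then show ?thesis using le[OF x] le[OF M_closed(3)[OF x]] by simp
qed

text \<open>Complex multiples of vectors \<open>w' \<Omega>\<close> with \<open>w'\<close> in the
  commutant are total, and \<open>x\<close> kills them together with
  \<open>\<Omega>\<close>.\<close>

lemma separating:
  assumes x: "x \<in> M" and 0: "blinfun_apply x \<Omega> = 0"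
  shows "x = 0"
proof (rule dense_span_eqI[OF dense_words])
  fix u assume "u \<in> {c *\<^sub>C blinfun_apply w \<Omega> | c w. w \<in> words B}"
  then obtain c w where u: "u = c *\<^sub>C blinfun_apply w \<Omega>" "w \<in> words B" by blast
  obtain w' where w': "w' \<in> commutant B" "w' \<Omega> = w \<Omega>" using words_mirror[OF u(2)] by blast
  have "x \<in> clinear_ops" using x M_closed(1) by blast
  then have "x u = c *\<^sub>C x (w' \<Omega>)" by (simp add: u(1) clinear_opsD w')
  also have "x (w' \<Omega>) = w' (x \<Omega>)" using x w'(1) by (rule commutant_apply)
  finally show "x u = blinfun_apply 0 u" by (simp add: 0)
qed

text \<open>For normality, the supremum \<open>s\<close> lies below the strong limit
  \<open>u\<close>, whose form at \<open>\<Omega>\<close> is controlled by the forms of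
  \<open>D\<close>; \<open>u\<close> qualifies as a competitor because it commutes with the
  commutant. The trace property is \<open>norm_adj\<close>, faithfulness comes from
  \<open>separating\<close>, and semifiniteness holds because the trace is finite.\<close>

lemma trace: "normal_semifinite_faithful_trace M (vector_trace \<Omega>)"
  unfolding normal_semifinite_faithful_trace_def
proof (intro conjI allI ballI impI; (elim conjE)?)
  note pos = positive_part_def
  fix x y assume "x \<in> positive_part M" "y \<in> positive_part M"
  then have "0 \<le> inner \<Omega> (x \<Omega>)" "0 \<le> inner \<Omega> (y \<Omega>)" by (auto simp: pos positive_opD)
  then show "vector_trace \<Omega> (x + y) = vector_trace \<Omega> x + vector_trace \<Omega> y"
    by (simp add: vector_trace_def blinfun.add_left cinner_add_right Re_cinner)
next
  fix r :: real and x assume "0 \<le> r" "x \<in> positive_part M"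
  moreover from this have "0 \<le> inner \<Omega> (x \<Omega>)" by (auto simp: positive_part_def positive_opD)
  ultimately show "vector_trace \<Omega> (r *\<^sub>R x) = ennreal r * vector_trace \<Omega> x"
    by (simp add: vector_trace_def blinfun.scaleR_left cinner_scaleR_right Re_cinner ennreal_mult)
next
  fix x assume x: "x \<in> M"
  then have "x \<in> clinear_ops" using M_closed(1) by blast
  then show "vector_trace \<Omega> (adj x o\<^sub>L x) = vector_trace \<Omega> (x o\<^sub>L adj x)"
    using norm_adj[OF x] by (simp add: vector_trace_def adj_right adj_left[symmetric] cinner_self)
next
  fix D s
  assume D: "D \<subseteq> positive_part M" "D \<noteq> {}" "\<forall>x\<in>D. \<forall>y\<in>D. \<exists>z\<in>D. op_le x z \<and> op_le y z"
    and s: "s \<in> positive_part M" "\<forall>x\<in>D. op_le x s"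
      "\<forall>u\<in>positive_part M. (\<forall>x\<in>D. op_le x u) \<longrightarrow> op_le s u"
  have pos: "positive_op x" "x \<in> M" if "x \<in> D" for x using that D(1) by (auto simp: positive_part_def)
  obtain u where u: "positive_op u" "\<forall>x\<in>D. op_le x u"
    "\<forall>\<xi> c. (\<forall>x\<in>D. inner \<xi> (x \<xi>) \<le> c) \<longrightarrow> inner \<xi> (u \<xi>) \<le> c"
    "\<forall>T\<in>clinear_ops. (\<forall>x\<in>D. T o\<^sub>L x = x o\<^sub>L T) \<longrightarrow> T o\<^sub>L u = u o\<^sub>L T"
    using directed_positive_limit[of D s] D(2,3) pos(1) s(2) by auto
  have "u \<in> M"
  proof (rule commutantI)
    show "u \<in> clinear_ops" using u(1) by (rule positive_op_clinear)
    fix T assume T: "T \<in> commutant B"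
    then have "\<forall>x\<in>D. T o\<^sub>L x = x o\<^sub>L T" using pos(2) commutant_commute by metis
    then show "u o\<^sub>L T = T o\<^sub>L u" using u(4) commutant_clinear[OF T] by simp
  qed
  then have "u \<in> positive_part M" using u(1) by (simp add: positive_part_def)
  with s(3) u(2) have "op_le s u" by blast
  from op_le_inner[OF this] have su: "inner \<Omega> (s \<Omega>) \<le> inner \<Omega> (u \<Omega>)" .
  show "vector_trace \<Omega> s = (SUP x\<in>D. vector_trace \<Omega> x)"
  proof (rule antisym)
    show "(SUP x\<in>D. vector_trace \<Omega> x) \<le> vector_trace \<Omega> s"
      by (rule SUP_least) (use s(2) op_le_inner in \<open>auto simp: vector_trace_def Re_cinner intro!: ennreal_leI\<close>)
    let ?S = "SUP x\<in>D. vector_trace \<Omega> x"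
    have fin: "?S < \<infinity>"
      using \<open>?S \<le> vector_trace \<Omega> s\<close> by (rule le_less_trans) (simp add: vector_trace_def)
    have "inner \<Omega> (x \<Omega>) \<le> enn2real ?S" if "x \<in> D" for x
    proof -
      have "ennreal (inner \<Omega> (x \<Omega>)) \<le> ?S"
        using SUP_upper[OF that, of "vector_trace \<Omega>"] by (simp add: vector_trace_def Re_cinner)
      then have "enn2real (ennreal (inner \<Omega> (x \<Omega>))) \<le> enn2real ?S"
        using fin by (intro enn2real_mono) auto
      then show ?thesis using positive_opD(2)[OF pos(1)[OF that], of \<Omega>] by simp
    qed
    then have "inner \<Omega> (u \<Omega>) \<le> enn2real ?S" using u(3) by blast
    with su have "ennreal (inner \<Omega> (s \<Omega>)) \<le> ennreal (enn2real ?S)" by (intro ennreal_leI) simp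
    also have "ennreal (enn2real ?S) = ?S" using fin by (simp only: ennreal_enn2real infinity_ennreal_def)
    finally show "vector_trace \<Omega> s \<le> ?S" by (simp only: vector_trace_def Re_cinner)
  qed
next
  fix x assume "x \<in> positive_part M" "x \<noteq> 0"
  then show "\<exists>y\<in>positive_part M. y \<noteq> 0 \<and> op_le y x \<and> vector_trace \<Omega> y < \<infinity>"
    by (intro bexI[of _ x]) (auto simp: op_le_refl vector_trace_def)
next
  fix x assume x: "x \<in> positive_part M" and 0: "vector_trace \<Omega> x = 0"
  have p: "positive_op x" "x \<in> M" using x by (auto simp: positive_part_def)
  have "inner \<Omega> (x \<Omega>) \<le> 0" using 0 by (simp add: vector_trace_def Re_cinner ennreal_eq_0_iff)
  then have "norm x * inner \<Omega> (x \<Omega>) \<le> 0" by (simp add: mult_le_0_iff)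
  with positive_op_norm_le[OF p(1), of \<Omega>] have "(norm (x \<Omega>))\<^sup>2 \<le> 0" by linarith
  then have "x \<Omega> = 0" by simp
  then show "x = 0" by (rule separating[OF p(2)])
qed

end

section \<open>Tensor decompositions of square summable families\<close>

lemma ell2_eqI: "(\<And>a. Rep_ell2 x a = Rep_ell2 y a) \<Longrightarrow> x = y"
  by (simp add: Rep_ell2_inject[symmetric] fun_eq_iff)

lemma cinner_ell2_has_sum: "((\<lambda>a. cnj (Rep_ell2 x a) * Rep_ell2 y a) has_sum cinner x y) UNIV"
  unfolding cinner_ell2_def cinner_ell2'.rep_eq
  by (rule has_sum_infsum, rule ell2_prod_summable) (rule ell2_norm_sq_summable)+

lemma cinner_basis: "cinner (ell2_basis a) x = Rep_ell2 x a"
proof -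
  have "((\<lambda>b. cnj (Rep_ell2 (ell2_basis a) b) * Rep_ell2 x b) has_sum Rep_ell2 x a) UNIV"
    by (rule has_sum_finite_neutralI[of "{a}"]) (auto simp: ell2_basis.rep_eq)
  then show ?thesis using cinner_ell2_has_sum has_sum_unique by blast
qed

lemma cinner_basis_basis: "cinner (ell2_basis a) (ell2_basis b) = (if a = b then 1 else 0)"
  by (simp add: cinner_basis ell2_basis.rep_eq)

lemma norm_basis [simp]: "norm (ell2_basis a) = 1"
proof -
  have "complex_of_real ((norm (ell2_basis a))\<^sup>2) = 1"
    using cinner_self[of "ell2_basis a"] by (simp add: cinner_basis_basis)
  then have "(norm (ell2_basis a))\<^sup>2 = 1" by (simp only: of_real_eq_1_iff)
  then have "norm (ell2_basis a) = 1 \<or> norm (ell2_basis a) = -1" by (simp only: power2_eq_1_iff)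
  moreover have "0 \<le> norm (ell2_basis a)" by simp
  ultimately show ?thesis by linarith
qed

lemma inner_basis_scaleC: "inner (c *\<^sub>C ell2_basis a) x = Re (cnj c * Rep_ell2 x a)"
  by (simp add: inner_eq_Re_cinner cinner_scaleC_left cinner_basis)

lemma zero_Rep_ell2: "Rep_ell2 0 a = 0"
  by (simp add: zero_ell2.rep_eq)

lemma dense_span_basis: "dense_span {c *\<^sub>C ell2_basis a | c a. c \<in> {1, \<i>}}"
proof (rule dense_spanI)
  fix x :: "'a ell2" assume *: "\<And>v. v \<in> {c *\<^sub>C ell2_basis a | c a. c \<in> {1, \<i>}} \<Longrightarrow> inner v x = 0"
  show "x = 0"
  proof (rule ell2_eqI)
    fix a
    have "Re (cnj 1 * Rep_ell2 x a) = 0" "Re (cnj \<i> * Rep_ell2 x a) = 0"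
      unfolding inner_basis_scaleC[symmetric] by (rule *, blast)+
    then show "Rep_ell2 x a = Rep_ell2 0 a" by (simp add: complex_eq_iff zero_Rep_ell2)
  qed
qed

lemma ell2_op_eqI:
  assumes "S \<in> clinear_ops" "T \<in> clinear_ops"
    and "\<And>a b. cinner (ell2_basis a) (blinfun_apply S (ell2_basis b)) = cinner (ell2_basis a) (T (ell2_basis b))"
  shows "S = T"
proof (rule dense_span_eqI[OF dense_span_basis])
  fix v :: "'a ell2" assume "v \<in> {c *\<^sub>C ell2_basis a | c a. c \<in> {1, \<i>}}"
  then obtain c b where v: "v = c *\<^sub>C ell2_basis b" by blast
  have "S (ell2_basis b) = T (ell2_basis b)"
    by (rule ell2_eqI) (use assms(3) in \<open>simp add: cinner_basis\<close>)
  then show "S v = T v" unfolding v using assms(1,2) by (simp add: clinear_opsD)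
qed

text \<open>A bijection of index sets in curried form makes \<open>'x ell2\<close> the Hilbert
  tensor product of \<open>'p ell2\<close> and \<open>'q ell2\<close>. An arbitrary target type is
  allowed because the dilation has to live on a prescribed index type.\<close>

definition pairing :: "('p \<Rightarrow> 'q \<Rightarrow> 'x) \<Rightarrow> bool"
  where "pairing \<iota> \<longleftrightarrow> bij (case_prod \<iota>)"

definition swap_pairing :: "('p \<Rightarrow> 'q \<Rightarrow> 'x) \<Rightarrow> 'q \<Rightarrow> 'p \<Rightarrow> 'x"
  where "swap_pairing \<iota> = (\<lambda>q p. \<iota> p q)"

lemma pairing_swap: "pairing \<iota> \<Longrightarrow> pairing (swap_pairing \<iota>)"
  unfolding pairing_def swap_pairing_def
  using bij_comp[OF bij_swap, of "case_prod \<iota>"] by (simp add: o_def case_prod_unfold prod.swap_def)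

lemma pairing_inj: "pairing \<iota> \<Longrightarrow> \<iota> p q = \<iota> p' q' \<longleftrightarrow> p = p' \<and> q = q'"
  unfolding pairing_def bij_def inj_def by fastforce

lemma pairing_cases: "pairing \<iota> \<Longrightarrow> \<exists>p q. x = \<iota> p q"
  unfolding pairing_def bij_def surj_def by fastforce

lemma pairing_inj_row: "pairing \<iota> \<Longrightarrow> inj (\<iota> p)"
  by (rule injI) (simp add: pairing_inj)

lemma inv_pairing: "pairing \<iota> \<Longrightarrow> inv (case_prod \<iota>) (\<iota> p q) = (p, q)"
  unfolding pairing_def bij_def by (metis case_prod_conv inv_f_f)

text \<open>The component over \<open>p\<close> in the tensor decomposition. The guard keeps the
  restricted family square summable for every \<open>\<iota>\<close>, as the lifting
  requires.\<close>

lift_definition slice :: "('p \<Rightarrow> 'q \<Rightarrow> 'x) \<Rightarrow> 'p \<Rightarrow> 'x ell2 \<Rightarrow> 'q ell2"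
  is "\<lambda>\<iota> p x q. if inj (\<iota> p) then x (\<iota> p q) else 0"
  subgoal for \<iota> p x
  proof (cases "inj (\<iota> p)")
    case True
    assume "(\<lambda>i. (cmod (x i))\<^sup>2) summable_on UNIV"
    then have "(\<lambda>i. (cmod (x i))\<^sup>2) summable_on range (\<iota> p)" by (rule summable_on_subset_banach) simp
    then show ?thesis using True summable_on_reindex[OF True, of "\<lambda>i. (cmod (x i))\<^sup>2"] by (simp add: o_def)
  qed simp
  done

lemma Rep_slice: "pairing \<iota> \<Longrightarrow> Rep_ell2 (slice \<iota> p x) q = Rep_ell2 x (\<iota> p q)"
  by (simp add: slice.rep_eq pairing_inj_row)

lemma slice_eqI:
  assumes "pairing \<iota>" "\<And>p. slice \<iota> p x = slice \<iota> p y"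
  shows "x = y"
proof (rule ell2_eqI)
  fix a
  obtain p q where "a = \<iota> p q" using pairing_cases[OF assms(1)] by blast
  then show "Rep_ell2 x a = Rep_ell2 y a" using assms(2)[of p] Rep_slice[OF assms(1)] by metis
qed

lemma slice_add: "slice \<iota> p (x + y) = slice \<iota> p x + slice \<iota> p y"
  by (rule ell2_eqI) (simp add: slice.rep_eq plus_ell2.rep_eq)

lemma slice_diff: "slice \<iota> p (x - y) = slice \<iota> p x - slice \<iota> p y"
  by (rule ell2_eqI) (simp add: slice.rep_eq minus_ell2.rep_eq)

lemma slice_scaleC: "slice \<iota> p (c *\<^sub>C x) = c *\<^sub>C slice \<iota> p x"
  by (rule ell2_eqI) (simp add: slice.rep_eq scaleC_ell2.rep_eq)

lemma cinner_slices:
  assumes "pairing \<iota>"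
  shows "((\<lambda>p. cinner (slice \<iota> p x) (slice \<iota> p y)) has_sum cinner x y) UNIV"
proof -
  have "((\<lambda>z. cnj (Rep_ell2 x (case_prod \<iota> z)) * Rep_ell2 y (case_prod \<iota> z)) has_sum cinner x y) UNIV"
    using cinner_ell2_has_sum[of x y] assms
    by (subst has_sum_reindex_bij_betw[where g = "case_prod \<iota>" and B = UNIV and f = "\<lambda>a. cnj (Rep_ell2 x a) * Rep_ell2 y a"])
      (simp_all add: pairing_def)
  then have "((\<lambda>z. cnj (Rep_ell2 x (case_prod \<iota> z)) * Rep_ell2 y (case_prod \<iota> z)) has_sum cinner x y) (Sigma UNIV (\<lambda>_. UNIV))"
    by simp
  then show ?thesis
  proof (rule has_sum_Sigma')
    fix p
    show "((\<lambda>q. cnj (Rep_ell2 x (case_prod \<iota> (p, q))) * Rep_ell2 y (case_prod \<iota> (p, q))) has_sum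
        cinner (slice \<iota> p x) (slice \<iota> p y)) UNIV"
      using cinner_ell2_has_sum[of "slice \<iota> p x" "slice \<iota> p y"] by (simp add: Rep_slice[OF assms])
  qed
qed

lemma norm_slices:
  assumes "pairing \<iota>"
  shows "((\<lambda>p. (norm (slice \<iota> p x))\<^sup>2) has_sum (norm x)\<^sup>2) UNIV"
proof -
  have "((\<lambda>p. Re (cinner (slice \<iota> p x) (slice \<iota> p x))) has_sum Re (cinner x x)) UNIV"
    by (rule has_sum_Re) (rule cinner_slices[OF assms])
  then show ?thesis by (simp add: cinner_self flip: of_real_power)
qed

lemma norm_slice_le:
  assumes "pairing \<iota>"
  shows "norm (slice \<iota> p x) \<le> norm x"
proof -
  have "((\<lambda>p. (norm (slice \<iota> p x))\<^sup>2) has_sum (norm (slice \<iota> p x))\<^sup>2) {p}"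
    by (rule has_sum_finite[of "{p}", simplified])
  then have "(norm (slice \<iota> p x))\<^sup>2 \<le> (norm x)\<^sup>2"
    by (rule has_sum_mono2[OF _ norm_slices[OF assms]]) auto
  then show ?thesis by (rule power2_le_imp_le) simp
qed

lemma bounded_linear_slice: "pairing \<iota> \<Longrightarrow> bounded_linear (slice \<iota> p)"
  by (rule bounded_linear_intro[where K = 1])
    (simp_all add: slice_add slice_scaleC norm_slice_le flip: scaleC_of_real)

definition glue :: "('p \<Rightarrow> 'q \<Rightarrow> 'x) \<Rightarrow> ('p \<Rightarrow> 'q ell2) \<Rightarrow> 'x ell2"
  where "glue \<iota> y = Abs_ell2 (\<lambda>x. case inv (case_prod \<iota>) x of (p, q) \<Rightarrow> Rep_ell2 (y p) q)"

lemma slice_glue: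
  assumes \<iota>: "pairing \<iota>" and s: "(\<lambda>p. (norm (y p))\<^sup>2) summable_on UNIV"
  shows "slice \<iota> p (glue \<iota> y) = y p"
proof -
  let ?f = "\<lambda>x. case inv (case_prod \<iota>) x of (p, q) \<Rightarrow> Rep_ell2 (y p) q"
  have "(\<lambda>(p, q). (cmod (Rep_ell2 (y p) q))\<^sup>2) summable_on Sigma UNIV (\<lambda>_. UNIV)"
  proof (rule summable_on_SigmaI)
    show "((\<lambda>q. case (p, q) of (p, q) \<Rightarrow> (cmod (Rep_ell2 (y p) q))\<^sup>2) has_sum (norm (y p))\<^sup>2) UNIV" for p
      unfolding norm_ell2_square prod.case by (rule has_sum_infsum) (rule ell2_norm_sq_summable)
  qed (use s in auto)
  also have "(\<lambda>(p, q). (cmod (Rep_ell2 (y p) q))\<^sup>2) = (\<lambda>z. (cmod (?f (case_prod \<iota> z)))\<^sup>2)"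
    by (auto simp: fun_eq_iff inv_pairing[OF \<iota>])
  finally have "(\<lambda>x. (cmod (?f x))\<^sup>2) summable_on UNIV"
    using \<iota> summable_on_reindex_bij_betw[of "case_prod \<iota>" UNIV UNIV "\<lambda>x. (cmod (?f x))\<^sup>2"]
    by (simp add: pairing_def)
  then have "Rep_ell2 (glue \<iota> y) = ?f" unfolding glue_def by (intro Abs_ell2_inverse) simp
  then show ?thesis by (intro ell2_eqI) (simp add: Rep_slice[OF \<iota>] inv_pairing[OF \<iota>])
qed

definition tens :: "('p \<Rightarrow> 'q \<Rightarrow> 'x) \<Rightarrow> 'p ell2 \<Rightarrow> 'q ell2 \<Rightarrow> 'x ell2"
  where "tens \<iota> \<phi> \<eta> = glue \<iota> (\<lambda>p. Rep_ell2 \<phi> p *\<^sub>C \<eta>)"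

lemma slice_tens:
  assumes "pairing \<iota>"
  shows "slice \<iota> p (tens \<iota> \<phi> \<eta>) = Rep_ell2 \<phi> p *\<^sub>C \<eta>"
  unfolding tens_def
  by (rule slice_glue[OF assms]) (simp add: norm_scaleC power_mult_distrib summable_on_cmult_left ell2_norm_sq_summable)

lemma Rep_tens: "pairing \<iota> \<Longrightarrow> Rep_ell2 (tens \<iota> \<phi> \<eta>) (\<iota> p q) = Rep_ell2 \<phi> p * Rep_ell2 \<eta> q"
  using Rep_slice[of \<iota> p "tens \<iota> \<phi> \<eta>" q] by (simp add: slice_tens scaleC_ell2.rep_eq)

lemma tens_swap:
  assumes "pairing \<iota>"
  shows "tens (swap_pairing \<iota>) \<eta> \<phi> = tens \<iota> \<phi> \<eta>"
proof (rule ell2_eqI)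
  fix a
  obtain p q where a: "a = \<iota> p q" using pairing_cases[OF assms] by blast
  then have "a = swap_pairing \<iota> q p" by (simp add: swap_pairing_def)
  then show "Rep_ell2 (tens (swap_pairing \<iota>) \<eta> \<phi>) a = Rep_ell2 (tens \<iota> \<phi> \<eta>) a"
    using Rep_tens[OF assms, of \<phi> \<eta> p q] Rep_tens[OF pairing_swap[OF assms], of \<eta> \<phi> q p] a by (simp add: mult.commute)
qed

lemma cinner_tens:
  assumes "pairing \<iota>"
  shows "cinner (tens \<iota> \<phi> \<eta>) (tens \<iota> \<phi>' \<eta>') = cinner \<phi> \<phi>' * cinner \<eta> \<eta>'"
proof -
  have "((\<lambda>p. cnj (Rep_ell2 \<phi> p) * Rep_ell2 \<phi>' p * cinner \<eta> \<eta>') has_sum cinner \<phi> \<phi>' * cinner \<eta> \<eta>') UNIV"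
    by (intro has_sum_cmult_left cinner_ell2_has_sum)
  moreover have "cinner (slice \<iota> p (tens \<iota> \<phi> \<eta>)) (slice \<iota> p (tens \<iota> \<phi>' \<eta>')) =
      cnj (Rep_ell2 \<phi> p) * Rep_ell2 \<phi>' p * cinner \<eta> \<eta>'" for p
    by (simp add: slice_tens[OF assms] cinner_scaleC_left cinner_scaleC_right)
  ultimately show ?thesis using cinner_slices[OF assms, of "tens \<iota> \<phi> \<eta>" "tens \<iota> \<phi>' \<eta>'"] has_sum_unique by auto
qed

lemma cinner_tens_basis:
  assumes "pairing \<iota>"
  shows "cinner (tens \<iota> (ell2_basis p) \<eta>) x = cinner \<eta> (slice \<iota> p x)"
proof -
  have "((\<lambda>p'. cinner (slice \<iota> p' (tens \<iota> (ell2_basis p) \<eta>)) (slice \<iota> p' x)) has_sum cinner \<eta> (slice \<iota> p x)) UNIV"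
    by (rule has_sum_finite_neutralI[of "{p}"]) (auto simp: slice_tens[OF assms] ell2_basis.rep_eq)
  then show ?thesis using cinner_slices[OF assms] has_sum_unique by blast
qed

lemma norm_tens: "pairing \<iota> \<Longrightarrow> norm (tens \<iota> \<phi> \<eta>) = norm \<phi> * norm \<eta>"
proof -
  assume "pairing \<iota>"
  then have "complex_of_real ((norm (tens \<iota> \<phi> \<eta>))\<^sup>2) = complex_of_real ((norm \<phi> * norm \<eta>)\<^sup>2)"
    using cinner_tens[of \<iota> \<phi> \<eta> \<phi> \<eta>] by (simp add: cinner_self power_mult_distrib)
  then have "(norm (tens \<iota> \<phi> \<eta>))\<^sup>2 = (norm \<phi> * norm \<eta>)\<^sup>2" by (simp only: of_real_eq_iff)
  then show ?thesis by (simp add: power2_eq_iff_nonneg)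
qed

lemma tens_add_right: "pairing \<iota> \<Longrightarrow> tens \<iota> \<phi> (\<eta> + \<eta>') = tens \<iota> \<phi> \<eta> + tens \<iota> \<phi> \<eta>'"
  by (rule slice_eqI) (auto simp: slice_tens slice_add scaleC_add_right)

lemma tens_scaleC_right: "pairing \<iota> \<Longrightarrow> tens \<iota> \<phi> (c *\<^sub>C \<eta>) = c *\<^sub>C tens \<iota> \<phi> \<eta>"
  by (rule slice_eqI) (auto simp: slice_tens slice_scaleC scaleC_scaleC mult.commute)

lemma tens_scaleC_left: "pairing \<iota> \<Longrightarrow> tens \<iota> (c *\<^sub>C \<phi>) \<eta> = c *\<^sub>C tens \<iota> \<phi> \<eta>"
  using tens_scaleC_right[OF pairing_swap, of \<iota> \<eta> c \<phi>] by (simp add: tens_swap)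

lemma tens_add_left: "pairing \<iota> \<Longrightarrow> tens \<iota> (\<phi> + \<phi>') \<eta> = tens \<iota> \<phi> \<eta> + tens \<iota> \<phi>' \<eta>"
  using tens_add_right[OF pairing_swap, of \<iota> \<eta> \<phi> \<phi>'] by (simp add: tens_swap)

lemma bounded_linear_tens_right: "pairing \<iota> \<Longrightarrow> bounded_linear (tens \<iota> \<phi>)"
  by (rule bounded_linear_intro[where K = "norm \<phi>"])
    (simp_all add: tens_add_right tens_scaleC_right norm_tens mult.commute flip: scaleC_of_real)

lemma bounded_linear_tens_left: "pairing \<iota> \<Longrightarrow> bounded_linear (\<lambda>\<phi>. tens \<iota> \<phi> \<eta>)"
  by (rule bounded_linear_intro[where K = "norm \<eta>"])
    (simp_all add: tens_add_left tens_scaleC_left norm_tens mult.commute flip: scaleC_of_real)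

lemma dense_span_tens:
  assumes "pairing \<iota>"
  shows "dense_span {tens \<iota> (ell2_basis p) \<eta> | p \<eta>. True}"
proof (rule dense_spanI)
  fix x assume *: "\<And>v. v \<in> {tens \<iota> (ell2_basis p) \<eta> | p \<eta>. True} \<Longrightarrow> inner v x = 0"
  show "x = 0"
  proof (rule slice_eqI[OF assms])
    fix p
    have "inner (tens \<iota> (ell2_basis p) (slice \<iota> p x)) x = 0" by (rule *) blast
    then have "inner (slice \<iota> p x) (slice \<iota> p x) = 0"
      by (simp add: inner_eq_Re_cinner cinner_tens_basis[OF assms])
    moreover have "slice \<iota> p 0 = 0" using slice_diff[of \<iota> p x x] by simp
    ultimately show "slice \<iota> p x = slice \<iota> p 0" by simp
  qed
qed

lemma tens_op_eqI:
  assumes "pairing \<iota>" "\<And>p \<eta>. blinfun_apply S (tens \<iota> (ell2_basis p) \<eta>) = blinfun_apply T (tens \<iota> (ell2_basis p) \<eta>)"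
  shows "S = T"
  by (rule dense_span_eqI[OF dense_span_tens[OF assms(1)]]) (use assms(2) in blast)

definition blockdiag :: "('p \<Rightarrow> 'q \<Rightarrow> 'x) \<Rightarrow> ('p \<Rightarrow> 'q ell2 \<Rightarrow>\<^sub>L 'q ell2) \<Rightarrow> 'x ell2 \<Rightarrow>\<^sub>L 'x ell2"
  where "blockdiag \<iota> D = Blinfun (\<lambda>x. glue \<iota> (\<lambda>p. D p (slice \<iota> p x)))"

lemma slice_blockdiag:
  fixes \<iota> :: "'p \<Rightarrow> 'q \<Rightarrow> 'x"
  assumes \<iota>: "pairing \<iota>" and D: "bounded (range D)"
  shows "slice \<iota> p (blockdiag \<iota> D x) = D p (slice \<iota> p x)"
proof -
  obtain C where C: "\<And>p. norm (D p) \<le> C" using D by (auto simp: bounded_iff)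
  then have C0: "0 \<le> C" by (meson norm_ge_zero order_trans)
  let ?f = "\<lambda>x. glue \<iota> (\<lambda>p. D p (slice \<iota> p x))"
  have le: "(norm (D p (slice \<iota> p x)))\<^sup>2 \<le> C\<^sup>2 * (norm (slice \<iota> p x))\<^sup>2" for p x
  proof -
    have "norm (D p (slice \<iota> p x)) \<le> norm (D p) * norm (slice \<iota> p x)" by (rule norm_blinfun)
    also have "\<dots> \<le> C * norm (slice \<iota> p x)" by (intro mult_right_mono C) simp
    finally show ?thesis by (metis norm_ge_zero power_mono power_mult_distrib)
  qed
  have s: "((\<lambda>p. C\<^sup>2 * (norm (slice \<iota> p x))\<^sup>2) has_sum C\<^sup>2 * (norm x)\<^sup>2) UNIV" for x
    by (intro has_sum_cmult_right norm_slices \<iota>)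
  have sl: "slice \<iota> p (?f x) = D p (slice \<iota> p x)" for p x
    by (rule slice_glue[OF \<iota>], rule summable_on_comparison_test[OF has_sum_imp_summable[OF s[of x]]])
      (use le in auto)
  have "bounded_linear ?f"
  proof (rule bounded_linear_intro[where K = C])
    show "?f (x + y) = ?f x + ?f y" for x y
      by (rule slice_eqI[OF \<iota>], rule trans[OF sl]) (simp add: sl slice_add blinfun.add_right)
    show "?f (r *\<^sub>R x) = r *\<^sub>R ?f x" for r x
      by (rule slice_eqI[OF \<iota>], rule trans[OF sl]) (simp add: sl linear_scale[OF bounded_linear.linear[OF bounded_linear_slice[OF \<iota>]]] blinfun.scaleR_right)
    fix x
    have "((\<lambda>p. (norm (D p (slice \<iota> p x)))\<^sup>2) has_sum (norm (?f x))\<^sup>2) UNIV"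
      using norm_slices[OF \<iota>, of "?f x"] by (simp add: sl)
    then have "(norm (?f x))\<^sup>2 \<le> C\<^sup>2 * (norm x)\<^sup>2" by (rule has_sum_mono[OF _ s]) (rule le)
    then have "(norm (?f x))\<^sup>2 \<le> (norm x * C)\<^sup>2" by (simp add: power_mult_distrib mult.commute)
    then show "norm (?f x) \<le> norm x * C" by (rule power2_le_imp_le) (simp add: C0)
  qed
  then show ?thesis using sl by (simp add: blockdiag_def bounded_linear_Blinfun_apply)
qed

lemma blockdiag_clinear:
  assumes "pairing \<iota>" "bounded (range D)" "\<And>p. D p \<in> clinear_ops"
  shows "blockdiag \<iota> D \<in> clinear_ops"
  by (rule clinear_opsI, rule slice_eqI[OF assms(1)])
    (simp add: slice_blockdiag assms slice_scaleC clinear_opsD)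

lemma blockdiag_tens:
  assumes "pairing \<iota>" "bounded (range D)" "\<And>p. D p \<in> clinear_ops"
  shows "blockdiag \<iota> D (tens \<iota> (ell2_basis p) \<eta>) = tens \<iota> (ell2_basis p) (D p \<eta>)"
  by (rule slice_eqI[OF assms(1)])
    (auto simp: slice_blockdiag assms slice_tens ell2_basis.rep_eq clinear_opsD)

lemma adj_blockdiag:
  assumes \<iota>: "pairing \<iota>" and D: "bounded (range D)" "\<And>p. D p \<in> clinear_ops"
    and a: "bounded (range (\<lambda>p. adj (D p)))"
  shows "adj (blockdiag \<iota> D) = blockdiag \<iota> (\<lambda>p. adj (D p))"
proof (rule adj_eqI[OF _ blockdiag_clinear[OF \<iota> D]])
  fix x y
  have "cinner (slice \<iota> p (blockdiag \<iota> (\<lambda>p. adj (D p)) x)) (slice \<iota> p y) =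
      cinner (slice \<iota> p x) (slice \<iota> p (blockdiag \<iota> D y))" for p
    by (simp add: slice_blockdiag \<iota> D a adj_left)
  then show "cinner (blockdiag \<iota> (\<lambda>p. adj (D p)) x) y = cinner x (blockdiag \<iota> D y)"
    using cinner_slices[OF \<iota>, of "blockdiag \<iota> (\<lambda>p. adj (D p)) x" y] cinner_slices[OF \<iota>, of x "blockdiag \<iota> D y"]
    by (simp add: has_sum_unique)
qed

section \<open>Operators acting on one tensor factor\<close>

lemma bounded_range_const: "bounded (range (\<lambda>_. c))"
  by (simp add: image_constant_conv)

text \<open>The operator \<open>T\<close> tensored with the identity, seen as a block diagonal
  operator with constant blocks once the two factors are exchanged.\<close>

definition amp :: "('p \<Rightarrow> 'q \<Rightarrow> 'x) \<Rightarrow> 'p ell2 \<Rightarrow>\<^sub>L 'p ell2 \<Rightarrow> 'x ell2 \<Rightarrow>\<^sub>L 'x ell2"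
  where "amp \<iota> T = blockdiag (swap_pairing \<iota>) (\<lambda>_. T)"

lemma slice_amp: "pairing \<iota> \<Longrightarrow> slice (swap_pairing \<iota>) q (amp \<iota> T x) = T (slice (swap_pairing \<iota>) q x)"
  unfolding amp_def by (rule slice_blockdiag[OF pairing_swap bounded_range_const])

lemma amp_clinear: "pairing \<iota> \<Longrightarrow> T \<in> clinear_ops \<Longrightarrow> amp \<iota> T \<in> clinear_ops"
  unfolding amp_def by (rule blockdiag_clinear[OF pairing_swap bounded_range_const])

lemma amp_tens:
  assumes "pairing \<iota>" "T \<in> clinear_ops"
  shows "amp \<iota> T (tens \<iota> \<phi> \<eta>) = tens \<iota> (T \<phi>) \<eta>"
proof (rule slice_eqI[OF pairing_swap[OF assms(1)]])
  fix q
  show "slice (swap_pairing \<iota>) q (amp \<iota> T (tens \<iota> \<phi> \<eta>)) = slice (swap_pairing \<iota>) q (tens \<iota> (T \<phi>) \<eta>)"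
    by (simp add: slice_amp assms slice_tens[OF pairing_swap] clinear_opsD tens_swap[symmetric])
qed

lemma amp_eqI:
  assumes "pairing \<iota>" "\<And>q x. slice (swap_pairing \<iota>) q (S x) = blinfun_apply T (slice (swap_pairing \<iota>) q x)"
  shows "amp \<iota> T x = S x"
  by (rule slice_eqI[OF pairing_swap[OF assms(1)]]) (simp add: slice_amp assms)

lemma amp_add: "pairing \<iota> \<Longrightarrow> amp \<iota> (S + T) = amp \<iota> S + amp \<iota> T"
  by (rule blinfun_eqI, rule amp_eqI) (simp_all add: slice_amp slice_add blinfun.add_left)

lemma amp_diff: "pairing \<iota> \<Longrightarrow> amp \<iota> (S - T) = amp \<iota> S - amp \<iota> T"
  by (rule blinfun_eqI, rule amp_eqI) (simp_all add: slice_amp slice_diff blinfun.diff_left)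

lemma amp_scaleC: "pairing \<iota> \<Longrightarrow> amp \<iota> (c *\<^sub>C T) = c *\<^sub>C amp \<iota> T"
  by (rule blinfun_eqI, rule amp_eqI) (simp_all add: slice_amp slice_scaleC scaleC_blinfun.rep_eq)

lemma amp_compose: "pairing \<iota> \<Longrightarrow> amp \<iota> (S o\<^sub>L T) = amp \<iota> S o\<^sub>L amp \<iota> T"
  by (rule blinfun_eqI, rule amp_eqI) (simp_all add: slice_amp)

lemma amp_id: "pairing \<iota> \<Longrightarrow> amp \<iota> id_blinfun = id_blinfun"
  by (rule blinfun_eqI, rule amp_eqI) simp_all

lemma amp_adj: "pairing \<iota> \<Longrightarrow> T \<in> clinear_ops \<Longrightarrow> adj (amp \<iota> T) = amp \<iota> (adj T)"
  unfolding amp_def by (rule adj_blockdiag[OF pairing_swap bounded_range_const _ bounded_range_const])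

text \<open>Relative to the second factor \<open>T\<close> is a matrix of operators on the first
  one, and each entry commutes with \<open>B\<close>; entrywise, \<open>T\<close> then commutes with
  the amplification of \<open>x\<close>.\<close>

lemma amp_bicommutant:
  assumes \<iota>: "pairing \<iota>" and B: "B \<subseteq> clinear_ops" and T: "T \<in> commutant (amp \<iota> ` B)"
    and x: "x \<in> commutant (commutant B)"
  shows "T o\<^sub>L amp \<iota> x = amp \<iota> x o\<^sub>L T"
proof (rule tens_op_eqI[OF pairing_swap[OF \<iota>]])
  fix q \<phi>
  note \<iota>' = pairing_swap[OF \<iota>]
  have xc: "x \<in> clinear_ops" and Tc: "T \<in> clinear_ops" using x T commutant_clinear by blast+
  \<comment> \<open>The entry in row \<open>r\<close> and column \<open>q\<close> of this
    matrix.\<close>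
  define N where "N r = Blinfun (\<lambda>\<phi>. slice (swap_pairing \<iota>) r (T (tens \<iota> \<phi> (ell2_basis q))))" for r
  have N: "N r \<phi> = slice (swap_pairing \<iota>) r (T (tens \<iota> \<phi> (ell2_basis q)))" for r \<phi>
    unfolding N_def
    by (rule bounded_linear_Blinfun_apply[THEN fun_cong], rule bounded_linear_compose[OF bounded_linear_slice[OF \<iota>']],
        rule bounded_linear_compose[OF blinfun.bounded_linear_right], rule bounded_linear_tens_left[OF \<iota>])
  have "N r \<in> commutant B" for r
  proof (rule commutantI)
    show "N r \<in> clinear_ops"
      by (rule clinear_opsI) (simp add: N tens_scaleC_left[OF \<iota>] clinear_opsD[OF Tc] slice_scaleC)
    fix b assume b: "b \<in> B"
    then have bc: "b \<in> clinear_ops" using B by blast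
    show "N r o\<^sub>L b = b o\<^sub>L N r"
    proof (rule blinfun_eqI)
      fix \<phi>
      show "(N r o\<^sub>L b) \<phi> = (b o\<^sub>L N r) \<phi>"
        using commutant_apply[OF T, of "amp \<iota> b" "tens \<iota> \<phi> (ell2_basis q)"] b
        by (simp add: N amp_tens[OF \<iota> bc] slice_amp[OF \<iota>])
    qed
  qed
  then have *: "N r (x \<phi>) = x (N r \<phi>)" for r using commutant_apply[OF x] by metis
  show "(T o\<^sub>L amp \<iota> x) (tens (swap_pairing \<iota>) (ell2_basis q) \<phi>) = (amp \<iota> x o\<^sub>L T) (tens (swap_pairing \<iota>) (ell2_basis q) \<phi>)"
  proof (rule slice_eqI[OF \<iota>'])
    fix r
    show "slice (swap_pairing \<iota>) r ((T o\<^sub>L amp \<iota> x) (tens (swap_pairing \<iota>) (ell2_basis q) \<phi>)) =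
        slice (swap_pairing \<iota>) r ((amp \<iota> x o\<^sub>L T) (tens (swap_pairing \<iota>) (ell2_basis q) \<phi>))"
      using *[of r] by (simp add: N tens_swap[OF \<iota>] amp_tens[OF \<iota> xc] slice_amp[OF \<iota>])
  qed
qed

section \<open>The ultraweak topology\<close>

lemma pairing_Pair: "pairing Pair"
  by (simp add: pairing_def case_prod_Pair)

lemma ultraweak_basic_open:
  assumes "summable (\<lambda>k. (norm (\<xi> k))\<^sup>2)" "summable (\<lambda>k. (norm (\<eta> k))\<^sup>2)" "open U"
  shows "openin ultraweak {T :: 'h::chilbert_space \<Rightarrow>\<^sub>L 'h. (\<Sum>k. cinner (\<xi> k) (T (\<eta> k))) \<in> U}"
  unfolding ultraweak_def by (rule topology_generated_by_Basis) (use assms in blast)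

lemma topspace_ultraweak: "topspace (ultraweak :: ('h::chilbert_space \<Rightarrow>\<^sub>L 'h) topology) = UNIV"
proof -
  have "openin ultraweak {T :: 'h \<Rightarrow>\<^sub>L 'h. (\<Sum>k. cinner 0 (T 0)) \<in> UNIV}"
    by (rule ultraweak_basic_open) auto
  from openin_subset[OF this] show ?thesis by auto
qed

lemma ultraweak_vector_open:
  assumes "open U"
  shows "openin ultraweak {T :: 'h::chilbert_space \<Rightarrow>\<^sub>L 'h. cinner \<phi> (T \<psi>) \<in> U}"
proof -
  let ?d = "\<lambda>\<phi> k. if k = (0::nat) then \<phi> else (0 :: 'h)"
  have "(\<lambda>k. cinner (?d \<phi> k) (T (?d \<psi> k))) sums cinner \<phi> (T \<psi>)" for T :: "'h \<Rightarrow>\<^sub>L 'h"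
    using sums_finite[of "{0}" "\<lambda>k. cinner (?d \<phi> k) (T (?d \<psi> k))"] by simp
  then have "(\<Sum>k. cinner (?d \<phi> k) (T (?d \<psi> k))) = cinner \<phi> (T \<psi>)" for T :: "'h \<Rightarrow>\<^sub>L 'h"
    by (rule sums_unique[symmetric])
  moreover have "openin ultraweak {T :: 'h \<Rightarrow>\<^sub>L 'h. (\<Sum>k. cinner (?d \<phi> k) (T (?d \<psi> k))) \<in> U}"
  proof (rule ultraweak_basic_open[OF _ _ assms])
    show "summable (\<lambda>k. (norm (?d \<phi> k))\<^sup>2)" for \<phi> by (rule summable_finite[of "{0}"]) auto
    show "summable (\<lambda>k. (norm (?d \<phi> k))\<^sup>2)" for \<phi> by (rule summable_finite[of "{0}"]) auto
  qed
  ultimately show ?thesis by simp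
qed

lemma sequence_vector:
  fixes \<xi> :: "nat \<Rightarrow> 'a ell2"
  assumes "summable (\<lambda>k. (norm (\<xi> k))\<^sup>2)"
  obtains \<Xi> :: "('a \<times> nat) ell2" where "\<And>k. slice (swap_pairing Pair) k \<Xi> = \<xi> k"
proof
  have "(\<lambda>k. (norm (\<xi> k))\<^sup>2) summable_on UNIV"
    using assms by (subst summable_on_UNIV_nonneg_real_iff) auto
  then show "slice (swap_pairing Pair) k (glue (swap_pairing Pair) \<xi>) = \<xi> k" for k
    by (rule slice_glue[OF pairing_swap[OF pairing_Pair]])
qed

text \<open>Stacking the two sequences into single vectors turns every ultraweak functional into a
  vector functional of the countable amplification.\<close>

lemma sequence_functional:
  fixes \<Xi> H :: "('a \<times> nat) ell2"
  assumes "\<And>k. slice (swap_pairing Pair) k \<Xi> = \<xi> k" "\<And>k. slice (swap_pairing Pair) k H = \<eta> k"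
  shows "(\<Sum>k. cinner (\<xi> k) (blinfun_apply T (\<eta> k))) = cinner \<Xi> (amp Pair T H)"
proof -
  have "(\<lambda>k. cinner (\<xi> k) (T (\<eta> k))) sums cinner \<Xi> (amp Pair T H)"
    using cinner_slices[OF pairing_swap[OF pairing_Pair], of \<Xi> "amp Pair T H"]
    by (intro has_sum_imp_sums) (simp add: slice_amp[OF pairing_Pair] assms)
  then show ?thesis by (rule sums_unique[symmetric])
qed

text \<open>The index set may be uncountable, but the vector \<open>H\<close> only has countably many nonzero slices.\<close>

lemma ultraweak_amp_open:
  fixes \<iota> :: "'a \<Rightarrow> 'q \<Rightarrow> 'x"
  assumes \<iota>: "pairing \<iota>" and U: "open U"
  shows "openin ultraweak {T. cinner \<Xi> (amp \<iota> T H) \<in> U}"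
proof -
  note \<iota>' = pairing_swap[OF \<iota>]
  define R where "R = {r. slice (swap_pairing \<iota>) r H \<noteq> 0}"
  have "countable {r \<in> UNIV. (norm (slice (swap_pairing \<iota>) r H))\<^sup>2 \<noteq> 0}"
    by (rule summable_countable_real) (rule has_sum_imp_summable[OF norm_slices[OF \<iota>']])
  then have R: "countable R" by (simp add: R_def)
  let ?j = "to_nat_on R"
  have j: "inj_on ?j R" using R by (rule inj_on_to_nat_on)
  define sq where "sq X n = (if n \<in> ?j ` R then slice (swap_pairing \<iota>) (inv_into R ?j n) X else 0)" for X :: "'x ell2" and n
  \<comment> \<open>Stated for an arbitrary summand built from \<open>sq\<close>, since both the
    norms and the inner products are reindexed this way.\<close>
  have transfer: "(f (\<lambda>X. sq X) has_sum s) (UNIV :: nat set)"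
    if "((\<lambda>r. g r) has_sum s) R" "\<And>r. r \<in> R \<Longrightarrow> f (\<lambda>X. sq X) (?j r) = g r" "\<And>n. n \<notin> ?j ` R \<Longrightarrow> f (\<lambda>X. sq X) n = 0"
    for f :: "('x ell2 \<Rightarrow> nat \<Rightarrow> 'a ell2) \<Rightarrow> nat \<Rightarrow> 'c::{comm_monoid_add,topological_space}" and g s
  proof -
    have "((\<lambda>r. f (\<lambda>X. sq X) (?j r)) has_sum s) R"
      using that(1,2) by (subst has_sum_cong[of R _ g]) auto
    then have "(f (\<lambda>X. sq X) has_sum s) (?j ` R)"
      by (subst has_sum_reindex[OF j]) (simp add: o_def)
    then show ?thesis
      by (rule has_sum_cong_neutral[THEN iffD1, rotated -1]) (use that(3) in auto)
  qed
  have sq: "sq X (?j r) = slice (swap_pairing \<iota>) r X" if "r \<in> R" for X r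
    using that j by (simp add: sq_def)
  have sq0: "sq X n = 0" if "n \<notin> ?j ` R" for X n using that by (simp add: sq_def)
  have summ: "summable (\<lambda>n. (norm (sq X n))\<^sup>2)" for X
  proof -
    have "(\<lambda>r. (norm (slice (swap_pairing \<iota>) r X))\<^sup>2) summable_on R"
      by (rule summable_on_subset_banach[OF has_sum_imp_summable[OF norm_slices[OF \<iota>']]]) simp
    then obtain s where "((\<lambda>r. (norm (slice (swap_pairing \<iota>) r X))\<^sup>2) has_sum s) R" by (auto simp: summable_on_def)
    then have "((\<lambda>n. (norm (sq X n))\<^sup>2) has_sum s) UNIV"
      using transfer[of "\<lambda>r. (norm (slice (swap_pairing \<iota>) r X))\<^sup>2" s "\<lambda>q n. (norm (q X n))\<^sup>2"]
      by (simp add: sq sq0)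
    then show ?thesis using has_sum_imp_summable summable_on_imp_summable by blast
  qed
  have "(\<Sum>n. cinner (sq \<Xi> n) (T (sq H n))) = cinner \<Xi> (amp \<iota> T H)" for T :: "'a ell2 \<Rightarrow>\<^sub>L 'a ell2"
  proof -
    have "((\<lambda>r. cinner (slice (swap_pairing \<iota>) r \<Xi>) (T (slice (swap_pairing \<iota>) r H))) has_sum cinner \<Xi> (amp \<iota> T H)) UNIV"
      using cinner_slices[OF \<iota>', of \<Xi> "amp \<iota> T H"] by (simp add: slice_amp[OF \<iota>])
    then have "((\<lambda>r. cinner (slice (swap_pairing \<iota>) r \<Xi>) (T (slice (swap_pairing \<iota>) r H))) has_sum cinner \<Xi> (amp \<iota> T H)) R"
      by (rule has_sum_cong_neutral[THEN iffD1, rotated -1]) (auto simp: R_def)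
    then have "((\<lambda>n. cinner (sq \<Xi> n) (T (sq H n))) has_sum cinner \<Xi> (amp \<iota> T H)) UNIV"
      using transfer[of "\<lambda>r. cinner (slice (swap_pairing \<iota>) r \<Xi>) (T (slice (swap_pairing \<iota>) r H))" _ "\<lambda>q n. cinner (q \<Xi> n) (T (q H n))"]
      by (simp add: sq sq0)
    then show ?thesis by (rule sums_unique[OF has_sum_imp_sums, symmetric])
  qed
  then have eq: "{T :: 'a ell2 \<Rightarrow>\<^sub>L 'a ell2. cinner \<Xi> (amp \<iota> T H) \<in> U} = {T :: 'a ell2 \<Rightarrow>\<^sub>L 'a ell2. (\<Sum>n. cinner (sq \<Xi> n) (T (sq H n))) \<in> U}" by simp
  show ?thesis unfolding eq by (rule ultraweak_basic_open[OF summ summ U])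
qed

lemma norm_amp_reindex_le:
  fixes H H' :: "('a \<times> nat) ell2"
  assumes f: "inj f" and sl: "\<And>k. slice (swap_pairing Pair) (f k) H' = slice (swap_pairing Pair) k H"
  shows "norm (amp Pair S H) \<le> norm (amp Pair S H')"
proof -
  note * = norm_slices[OF pairing_swap[OF pairing_Pair]]
  have "((\<lambda>k. (norm (S (slice (swap_pairing Pair) (f k) H')))\<^sup>2) has_sum (norm (amp Pair S H))\<^sup>2) UNIV"
    using *[of "amp Pair S H"] by (simp add: slice_amp[OF pairing_Pair] sl)
  then have "((\<lambda>k. (norm (S (slice (swap_pairing Pair) k H')))\<^sup>2) has_sum (norm (amp Pair S H))\<^sup>2) (range f)"
    by (subst has_sum_reindex[OF f]) (simp add: o_def)
  moreover have "((\<lambda>k. (norm (S (slice (swap_pairing Pair) k H')))\<^sup>2) has_sum (norm (amp Pair S H'))\<^sup>2) UNIV"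
    using *[of "amp Pair S H'"] by (simp add: slice_amp[OF pairing_Pair])
  ultimately have "(norm (amp Pair S H))\<^sup>2 \<le> (norm (amp Pair S H'))\<^sup>2"
    by (rule has_sum_mono2) auto
  then show ?thesis by (rule power2_le_imp_le) simp
qed

text \<open>Alternating the slices of both vectors gives one vector whose seminorm dominates both;
  this handles intersections of neighbourhoods.\<close>

lemma interleave:
  fixes H H' :: "('a \<times> nat) ell2"
  shows "\<exists>K :: ('a \<times> nat) ell2. \<forall>S :: 'a ell2 \<Rightarrow>\<^sub>L 'a ell2.
    norm (amp Pair S H) \<le> norm (amp Pair S K) \<and> norm (amp Pair S H') \<le> norm (amp Pair S K)"
proof -
  note \<iota>' = pairing_swap[OF pairing_Pair]
  let ?s = "slice (swap_pairing Pair)"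
  define k where "k n = (if even n then ?s (n div 2) H else ?s (n div 2) H')" for n :: nat
  have "((\<lambda>n. (norm (k n))\<^sup>2) has_sum (norm H)\<^sup>2) (range (\<lambda>n. 2 * n))"
    using norm_slices[OF \<iota>', of H] by (subst has_sum_reindex) (auto simp: o_def k_def inj_on_def)
  moreover have "((\<lambda>n. (norm (k n))\<^sup>2) has_sum (norm H')\<^sup>2) (range (\<lambda>n. 2 * n + 1))"
    using norm_slices[OF \<iota>', of H'] by (subst has_sum_reindex) (auto simp: o_def k_def inj_on_def)
  ultimately have "((\<lambda>n. (norm (k n))\<^sup>2) has_sum (norm H)\<^sup>2 + (norm H')\<^sup>2) (range (\<lambda>n. 2 * n) \<union> range (\<lambda>n. 2 * n + 1))"
    by (rule has_sum_Un_disjoint) (auto, presburger)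
  moreover have "range (\<lambda>n. 2 * n) \<union> range (\<lambda>n. 2 * n + 1) = (UNIV :: nat set)"
    by (auto simp: image_iff) presburger
  ultimately have "(\<lambda>n. (norm (k n))\<^sup>2) summable_on UNIV" using has_sum_imp_summable by metis
  from slice_glue[OF \<iota>' this] have K: "?s n (glue (swap_pairing Pair) k) = k n" for n .
  show ?thesis
  proof (intro exI[of _ "glue (swap_pairing Pair) k"] allI conjI)
    show "norm (amp Pair S H) \<le> norm (amp Pair S (glue (swap_pairing Pair) k))" for S :: "'a ell2 \<Rightarrow>\<^sub>L 'a ell2"
      by (rule norm_amp_reindex_le[of "\<lambda>n. 2 * n"]) (auto simp: K k_def inj_on_def)
    show "norm (amp Pair S H') \<le> norm (amp Pair S (glue (swap_pairing Pair) k))" for S :: "'a ell2 \<Rightarrow>\<^sub>L 'a ell2"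
      by (rule norm_amp_reindex_le[of "\<lambda>n. 2 * n + 1"]) (auto simp: K k_def inj_on_def)
  qed
qed

text \<open>Ultraweakly open sets are ultrastrongly open, and one seminorm from a single amplified
  vector suffices at each point. Approximation by the group algebra is proved in exactly these
  seminorms.\<close>

lemma ultraweak_neighbourhood:
  fixes x :: "'a ell2 \<Rightarrow>\<^sub>L 'a ell2"
  assumes "openin ultraweak W" "x \<in> W"
  shows "\<exists>(H :: ('a \<times> nat) ell2) \<delta>. 0 < \<delta> \<and> (\<forall>y. norm (amp Pair (y - x) H) < \<delta> \<longrightarrow> y \<in> W)"
  using openin_topology_generated_by[OF assms(1)[unfolded ultraweak_def]] assms(2)
proof (induction arbitrary: x)
  case (Int a b)
  then have x: "x \<in> a" "x \<in> b" by auto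
  obtain H :: "('a \<times> nat) ell2" and \<delta>
    where 1: "0 < \<delta>" "\<And>y. norm (amp Pair (y - x) H) < \<delta> \<Longrightarrow> y \<in> a"
    using Int.IH(1)[OF x(1)] by blast
  obtain H' :: "('a \<times> nat) ell2" and \<delta>'
    where 2: "0 < \<delta>'" "\<And>y. norm (amp Pair (y - x) H') < \<delta>' \<Longrightarrow> y \<in> b"
    using Int.IH(2)[OF x(2)] by blast
  obtain K :: "('a \<times> nat) ell2"
    where K: "\<And>S. norm (amp Pair S H) \<le> norm (amp Pair S K) \<and> norm (amp Pair S H') \<le> norm (amp Pair S K)"
    using interleave[of H H'] by auto
  have *: "y \<in> a \<inter> b" if "norm (amp Pair (y - x) K) < min \<delta> \<delta>'" for y
    using 1(2)[of y] 2(2)[of y] K[of "y - x"] that by simp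
  show ?case using 1(1) 2(1) * by (intro exI[of _ K] exI[of _ "min \<delta> \<delta>'"]) auto
next
  case (UN K)
  then obtain k where k: "k \<in> K" "x \<in> k" by blast
  from UN.IH[OF this] show ?case using k(1) by (meson UnionI)
next
  case (Basis s)
  then obtain \<xi> \<eta> U where s: "s = {T :: 'a ell2 \<Rightarrow>\<^sub>L 'a ell2. (\<Sum>k. cinner (\<xi> k) (T (\<eta> k))) \<in> U}"
    and sum: "summable (\<lambda>k. (norm (\<xi> k))\<^sup>2)" "summable (\<lambda>k. (norm (\<eta> k))\<^sup>2)" and U: "open U"
    by blast
  obtain \<Xi> where \<Xi>: "\<And>k. slice (swap_pairing Pair) k \<Xi> = \<xi> k" using sequence_vector[OF sum(1)] by blast
  obtain H where H: "\<And>k. slice (swap_pairing Pair) k H = \<eta> k" using sequence_vector[OF sum(2)] by blast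
  have s': "s = {T. cinner \<Xi> (amp Pair T H) \<in> U}"
    unfolding s by (simp add: sequence_functional[OF \<Xi> H])
  then have "cinner \<Xi> (amp Pair x H) \<in> U" using Basis by blast
  then obtain e where e: "0 < e" "ball (cinner \<Xi> (amp Pair x H)) e \<subseteq> U" using U open_contains_ball by blast
  have *: "y \<in> s" if "norm (amp Pair (y - x) H) < e / (norm \<Xi> + 1)" for y
  proof -
    have "cmod (cinner \<Xi> (amp Pair y H) - cinner \<Xi> (amp Pair x H)) \<le> norm \<Xi> * norm (amp Pair (y - x) H)"
      unfolding amp_diff[OF pairing_Pair] blinfun.diff_left cinner_diff_right[symmetric] by (rule norm_cinner_le)
    also have "\<dots> \<le> (norm \<Xi> + 1) * norm (amp Pair (y - x) H)" by (intro mult_right_mono) auto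
    also have "\<dots> < (norm \<Xi> + 1) * (e / (norm \<Xi> + 1))"
      using that by (intro mult_strict_left_mono) (auto simp: add_nonneg_pos)
    also have "\<dots> = e" using norm_ge_zero[of \<Xi>] by (simp add: add_nonneg_eq_0_iff)
    finally have "cinner \<Xi> (amp Pair y H) \<in> ball (cinner \<Xi> (amp Pair x H)) e"
      by (simp add: dist_norm norm_minus_commute)
    then show ?thesis using e(2) by (auto simp: s')
  qed
  have "0 < e / (norm \<Xi> + 1)" using e(1) by (intro divide_pos_pos) (auto simp: add_nonneg_pos)
  with * show ?case by (intro exI[of _ H] exI[of _ "e / (norm \<Xi> + 1)"]) auto
qed simp

text \<open>Amplifying twice is one amplification over the product of the multiplicity spaces; a
  functional pulled back along \<open>amp \<iota>\<close> is thus again of the form treated in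
  \<open>ultraweak_amp_open\<close>.\<close>

lemma amp_amp:
  fixes \<iota> :: "'p \<Rightarrow> 'q \<Rightarrow> 'x"
  assumes \<iota>: "pairing \<iota>"
  defines "\<kappa> \<equiv> (\<lambda>p (q, k :: nat). (\<iota> p q, k))"
  shows "pairing \<kappa>" "amp Pair (amp \<iota> T) = amp \<kappa> T"
proof -
  show \<kappa>: "pairing \<kappa>"
    unfolding pairing_def
  proof (rule bijI)
    show "inj (case_prod \<kappa>)"
      by (rule injI) (auto simp: \<kappa>_def pairing_inj[OF \<iota>])
    have "(x, k) \<in> range (case_prod \<kappa>)" for x k
    proof -
      obtain p q where "x = \<iota> p q" using pairing_cases[OF \<iota>] by blast
      then have "(x, k) = case_prod \<kappa> (p, q, k)" by (simp add: \<kappa>_def)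
      then show ?thesis by blast
    qed
    then show "surj (case_prod \<kappa>)" by auto
  qed
  have sl: "slice (swap_pairing \<kappa>) (q, k) x = slice (swap_pairing \<iota>) q (slice (swap_pairing Pair) k x)" for q k x
    by (rule ell2_eqI)
      (simp add: Rep_slice[OF pairing_swap[OF \<kappa>]] Rep_slice[OF pairing_swap[OF \<iota>]]
        Rep_slice[OF pairing_swap[OF pairing_Pair]], simp add: \<kappa>_def swap_pairing_def)
  have "amp \<kappa> T x = amp Pair (amp \<iota> T) x" for x
  proof (rule amp_eqI[OF \<kappa>])
    fix r :: "'q \<times> nat" and x
    obtain q k where "r = (q, k)" by fastforce
    then show "slice (swap_pairing \<kappa>) r (amp Pair (amp \<iota> T) x) = T (slice (swap_pairing \<kappa>) r x)"
      by (simp add: sl slice_amp[OF pairing_Pair] slice_amp[OF \<iota>])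
  qed
  then show "amp Pair (amp \<iota> T) = amp \<kappa> T" by (intro blinfun_eqI) simp
qed

lemma ultraweak_continuousI:
  fixes F :: "('h::chilbert_space \<Rightarrow>\<^sub>L 'h) \<Rightarrow> ('k::chilbert_space \<Rightarrow>\<^sub>L 'k)"
  assumes F: "linear_map A B F"
    and "\<And>\<xi> \<eta> U. summable (\<lambda>k. (norm (\<xi> k))\<^sup>2) \<Longrightarrow> summable (\<lambda>k. (norm (\<eta> k))\<^sup>2) \<Longrightarrow> open U \<Longrightarrow>
      openin ultraweak {T. (\<Sum>k. cinner (\<xi> k) (blinfun_apply (F T) (\<eta> k))) \<in> U}"
  shows "normal_map A B F"
proof -
  have "continuous_map (subtopology ultraweak A) ultraweak F"
    unfolding ultraweak_def[where 'h = 'k] continuous_on_generated_topo_iff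
  proof (intro conjI allI impI)
    fix W assume "W \<in> {{T :: 'k \<Rightarrow>\<^sub>L 'k. (\<Sum>k. cinner (\<xi> k) (T (\<eta> k))) \<in> U} | \<xi> \<eta> U.
      summable (\<lambda>k. (norm (\<xi> k))\<^sup>2) \<and> summable (\<lambda>k. (norm (\<eta> k))\<^sup>2) \<and> open U}"
    then have "openin ultraweak (F -` W)" using assms(2) by auto
    then show "openin (subtopology ultraweak A) (F -` W \<inter> topspace (subtopology ultraweak A))"
      by (auto simp: openin_subtopology topspace_ultraweak topspace_subtopology)
  next
    show "F ` topspace (subtopology ultraweak A) \<subseteq> \<Union> {{T :: 'k \<Rightarrow>\<^sub>L 'k. (\<Sum>k. cinner (\<xi> k) (T (\<eta> k))) \<in> U} | \<xi> \<eta> U.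
      summable (\<lambda>k. (norm (\<xi> k))\<^sup>2) \<and> summable (\<lambda>k. (norm (\<eta> k))\<^sup>2) \<and> open U}"
      using topspace_ultraweak[where 'h = 'k] unfolding ultraweak_def topology_generated_by_topspace by simp
  qed
  then show ?thesis
    using F by (auto simp: normal_map_def continuous_map_in_subtopology linear_map_def)
qed

lemma normal_map_amp:
  fixes \<iota> :: "'a \<Rightarrow> 'q \<Rightarrow> 'x"
  assumes \<iota>: "pairing \<iota>" and AM: "\<And>x. x \<in> A \<Longrightarrow> amp \<iota> x \<in> M"
  shows "normal_map A M (amp \<iota>)"
proof (rule ultraweak_continuousI)
  show "linear_map A M (amp \<iota>)"
    using AM by (auto simp: linear_map_def amp_add[OF \<iota>] amp_scaleC[OF \<iota>])
  fix \<xi> \<eta> :: "nat \<Rightarrow> 'x ell2" and U :: "complex set"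
  assume \<xi>: "summable (\<lambda>k. (norm (\<xi> k))\<^sup>2)" and \<eta>: "summable (\<lambda>k. (norm (\<eta> k))\<^sup>2)" and U: "open U"
  obtain \<Xi> where \<Xi>: "\<And>k. slice (swap_pairing Pair) k \<Xi> = \<xi> k" using sequence_vector[OF \<xi>] by blast
  obtain H where H: "\<And>k. slice (swap_pairing Pair) k H = \<eta> k" using sequence_vector[OF \<eta>] by blast
  show "openin ultraweak {T. (\<Sum>k. cinner (\<xi> k) (amp \<iota> T (\<eta> k))) \<in> U}"
    unfolding sequence_functional[OF \<Xi> H] amp_amp(2)[OF \<iota>] by (rule ultraweak_amp_open[OF amp_amp(1)[OF \<iota>] U])
qed

text \<open>Pulling a functional back along the compression replaces its sequences by their images
  under the isometry \<open>V\<close>, which stay square summable.\<close>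

lemma normal_map_compression:
  fixes V :: "'h::chilbert_space \<Rightarrow>\<^sub>L 'k::chilbert_space"
  assumes lin: "linear_map A B E" and V: "\<And>\<xi>. norm (V \<xi>) = norm \<xi>"
    and E: "\<And>y \<xi> \<eta>. cinner \<xi> (blinfun_apply (E y) \<eta>) = cinner (V \<xi>) (y (V \<eta>))"
  shows "normal_map A B E"
  by (rule ultraweak_continuousI[OF lin]) (simp add: E V ultraweak_basic_open)

text \<open>An operator that preserves a closed subspace and its orthogonal complement commutes with
  the projection. The maps \<open>f\<close> are real linear, so that complex scalars and group
  elements can both be inserted; the former give complex linearity of \<open>P\<close>.\<close>

lemma commuting_projection:
  fixes S :: "'h::chilbert_space set"
  assumes S: "subspace S" "closed S"
  shows "\<exists>P :: 'h \<Rightarrow>\<^sub>L 'h. (\<forall>x\<in>S. P x = x) \<and> (\<forall>x. P x \<in> S) \<and>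
    (\<forall>f. linear f \<longrightarrow> (\<forall>x\<in>S. f x \<in> S) \<longrightarrow>
      (\<forall>z. (\<forall>y\<in>S. inner z y = 0) \<longrightarrow> (\<forall>y\<in>S. inner (f z) y = 0)) \<longrightarrow> (\<forall>x. P (f x) = f (P x)))"
proof -
  have "subspace ((\<lambda>x. (x, x)) ` S)"
    by (rule linear_subspace_image[OF _ S(1)]) (simp add: linear_iff)
  from bounded_extension[OF this, of 1 S] obtain P :: "'h \<Rightarrow>\<^sub>L 'h"
    where P: "\<forall>x\<in>S. P x = x" "\<forall>z. (\<forall>x\<in>S. inner z x = 0) \<longrightarrow> P z = 0"
    using closure_closed[OF S(2)] by (auto simp: image_image)
  have PP: "P x = p" if "p \<in> S" "\<And>y. y \<in> S \<Longrightarrow> inner (x - p) y = 0" for x p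
  proof -
    have "P (x - p) = 0" using P(2) that(2) by blast
    then show ?thesis using P(1) that(1) by (simp add: blinfun.diff_right)
  qed
  show ?thesis
  proof (intro exI[of _ P] conjI allI ballI impI)
    show "P x = x" if "x \<in> S" for x using P(1) that by blast
    show "P x \<in> S" for x using orthogonal_projection_exists[OF S, of x] PP by metis
    fix f x assume f: "linear f" "\<forall>x\<in>S. f x \<in> S"
      "\<forall>z. (\<forall>y\<in>S. inner z y = 0) \<longrightarrow> (\<forall>y\<in>S. inner (f z) y = 0)"
    obtain p where p: "p \<in> S" "\<And>y. y \<in> S \<Longrightarrow> inner (x - p) y = 0"
      using orthogonal_projection_exists[OF S, of x] by blast
    have "P (f x) = f p"
      by (rule PP) (use f(2) f(3)[rule_format, OF p(2)] p(1) in \<open>simp_all add: linear_diff[OF f(1), symmetric]\<close>)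
    then show "P (f x) = f (P x)" using PP[OF p] by simp
  qed
qed

section \<open>The group von Neumann algebra\<close>

lemma clinear_ops_left_regular [simp, intro]: "left_regular g \<in> clinear_ops"
  by (rule clinear_opsI, rule ell2_eqI) (simp add: left_regular.rep_eq translate.rep_eq scaleC_ell2.rep_eq)

lemma Rep_left_regular: "Rep_ell2 (left_regular g x) h = Rep_ell2 x (- g + h)"
  by (simp add: left_regular.rep_eq translate.rep_eq)

lemma left_regular_zero: "left_regular 0 = id_blinfun"
  by (rule blinfun_eqI, rule ell2_eqI) (simp add: Rep_left_regular)

lemma left_regular_compose: "left_regular g o\<^sub>L left_regular h = left_regular (g + h)"
  by (rule blinfun_eqI, rule ell2_eqI) (simp add: Rep_left_regular minus_add add.assoc diff_conv_add_uminus del: add_uminus_conv_diff)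

lemma adj_left_regular: "adj (left_regular g) = left_regular (- g)"
proof (rule adj_eqI)
  fix x y :: "'a ell2"
  have "((\<lambda>a. cnj (Rep_ell2 x (g + a)) * Rep_ell2 y (- g + (g + a))) has_sum cinner x (left_regular g y)) UNIV"
    using cinner_ell2_has_sum[of x "left_regular g y"]
      has_sum_reindex_bij_betw[OF bij_plus[of g], of "\<lambda>a. cnj (Rep_ell2 x a) * Rep_ell2 y (- g + a)"]
    by (simp add: Rep_left_regular)
  then show "cinner (left_regular (- g) x) y = cinner x (left_regular g y)"
    using cinner_ell2_has_sum[of "left_regular (- g) x" y]
    by (simp add: Rep_left_regular add.assoc[symmetric] has_sum_unique)
qed simp

lift_definition translate_right :: "'g::group_add \<Rightarrow> 'g ell2 \<Rightarrow> 'g ell2" is "\<lambda>g f h. f (h + g)"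
  subgoal for g f
    using summable_on_reindex_bij_betw[OF bij_plus_right[of g], of "\<lambda>i. (cmod (f i))\<^sup>2"] by simp
  done

lemma norm_translate_right: "norm (translate_right g f) = norm f"
proof -
  have "(norm (translate_right g f))\<^sup>2 = (norm f)\<^sup>2"
    unfolding norm_ell2_square translate_right.rep_eq
    by (rule infsum_reindex_bij_betw[OF bij_plus_right[of g], of "\<lambda>i. (cmod (Rep_ell2 f i))\<^sup>2"])
  then show ?thesis by simp
qed

lift_definition right_regular :: "'g::group_add \<Rightarrow> 'g ell2 \<Rightarrow>\<^sub>L 'g ell2" is translate_right
  subgoal for g
  proof (rule bounded_linear_intro[where K = 1])
    show "translate_right g (x + y) = translate_right g x + translate_right g y" for x y by transfer simp
    show "translate_right g (r *\<^sub>R x) = r *\<^sub>R translate_right g x" for r x by transfer simp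
  qed (simp add: norm_translate_right)
  done

lemma Rep_right_regular: "Rep_ell2 (right_regular g x) h = Rep_ell2 x (h + g)"
  by (simp add: right_regular.rep_eq translate_right.rep_eq)

lemma clinear_ops_right_regular [simp, intro]: "right_regular g \<in> clinear_ops"
  by (rule clinear_opsI, rule ell2_eqI) (simp add: Rep_right_regular scaleC_ell2.rep_eq)

lemma right_regular_basis: "right_regular g (ell2_basis h) = ell2_basis (h - g)"
  by (rule ell2_eqI) (auto simp: Rep_right_regular ell2_basis.rep_eq diff_eq_eq[symmetric])

lemma adj_right_regular: "adj (right_regular g) = right_regular (- g)"
proof (rule adj_eqI)
  fix x y :: "'a ell2"
  have "((\<lambda>a. cnj (Rep_ell2 x (a + - g)) * Rep_ell2 y (a + - g + g)) has_sum cinner x (right_regular g y)) UNIV"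
    using cinner_ell2_has_sum[of x "right_regular g y"]
      has_sum_reindex_bij_betw[OF bij_plus_right[of "- g"], of "\<lambda>a. cnj (Rep_ell2 x a) * Rep_ell2 y (a + g)"]
    by (simp add: Rep_right_regular)
  then show "cinner (right_regular (- g) x) y = cinner x (right_regular g y)"
    using cinner_ell2_has_sum[of "right_regular (- g) x" y]
    by (simp add: Rep_right_regular has_sum_unique)
qed simp

lemma range_left_regular: "range left_regular \<subseteq> clinear_ops" "S \<in> range left_regular \<Longrightarrow> adj S \<in> range left_regular"
  by (auto simp: adj_left_regular)

lemma VN_eq_bicommutant: "VN = commutant (commutant (range left_regular))"
proof
  let ?C = "commutant (commutant (range left_regular))"
  show "VN \<subseteq> ?C"
    unfolding VN_def using subset_bicommutant[OF range_left_regular(1)]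
      von_neumann_algebra_bicommutant[OF range_left_regular] by (rule hull_minimal)
  show "?C \<subseteq> VN"
    unfolding VN_def hull_def
  proof (rule Inter_greatest)
    fix A assume "A \<in> {t. von_neumann_algebra t \<and> range left_regular \<subseteq> t}"
    then have "commutant (commutant A) = A" "range left_regular \<subseteq> A" by (auto simp: von_neumann_algebra_def)
    then show "?C \<subseteq> A" using commutant_antimono[OF commutant_antimono] by metis
  qed
qed

lemma von_neumann_algebra_VN: "von_neumann_algebra VN"
  unfolding VN_eq_bicommutant by (rule von_neumann_algebra_bicommutant[OF range_left_regular])

lemma left_regular_VN: "left_regular g \<in> VN"
  unfolding VN_eq_bicommutant using subset_bicommutant[OF range_left_regular(1)] by blast

lemma right_regular_commutant: "right_regular g \<in> commutant (range left_regular)"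
  by (rule commutantI, blast)
    (auto intro!: blinfun_eqI ell2_eqI simp: Rep_right_regular Rep_left_regular add.assoc)

lemma matrix_product:
  assumes "S \<in> clinear_ops"
  shows "((\<lambda>m. cinner (ell2_basis k) (blinfun_apply S (ell2_basis m)) * cinner (ell2_basis m) (blinfun_apply T (ell2_basis h)))
    has_sum cinner (ell2_basis k) (S (blinfun_apply T (ell2_basis h)))) UNIV"
proof -
  have "((\<lambda>m. cnj (Rep_ell2 (adj S (ell2_basis k)) m) * Rep_ell2 (T (ell2_basis h)) m) has_sum
      cinner (adj S (ell2_basis k)) (T (ell2_basis h))) UNIV"
    by (rule cinner_ell2_has_sum)
  moreover have "cnj (Rep_ell2 (adj S (ell2_basis k)) m) = cinner (ell2_basis k) (S (ell2_basis m))" for m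
    using cinner_commute[of "adj S (ell2_basis k)" "ell2_basis m"] by (simp add: cinner_basis[symmetric] adj_left[OF assms])
  ultimately show ?thesis by (simp add: cinner_basis adj_left[OF assms])
qed

text \<open>The commutation theorem for the regular representations. Entries of \<open>x\<close>
  depend on \<open>k - m\<close> and entries of \<open>T\<close> on \<open>- m + k\<close>, so both
  products are convolution sums that agree after a change of variables.\<close>

lemma VN_eq_commutant_right: "(VN :: ('a::group_add ell2 \<Rightarrow>\<^sub>L 'a ell2) set) = commutant (range right_regular)"
proof
  show "(VN :: ('a ell2 \<Rightarrow>\<^sub>L 'a ell2) set) \<subseteq> commutant (range right_regular)"
    unfolding VN_eq_bicommutant by (rule commutant_antimono) (use right_regular_commutant in blast)
  show "commutant (range right_regular) \<subseteq> (VN :: ('a ell2 \<Rightarrow>\<^sub>L 'a ell2) set)"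
    unfolding VN_eq_bicommutant
  proof (intro subsetI, rule commutantI)
    fix x :: "'a ell2 \<Rightarrow>\<^sub>L 'a ell2" assume x: "x \<in> commutant (range right_regular)"
    show xc: "x \<in> clinear_ops" using x by (rule commutant_clinear)
    fix T :: "'a ell2 \<Rightarrow>\<^sub>L 'a ell2" assume T: "T \<in> commutant (range left_regular)"
    have Tc: "T \<in> clinear_ops" using T by (rule commutant_clinear)
    define X where "X g = cinner (ell2_basis g) (x (ell2_basis 0))" for g
    define F where "F g = cinner (ell2_basis g) (T (ell2_basis 0))" for g
    have X: "cinner (ell2_basis k) (x (ell2_basis m)) = X (k - m)" for k m
    proof -
      have "x (ell2_basis m) = right_regular (- m) (x (ell2_basis 0))"
        using commutant_apply[OF x, of "right_regular (- m)" "ell2_basis 0"] by (simp add: right_regular_basis)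
      then show ?thesis by (simp add: X_def cinner_basis Rep_right_regular)
    qed
    have F: "cinner (ell2_basis k) (T (ell2_basis m)) = F (- m + k)" for k m
    proof -
      have "T (ell2_basis m) = left_regular m (T (ell2_basis 0))"
        using commutant_apply[OF T, of "left_regular m" "ell2_basis 0"] by (simp add: left_regular_basis)
      then show ?thesis by (simp add: F_def cinner_basis Rep_left_regular)
    qed
    show "x o\<^sub>L T = T o\<^sub>L x"
    proof (rule ell2_op_eqI)
      fix k h
      have 1: "((\<lambda>m. X (k - m) * F (- h + m)) has_sum cinner (ell2_basis k) (x (T (ell2_basis h)))) UNIV"
        using matrix_product[OF xc, of k T h] by (simp add: X F)
      have 2: "((\<lambda>m. F (- m + k) * X (m - h)) has_sum cinner (ell2_basis k) (T (x (ell2_basis h)))) UNIV"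
        using matrix_product[OF Tc, of k x h] by (simp add: X F)
      \<comment> \<open>The substitution exchanging the two convolution sums.\<close>
      have b: "bij (\<lambda>m. k - m + h)"
        by (rule bij_betw_byWitness[where f' = "\<lambda>m. h - m + k"]) (auto simp: diff_conv_add_uminus minus_add add.assoc simp del: add_uminus_conv_diff)
      have "((\<lambda>m. F (- (k - m + h) + k) * X ((k - m + h) - h)) has_sum cinner (ell2_basis k) (T (x (ell2_basis h)))) UNIV"
        using 2 has_sum_reindex_bij_betw[OF b, of "\<lambda>m. F (- m + k) * X (m - h)"] by simp
      moreover have "- (k - m + h) + k = - h + m" for m
        by (simp add: diff_conv_add_uminus minus_add add.assoc del: add_uminus_conv_diff)
      ultimately show "cinner (ell2_basis k) ((x o\<^sub>L T) (ell2_basis h)) = cinner (ell2_basis k) ((T o\<^sub>L x) (ell2_basis h))"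
        using 1 has_sum_unique by (simp add: mult.commute) blast
    qed (use xc Tc in blast)+
  qed
qed

text \<open>Spans are real, so complex multiples are included among the generators; the result is
  the complex group algebra.\<close>

definition group_span :: "('g::group_add ell2 \<Rightarrow>\<^sub>L 'g ell2) set"
  where "group_span = span {c *\<^sub>C left_regular g | c g. True}"

lemma scaleC_blinfun_scaleR: "r *\<^sub>R (T :: 'h::chilbert_space \<Rightarrow>\<^sub>L 'h) = complex_of_real r *\<^sub>C T"
  by (rule blinfun_eqI) (simp add: scaleC_blinfun.rep_eq blinfun.scaleR_left scaleR_scaleC)

lemma group_span_closed:
  shows "S \<in> group_span \<Longrightarrow> c *\<^sub>C S \<in> group_span"
    and "S \<in> group_span \<Longrightarrow> left_regular g o\<^sub>L S \<in> group_span"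
proof -
  let ?B = "{c *\<^sub>C left_regular g | c g. True} :: ('a ell2 \<Rightarrow>\<^sub>L 'a ell2) set"
  have "span ?B \<subseteq> {S. c *\<^sub>C S \<in> span ?B \<and> left_regular g o\<^sub>L S \<in> span ?B}"
  proof (rule span_minimal)
    show "?B \<subseteq> {S. c *\<^sub>C S \<in> span ?B \<and> left_regular g o\<^sub>L S \<in> span ?B}"
    proof (rule subsetI, elim CollectE exE conjE, simp only:, intro CollectI conjI)
      fix d h
      have "c *\<^sub>C d *\<^sub>C left_regular h = (c * d) *\<^sub>C (left_regular h :: 'a ell2 \<Rightarrow>\<^sub>L 'a ell2)"
        by (rule blinfun_eqI) (simp add: scaleC_blinfun.rep_eq scaleC_scaleC)
      then have "c *\<^sub>C d *\<^sub>C left_regular h \<in> ?B" by auto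
      then show "c *\<^sub>C d *\<^sub>C left_regular h \<in> span ?B" by (rule span_base)
      have "left_regular g o\<^sub>L d *\<^sub>C left_regular h = d *\<^sub>C left_regular (g + h)"
        by (rule blinfun_eqI) (simp add: scaleC_blinfun.rep_eq clinear_opsD flip: left_regular_compose)
      then have "left_regular g o\<^sub>L d *\<^sub>C left_regular h \<in> ?B" by auto
      then show "left_regular g o\<^sub>L d *\<^sub>C left_regular h \<in> span ?B" by (rule span_base)
    qed
    have l1: "linear (\<lambda>S :: 'a ell2 \<Rightarrow>\<^sub>L 'a ell2. c *\<^sub>C S)"
      by (rule linearI; rule blinfun_eqI)
        (simp_all add: scaleC_blinfun.rep_eq blinfun.add_left blinfun.scaleR_left scaleC_add_right scaleC_scaleR_commute)
    have l2: "linear (\<lambda>S :: 'a ell2 \<Rightarrow>\<^sub>L 'a ell2. left_regular g o\<^sub>L S)"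
      by (rule bounded_linear.linear[OF bounded_linear_compose_left])
    show "subspace {S. c *\<^sub>C S \<in> span ?B \<and> left_regular g o\<^sub>L S \<in> span ?B}"
      unfolding subspace_def
      by (auto simp: linear_add[OF l1] linear_add[OF l2] linear_0[OF l1] linear_0[OF l2] linear_scale[OF l1] linear_scale[OF l2]
          intro: span_add span_scale span_zero)
  qed
  then show "S \<in> group_span \<Longrightarrow> c *\<^sub>C S \<in> group_span" "S \<in> group_span \<Longrightarrow> left_regular g o\<^sub>L S \<in> group_span"
    unfolding group_span_def by auto
qed

lemma group_span_induct [consumes 1, case_names gen zero add scale]:
  assumes "S \<in> group_span" "\<And>c g. P (c *\<^sub>C left_regular g)" "P 0"
    "\<And>S T. S \<in> group_span \<Longrightarrow> T \<in> group_span \<Longrightarrow> P S \<Longrightarrow> P T \<Longrightarrow> P (S + T)"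
    "\<And>r S. S \<in> group_span \<Longrightarrow> P S \<Longrightarrow> P (r *\<^sub>R S)"
  shows "P S"
proof -
  have "S \<in> group_span \<and> P S"
    using assms(1) unfolding group_span_def
  proof (induction rule: span_induct_alt)
    case base
    show ?case using assms(3) by (simp add: span_zero)
  next
    case (step r x y)
    then have "x \<in> group_span" "y \<in> group_span" "P x"
      unfolding group_span_def using assms(2) by (auto intro: span_base)
    then show ?case using step assms(4)[of "r *\<^sub>R x" y] assms(5)[of x r]
      unfolding group_span_def[symmetric] by (auto simp: group_span_def intro: span_add span_scale)
  qed
  then show ?thesis by blast
qed

lemma group_span_VN: "S \<in> group_span \<Longrightarrow> S \<in> VN"
proof (induction rule: group_span_induct)
  note cl = von_neumann_algebra_closed[OF von_neumann_algebra_VN]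
  case (gen c g)
  show ?case by (intro cl left_regular_VN)
next
  note cl = von_neumann_algebra_closed[OF von_neumann_algebra_VN]
  case zero
  have "0 *\<^sub>C left_regular 0 \<in> VN" by (intro cl left_regular_VN)
  then show ?case by (metis scaleC_blinfun_scaleR of_real_0 scaleR_zero_left)
next
  case (add S T)
  then show ?case using von_neumann_algebra_closed(5)[OF von_neumann_algebra_VN] by blast
next
  case (scale r S)
  then show ?case unfolding scaleC_blinfun_scaleR using von_neumann_algebra_closed(6)[OF von_neumann_algebra_VN] by blast
qed

text \<open>The projection onto the closure of the orbit of \<open>H\<close> commutes with the amplified group, hence with
  the amplification of \<open>x\<close>.\<close>

lemma group_span_dense:
  fixes x :: "'g::group_add ell2 \<Rightarrow>\<^sub>L 'g ell2" and H :: "('g \<times> nat) ell2"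
  assumes x: "x \<in> VN" and e: "0 < e"
  shows "\<exists>a\<in>group_span. norm (amp Pair (a - x) H) < e"
proof -
  note PP = pairing_Pair
  let ?A = "(\<lambda>a. amp Pair a H) ` (group_span :: ('g ell2 \<Rightarrow>\<^sub>L 'g ell2) set)"
  let ?S = "closure ?A"
  have lin: "linear (\<lambda>a. amp Pair a H)"
    by (rule linearI) (simp_all add: amp_add[OF PP] blinfun.add_left scaleC_blinfun_scaleR amp_scaleC[OF PP] scaleC_blinfun.rep_eq scaleC_of_real)
  have "subspace ?A" by (rule linear_subspace_image[OF lin]) (simp add: group_span_def)
  then have S: "subspace ?S" "closed ?S" by (auto intro: subspace_closure)
  have inv: "f u \<in> ?S" if f: "bounded_linear f" "\<And>a. a \<in> group_span \<Longrightarrow> f (amp Pair a H) \<in> ?A" and u: "u \<in> ?S" for f u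
  proof -
    have "f ` ?S \<subseteq> ?S"
    proof (rule image_closure_subset)
      show "continuous_on (closure ?A) f" using f(1) by (rule linear_continuous_on)
      show "f ` ?A \<subseteq> closure ?A" using f(2) closure_subset by fastforce
    qed simp
    then show ?thesis using u by blast
  qed
  have invc: "c *\<^sub>C u \<in> ?S" if "u \<in> ?S" for c u
  proof (rule inv[OF bounded_linear_scaleC _ that])
    fix a :: "'g ell2 \<Rightarrow>\<^sub>L 'g ell2" assume "a \<in> group_span"
    then have "amp Pair (c *\<^sub>C a) H \<in> ?A" by (intro imageI group_span_closed(1))
    then show "c *\<^sub>C amp Pair a H \<in> ?A" by (simp add: amp_scaleC[OF PP] scaleC_blinfun.rep_eq)
  qed
  have invg: "amp Pair (left_regular g) u \<in> ?S" if "u \<in> ?S" for g u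
  proof (rule inv[OF blinfun.bounded_linear_right _ that])
    fix a :: "'g ell2 \<Rightarrow>\<^sub>L 'g ell2" assume "a \<in> group_span"
    then have "amp Pair (left_regular g o\<^sub>L a) H \<in> ?A" by (intro imageI group_span_closed(2))
    then show "amp Pair (left_regular g) (amp Pair a H) \<in> ?A" by (simp add: amp_compose[OF PP])
  qed
  obtain P :: "('g \<times> nat) ell2 \<Rightarrow>\<^sub>L ('g \<times> nat) ell2" where P: "\<forall>x\<in>?S. P x = x" "\<forall>x. P x \<in> ?S"
    "\<forall>f. linear f \<longrightarrow> (\<forall>x\<in>?S. f x \<in> ?S) \<longrightarrow>
      (\<forall>z. (\<forall>y\<in>?S. inner z y = 0) \<longrightarrow> (\<forall>y\<in>?S. inner (f z) y = 0)) \<longrightarrow> (\<forall>x. P (f x) = f (P x))"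
    using commuting_projection[OF S] by blast
  have "P \<in> commutant (amp Pair ` range left_regular)"
  proof (rule commutantI)
    show "P \<in> clinear_ops"
    proof (rule clinear_opsI)
      fix c x
      have "inner (c *\<^sub>C z) y = 0" if "\<forall>y\<in>?S. inner z y = 0" "y \<in> ?S" for z y
      proof -
        have "inner z (cnj c *\<^sub>C y) = 0" using invc that by blast
        then show ?thesis by (simp add: inner_eq_Re_cinner cinner_scaleC_left cinner_scaleC_right)
      qed
      then show "P (c *\<^sub>C x) = c *\<^sub>C P x"
        using P(3) bounded_linear.linear[OF bounded_linear_scaleC, of c] invc by auto
    qed
    fix b :: "('g \<times> nat) ell2 \<Rightarrow>\<^sub>L ('g \<times> nat) ell2" assume "b \<in> amp Pair ` range left_regular"
    then obtain g where b: "b = amp Pair (left_regular g)" by blast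
    show "P o\<^sub>L b = b o\<^sub>L P"
      unfolding b
    proof (rule blinfun_eqI)
      fix x
      have "inner (amp Pair (left_regular g) z) y = 0" if "\<forall>y\<in>?S. inner z y = 0" "y \<in> ?S" for z y
      proof -
        have "inner z (amp Pair (left_regular (- g)) y) = 0" using invg that by blast
        then have "inner z (adj (amp Pair (left_regular g)) y) = 0"
          by (simp add: amp_adj[OF PP] adj_left_regular)
        then show ?thesis by (simp add: inner_eq_Re_cinner adj_right amp_clinear[OF PP])
      qed
      then have "P (amp Pair (left_regular g) x) = amp Pair (left_regular g) (P x)"
        using P(3) bounded_linear.linear[OF blinfun.bounded_linear_right, of "amp Pair (left_regular g)"] invg by auto
      then show "(P o\<^sub>L amp Pair (left_regular g)) x = (amp Pair (left_regular g) o\<^sub>L P) x" by simp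
    qed
  qed
  from amp_bicommutant[OF PP range_left_regular(1) this x[unfolded VN_eq_bicommutant]]
  have "P (amp Pair x H) = amp Pair x (P H)" by (metis blinfun_apply_blinfun_compose)
  moreover have "H \<in> ?S"
  proof -
    have "left_regular 0 \<in> (group_span :: ('g ell2 \<Rightarrow>\<^sub>L 'g ell2) set)"
    proof -
      have "(left_regular 0 :: 'g ell2 \<Rightarrow>\<^sub>L 'g ell2) = 1 *\<^sub>C left_regular 0"
        by (rule blinfun_eqI) (simp add: scaleC_blinfun.rep_eq)
      then show ?thesis unfolding group_span_def by (intro span_base) blast
    qed
    then have "amp Pair (left_regular 0) H \<in> ?A" by (rule imageI)
    then have "H \<in> ?A" by (simp add: left_regular_zero amp_id[OF PP])
    then show ?thesis by (rule subsetD[OF closure_subset])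
  qed
  ultimately have "amp Pair x H = P (amp Pair x H)" using P(1) by simp
  then have "amp Pair x H \<in> ?S" using P(2)[rule_format, of "amp Pair x H"] by simp
  then obtain a where "a \<in> group_span" "dist (amp Pair a H) (amp Pair x H) < e"
    using e unfolding closure_approachable by blast
  then show ?thesis by (intro bexI[of _ a]) (auto simp: dist_norm amp_diff[OF PP] blinfun.diff_left)
qed

text \<open>On \<open>left_regular g\<close> the entry at \<open>(a, b)\<close> vanishes unless
  \<open>g = a - b\<close>, which gives the formula on the group algebra. Normality carries it to
  \<open>x\<close>: a single element of the group algebra approximates \<open>x\<close> so well that
  its own entry and that of its image are both close.\<close>

lemma fourier_multiplier_matrix:
  fixes T :: "('g::group_add ell2 \<Rightarrow>\<^sub>L 'g ell2) \<Rightarrow> ('g ell2 \<Rightarrow>\<^sub>L 'g ell2)"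
  assumes T: "fourier_multiplier t T" and x: "x \<in> VN"
  shows "cinner (ell2_basis a) (T x (ell2_basis b)) = t (a - b) * cinner (ell2_basis a) (x (ell2_basis b))"
proof -
  let ?m = "\<lambda>y. cinner (ell2_basis a) (blinfun_apply y (ell2_basis b))"
  have TV: "linear_map VN VN T" "continuous_map (subtopology ultraweak VN) (subtopology ultraweak VN) T"
    and Tg: "\<And>g. T (left_regular g) = t g *\<^sub>C left_regular g"
    using T by (auto simp: fourier_multiplier_def normal_map_def)
  have span: "?m (T y) = t (a - b) * ?m y" if "y \<in> group_span" for y
    using that
  proof (induction rule: group_span_induct)
    case (gen c g)
    have "T (c *\<^sub>C left_regular g) = c *\<^sub>C t g *\<^sub>C left_regular g"
      using TV(1) left_regular_VN[of g] unfolding Tg[of g, symmetric] by (simp add: linear_map_def)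
    moreover have "a = g + b \<longleftrightarrow> g = a - b" by (metis add_diff_cancel diff_add_cancel)
    ultimately show ?case
      by (auto simp: scaleC_blinfun.rep_eq cinner_scaleC_right left_regular_basis cinner_basis_basis)
  next
    case zero
    have z: "(0 :: 'g ell2 \<Rightarrow>\<^sub>L 'g ell2) = 0 *\<^sub>C left_regular 0" by (rule blinfun_eqI) (simp add: scaleC_blinfun.rep_eq)
    have "T (0 *\<^sub>C left_regular 0) = 0 *\<^sub>C T (left_regular 0)"
      using TV(1) left_regular_VN[of "0 :: 'g"] by (simp add: linear_map_def)
    then show ?case unfolding z by (simp add: scaleC_blinfun.rep_eq)
  next
    case (add S S')
    then have "T (S + S') = T S + T S'" using TV(1) add(1,2)[THEN group_span_VN] by (simp add: linear_map_def)
    then show ?case using add by (simp add: blinfun.add_left cinner_add_right distrib_left)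
  next
    case (scale r S)
    then have "T (r *\<^sub>R S) = complex_of_real r *\<^sub>C T S"
      using TV(1) scale(1)[THEN group_span_VN] unfolding scaleC_blinfun_scaleR by (simp add: linear_map_def)
    then show ?case using scale by (simp add: scaleC_blinfun_scaleR scaleC_blinfun.rep_eq cinner_scaleC_right)
  qed
  have "cmod (?m (T x) - t (a - b) * ?m x) \<le> 0 + e" if e: "0 < e" for e
  proof -
    \<comment> \<open>With this tolerance the two errors \<open>d\<close> and
      \<open>cmod (t (a - b)) * d\<close> add up to \<open>e\<close>.\<close>
    define d where "d = e / (cmod (t (a - b)) + 1)"
    have d: "0 < d" unfolding d_def using e by (intro divide_pos_pos) (auto simp: add_nonneg_pos)
    have de: "cmod (t (a - b)) * d + d = e"
      unfolding d_def using norm_ge_zero[of "t (a - b)"]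
      by (metis add_nonneg_eq_0_iff distrib_right mult.left_neutral nonzero_mult_div_cancel_left times_divide_eq_right zero_le_one zero_neq_one)
    let ?W = "{S. ?m S \<in> ball (?m (T x)) d}" and ?W' = "{S. ?m S \<in> ball (?m x) d}"
    have "openin (subtopology ultraweak VN) (?W \<inter> VN)"
      unfolding openin_subtopology using ultraweak_vector_open[OF open_ball] by (intro exI[of _ ?W] conjI refl)
    then have "openin (subtopology ultraweak VN) {y \<in> topspace (subtopology ultraweak VN). T y \<in> ?W \<inter> VN}"
      by (rule openin_continuous_map_preimage[OF TV(2)])
    then have "openin (subtopology ultraweak VN) {y \<in> VN. T y \<in> ?W \<inter> VN}"
      by (simp add: topspace_subtopology topspace_ultraweak)
    then obtain Z where Z: "openin ultraweak Z" "{y \<in> VN. T y \<in> ?W \<inter> VN} = Z \<inter> VN"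
      unfolding openin_subtopology by blast
    have "T x \<in> VN" using TV(1) x by (auto simp: linear_map_def)
    then have "x \<in> {y \<in> VN. T y \<in> ?W \<inter> VN}" using x d by simp
    then have "x \<in> Z" unfolding Z(2) by simp
    then have xZ: "x \<in> Z \<inter> ?W'" using d by simp
    have "openin ultraweak (Z \<inter> ?W')" by (intro openin_Int Z ultraweak_vector_open open_ball)
    from ultraweak_neighbourhood[OF this xZ] obtain H :: "('g \<times> nat) ell2" and \<delta>
      where "0 < \<delta> \<and> (\<forall>y. norm (amp Pair (y - x) H) < \<delta> \<longrightarrow> y \<in> Z \<inter> ?W')" by (elim exE) (rule that)
    then have \<delta>: "0 < \<delta>" "\<And>y. norm (amp Pair (y - x) H) < \<delta> \<Longrightarrow> y \<in> Z \<inter> ?W'" by simp_all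
    obtain y where y: "y \<in> group_span" "norm (amp Pair (y - x) H) < \<delta>"
      using group_span_dense[OF x \<delta>(1)] by blast
    have yZ: "y \<in> Z \<inter> ?W'" by (rule \<delta>(2)[OF y(2)])
    then have "y \<in> {y \<in> VN. T y \<in> ?W \<inter> VN}" unfolding Z(2) using group_span_VN[OF y(1)] by blast
    then have 1: "cmod (?m (T x) - ?m (T y)) < d" by (simp add: dist_norm)
    have 2: "cmod (?m x - ?m y) < d" using yZ by (simp add: dist_norm)
    have "?m (T x) - t (a - b) * ?m x = (?m (T x) - ?m (T y)) - t (a - b) * (?m x - ?m y)"
      by (simp add: span[OF y(1)] algebra_simps)
    also have "cmod \<dots> \<le> cmod (?m (T x) - ?m (T y)) + cmod (t (a - b)) * cmod (?m x - ?m y)"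
      using norm_triangle_ineq4 by (metis norm_mult)
    also have "\<dots> \<le> d + cmod (t (a - b)) * d"
      using 1 2 by (intro add_mono mult_left_mono) auto
    finally show ?thesis using de by simp
  qed
  then have "cmod (?m (T x) - t (a - b) * ?m x) \<le> 0" by (rule field_le_epsilon)
  then show ?thesis by simp
qed

section \<open>The Clifford algebra on Fock space\<close>

text \<open>An arbitrary well-ordering of the index type. It fixes the signs of the fermionic
  generators and also drives the recursion that realizes kernels as Gram matrices.\<close>

definition before :: "'b \<Rightarrow> 'b \<Rightarrow> bool"
  where "before a b \<longleftrightarrow> a \<noteq> b \<and> (a, b) \<in> (SOME r. well_order_on UNIV r)"

lemma before_well_order: "well_order_on UNIV (SOME r :: 'b rel. well_order_on UNIV r)"
  using well_order_on[of UNIV] by (rule someI_ex)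

lemma before_total: "a \<noteq> b \<Longrightarrow> before a b \<longleftrightarrow> \<not> before b a"
proof -
  assume "a \<noteq> b"
  define r where "r = (SOME r :: 'a rel. well_order_on UNIV r)"
  have "linear_order r" using before_well_order unfolding r_def well_order_on_def by blast
  then have "total_on UNIV r" "antisym r" by (simp_all add: linear_order_on_def partial_order_on_def)
  then show ?thesis
    using \<open>a \<noteq> b\<close> unfolding before_def r_def[symmetric] total_on_def antisym_def by blast
qed

lemma before_irrefl [simp]: "\<not> before a a"
  by (simp add: before_def)

lemma wf_before: "wf {(a, b). before a b}"
proof -
  have *: "{(a, b). before a b} = (SOME r. well_order_on UNIV r) - Id" by (auto simp: before_def)
  show ?thesis unfolding * using before_well_order unfolding well_order_on_def by blast
qed

section \<open>Fermionic generators as signed permutations of finite subsets\<close>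

lift_definition signed_perm_ell2 :: "('a \<Rightarrow> 'a) \<Rightarrow> ('a \<Rightarrow> complex) \<Rightarrow> 'a ell2 \<Rightarrow> 'a ell2"
  is "\<lambda>f \<sigma> x a. if bij f \<and> (\<forall>a. cmod (\<sigma> a) = 1) then \<sigma> a * x (f a) else 0"
  subgoal for f \<sigma> x
  proof (cases "bij f \<and> (\<forall>a. cmod (\<sigma> a) = 1)")
    case True
    assume "(\<lambda>i. (cmod (x i))\<^sup>2) summable_on UNIV"
    then show ?thesis
      using True summable_on_reindex_bij_betw[of f UNIV UNIV "\<lambda>i. (cmod (x i))\<^sup>2"] by (simp add: norm_mult)
  next
    case False
    show ?thesis unfolding if_not_P[OF False] by simp
  qed
  done

definition signed_perm :: "('a \<Rightarrow> 'a) \<Rightarrow> ('a \<Rightarrow> complex) \<Rightarrow> 'a ell2 \<Rightarrow>\<^sub>L 'a ell2"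
  where "signed_perm f \<sigma> = Blinfun (signed_perm_ell2 f \<sigma>)"

lemma Rep_signed_perm:
  assumes f: "bij f" and \<sigma>: "\<And>a. cmod (\<sigma> a) = 1"
  shows "Rep_ell2 (signed_perm f \<sigma> x) a = \<sigma> a * Rep_ell2 x (f a)"
proof -
  have R: "Rep_ell2 (signed_perm_ell2 f \<sigma> x) a = \<sigma> a * Rep_ell2 x (f a)" for x a
    using assms by (simp add: signed_perm_ell2.rep_eq)
  have "bounded_linear (signed_perm_ell2 f \<sigma>)"
  proof (rule bounded_linear_intro[where K = 1])
    show "signed_perm_ell2 f \<sigma> (x + y) = signed_perm_ell2 f \<sigma> x + signed_perm_ell2 f \<sigma> y" for x y
      by (rule ell2_eqI) (simp add: R plus_ell2.rep_eq distrib_left)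
    show "signed_perm_ell2 f \<sigma> (r *\<^sub>R x) = r *\<^sub>R signed_perm_ell2 f \<sigma> x" for r x
      by (rule ell2_eqI) (simp add: R scaleR_ell2.rep_eq)
    fix x
    have "(norm (signed_perm_ell2 f \<sigma> x))\<^sup>2 = (norm x)\<^sup>2"
      unfolding norm_ell2_square R norm_mult \<sigma> mult_1
      by (rule infsum_reindex_bij_betw[OF f, of "\<lambda>i. (cmod (Rep_ell2 x i))\<^sup>2"])
    then show "norm (signed_perm_ell2 f \<sigma> x) \<le> norm x * 1" by simp
  qed
  then show ?thesis by (simp add: signed_perm_def bounded_linear_Blinfun_apply R)
qed

lemma signed_perm_clinear:
  assumes "bij f" "\<And>a. cmod (\<sigma> a) = 1"
  shows "signed_perm f \<sigma> \<in> clinear_ops"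
  by (rule clinear_opsI, rule ell2_eqI) (simp add: Rep_signed_perm assms scaleC_ell2.rep_eq)

lemma adj_signed_perm:
  assumes f: "\<And>a. f (f a) = a" and \<sigma>: "\<And>a. cmod (\<sigma> a) = 1"
  shows "adj (signed_perm f \<sigma>) = signed_perm f (\<lambda>a. cnj (\<sigma> (f a)))"
proof (rule adj_eqI[OF _ signed_perm_clinear])
  show bf: "bij f" using f by (intro o_bij[of f]) (auto simp: fun_eq_iff)
  show "\<And>a. cmod (\<sigma> a) = 1" by (rule \<sigma>)
  fix x y
  have "((\<lambda>a. cnj (Rep_ell2 x (f a)) * (\<sigma> (f a) * Rep_ell2 y (f (f a)))) has_sum cinner x (signed_perm f \<sigma> y)) UNIV"
    using cinner_ell2_has_sum[of x "signed_perm f \<sigma> y"] Rep_signed_perm[OF bf \<sigma>]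
      has_sum_reindex_bij_betw[OF bf, of "\<lambda>a. cnj (Rep_ell2 x a) * (\<sigma> a * Rep_ell2 y (f a))"]
    by simp
  moreover have "((\<lambda>a. cnj (Rep_ell2 x (f a)) * (\<sigma> (f a) * Rep_ell2 y (f (f a)))) has_sum
      cinner (signed_perm f (\<lambda>a. cnj (\<sigma> (f a))) x) y) UNIV"
    using cinner_ell2_has_sum[of "signed_perm f (\<lambda>a. cnj (\<sigma> (f a))) x" y]
    by (simp add: Rep_signed_perm[OF bf] \<sigma> f mult_ac)
  ultimately show "cinner (signed_perm f (\<lambda>a. cnj (\<sigma> (f a))) x) y = cinner x (signed_perm f \<sigma> y)"
    using has_sum_unique by blast
qed

definition toggle :: "'b \<Rightarrow> 'b fset \<Rightarrow> 'b fset"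
  where "toggle b A = (if b |\<in>| A then A |-| {|b|} else finsert b A)"

lemma fset_toggle: "fset (toggle b A) = (if b \<in> fset A then fset A - {b} else insert b (fset A))"
  by (simp add: toggle_def)

lemma toggle_toggle [simp]: "toggle b (toggle b A) = A"
  by (rule fset_inject[THEN iffD1]) (auto simp: fset_toggle)

lemma toggle_commute: "toggle a (toggle b A) = toggle b (toggle a A)"
  by (rule fset_inject[THEN iffD1]) (auto simp: fset_toggle)

lemma bij_toggle: "bij (toggle b)"
  by (intro o_bij[of "toggle b"]) (auto simp: fun_eq_iff)

text \<open>For signs \<open>u\<close> this is a character of the finite subsets under symmetric
  difference; for the constant -1 it is the parity of the cardinality.\<close>

definition parity :: "('b \<Rightarrow> complex) \<Rightarrow> 'b fset \<Rightarrow> complex"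
  where "parity u A = (\<Prod>a\<in>fset A. u a)"

lemma parity_toggle: "u b * u b = 1 \<Longrightarrow> parity u (toggle b A) = u b * parity u A"
  by (cases "b \<in> fset A") (auto simp: parity_def fset_toggle prod.remove[of "fset A" b] mult.assoc[symmetric])

lemma prod_sign:
  fixes u :: "'b \<Rightarrow> complex"
  assumes "\<And>a. u a = 1 \<or> u a = -1"
  shows "prod u F = 1 \<or> prod u F = -1"
proof (induction F rule: infinite_finite_induct)
  case (insert a F)
  then show ?case using assms[of a] by auto
qed simp_all

lemma parity_sign: "(\<And>a. u a = 1 \<or> u a = -1) \<Longrightarrow> parity u A = 1 \<or> parity u A = -1"
  unfolding parity_def by (rule prod_sign)

text \<open>For the fermionic annihilation operator \<open>a\<close> of \<open>b\<close>, \<open>cliff False b\<close> is \<open>a\<^sup>* + a\<close> and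
  \<open>cliff True b\<close> is \<open>a\<^sup>* - a\<close>.\<close>

definition cliff_sign :: "bool \<Rightarrow> 'b \<Rightarrow> 'b \<Rightarrow> complex"
  where "cliff_sign w b e = (if before e b \<or> w \<and> e = b then - 1 else 1)"

definition cliff :: "bool \<Rightarrow> 'b \<Rightarrow> 'b fset ell2 \<Rightarrow>\<^sub>L 'b fset ell2"
  where "cliff w b = signed_perm (toggle b) (\<lambda>A. (if w then - 1 else 1) * parity (cliff_sign w b) A)"

definition grading :: "'b fset ell2 \<Rightarrow>\<^sub>L 'b fset ell2"
  where "grading = signed_perm id (parity (\<lambda>_. - 1))"

lemma cliff_sign_cases: "cliff_sign w b e = 1 \<or> cliff_sign w b e = - 1"
  by (simp add: cliff_sign_def)

lemma cliff_sign_square: "cliff_sign w b e * cliff_sign w b e = 1"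
  by (simp add: cliff_sign_def)

lemma parity_cliff_toggle: "parity (cliff_sign w b) (toggle e A) = cliff_sign w b e * parity (cliff_sign w b) A"
  by (rule parity_toggle) (rule cliff_sign_square)

lemma parity_cliff_sign: "parity (cliff_sign w b) A = 1 \<or> parity (cliff_sign w b) A = - 1"
  by (rule parity_sign) (rule cliff_sign_cases)

lemma cmod_cliff: "cmod ((if w then - 1 else 1) * parity (cliff_sign w b) A) = 1"
  using parity_cliff_sign[of w b A] by (auto simp: norm_mult)

lemma Rep_cliff: "Rep_ell2 (cliff w b x) A = (if w then - 1 else 1) * parity (cliff_sign w b) A * Rep_ell2 x (toggle b A)"
  unfolding cliff_def by (rule Rep_signed_perm[OF bij_toggle cmod_cliff])

lemma cliff_clinear: "cliff w b \<in> clinear_ops"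
  unfolding cliff_def by (rule signed_perm_clinear[OF bij_toggle cmod_cliff])

lemma adj_cliff: "adj (cliff w b) = (if w then - 1 else 1) *\<^sub>R cliff w b"
proof -
  have "cnj ((if w then - 1 else 1) * parity (cliff_sign w b) (toggle b A)) = parity (cliff_sign w b) A" for A
  proof -
    have "cnj (parity (cliff_sign w b) A) = parity (cliff_sign w b) A"
      using parity_cliff_sign[of w b A] by auto
    then show ?thesis by (simp add: parity_cliff_toggle) (simp add: cliff_sign_def)
  qed
  then have "adj (cliff w b) = signed_perm (toggle b) (parity (cliff_sign w b))"
    unfolding cliff_def by (subst adj_signed_perm[OF toggle_toggle cmod_cliff]) simp
  moreover have "signed_perm (toggle b) (parity (cliff_sign w b)) = (if w then - 1 else 1) *\<^sub>R cliff w b"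
  proof (rule blinfun_eqI, rule ell2_eqI)
    fix x :: "'a fset ell2" and A
    have "cmod (parity (cliff_sign w b) A) = 1" for A using parity_cliff_sign[of w b A] by auto
    then show "Rep_ell2 (signed_perm (toggle b) (parity (cliff_sign w b)) x) A = Rep_ell2 (((if w then - 1 else 1) *\<^sub>R cliff w b) x) A"
      by (simp add: Rep_signed_perm[OF bij_toggle] Rep_cliff blinfun.scaleR_left scaleR_ell2.rep_eq)
  qed
  ultimately show ?thesis by simp
qed

text \<open>Exchanging the two toggles costs exactly one sign: for distinct indices one precedes the
  other, and for equal indices exactly one of the two flags is set.\<close>

lemma cliff_anticommute:
  assumes "w \<noteq> w' \<or> b \<noteq> e"
  shows "cliff w b (cliff w' e x) = - cliff w' e (cliff w b x)"
proof (rule ell2_eqI)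
  fix A
  have "cliff_sign w' e b * cliff_sign w b e = - 1"
    using assms before_total[of b e] by (cases "b = e") (auto simp: cliff_sign_def)
  then have "cliff_sign w' e b = - cliff_sign w b e"
    using cliff_sign_cases[of w' e b] cliff_sign_cases[of w b e] by auto
  then show "Rep_ell2 (cliff w b (cliff w' e x)) A = Rep_ell2 (- cliff w' e (cliff w b x)) A"
    by (simp add: Rep_cliff uminus_ell2.rep_eq parity_cliff_toggle toggle_commute[of b e])
qed

lemma cliff_square: "cliff w b (cliff w b x) = (if w then - 1 else 1) *\<^sub>R x"
proof (rule ell2_eqI)
  fix A
  have "parity (cliff_sign w b) A * parity (cliff_sign w b) A = 1" using parity_cliff_sign[of w b A] by auto
  then show "Rep_ell2 (cliff w b (cliff w b x)) A = Rep_ell2 ((if w then - 1 else 1) *\<^sub>R x) A"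
    by (simp add: Rep_cliff scaleR_ell2.rep_eq parity_cliff_toggle)
      (cases w; simp add: cliff_sign_def[where b = b and e = b])
qed

lemma cmod_parity_minus: "cmod (parity (\<lambda>_. - 1) A) = 1"
  using parity_sign[of "\<lambda>_. - 1" A] by auto

lemma Rep_grading: "Rep_ell2 (grading x) A = parity (\<lambda>_. - 1) A * Rep_ell2 x A"
  unfolding grading_def by (subst Rep_signed_perm[OF _ cmod_parity_minus]) simp_all

lemma grading_clinear: "grading \<in> clinear_ops"
  unfolding grading_def by (rule signed_perm_clinear[OF _ cmod_parity_minus]) simp

lemma adj_grading: "adj grading = grading"
proof -
  have "cnj (parity (\<lambda>_. - 1) A) = parity (\<lambda>_. - 1) A" for A :: "'a fset"
    using parity_sign[of "\<lambda>_. - 1" A] by auto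
  then show ?thesis unfolding grading_def by (subst adj_signed_perm[OF _ cmod_parity_minus]) simp_all
qed

lemma grading_square: "grading (grading x) = x"
proof (rule ell2_eqI)
  fix A show "Rep_ell2 (grading (grading x)) A = Rep_ell2 x A"
    using parity_sign[of "\<lambda>_. - 1" A] by (auto simp: Rep_grading)
qed

lemma grading_cliff: "grading (cliff w b x) = - cliff w b (grading x)"
  by (rule ell2_eqI) (simp add: Rep_grading Rep_cliff uminus_ell2.rep_eq parity_toggle[of "\<lambda>_. - 1"])

lemma grading_vacuum: "grading (ell2_basis {||}) = ell2_basis {||}"
  by (rule ell2_eqI) (simp add: Rep_grading ell2_basis.rep_eq parity_def)

lemma cliff_basis:
  "cliff w b (ell2_basis A) = ((if w then - 1 else 1) * parity (cliff_sign w b) (toggle b A)) *\<^sub>C ell2_basis (toggle b A)"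
proof (rule ell2_eqI)
  fix C
  have "toggle b C = A \<longleftrightarrow> C = toggle b A" by auto
  then show "Rep_ell2 (cliff w b (ell2_basis A)) C =
      Rep_ell2 (((if w then - 1 else 1) * parity (cliff_sign w b) (toggle b A)) *\<^sub>C ell2_basis (toggle b A)) C"
    by (simp add: Rep_cliff ell2_basis.rep_eq scaleC_ell2.rep_eq)
qed

text \<open>Both kinds of generators agree here because annihilation kills the vacuum; this is why
  right multiplications can mirror left ones.\<close>

lemma cliff_vacuum: "cliff w b (ell2_basis {||}) = ell2_basis {|b|}"
proof -
  have "parity (cliff_sign w b) {|b|} = (if w then - 1 else 1)" by (simp add: parity_def cliff_sign_def)
  then show ?thesis by (simp add: cliff_basis toggle_def)
qed

section \<open>Clifford operators for arbitrary vectors\<close>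

lemma bounded_linear_eq_on_closure:
  assumes f: "bounded_linear f" and g: "bounded_linear g" and V: "\<And>v. v \<in> V \<Longrightarrow> f v = g v"
    and x: "x \<in> closure (span V)"
  shows "f x = g x"
proof -
  have fg: "bounded_linear (\<lambda>x. f x - g x)" using f g by (rule bounded_linear_sub)
  have "subspace {x. f x - g x = 0}"
    by (rule linear_subspace_kernel[OF bounded_linear.linear[OF fg]])
  then have "span V \<subseteq> {x. f x - g x = 0}" by (intro span_minimal) (use V in auto)
  moreover have "closed {x. f x - g x = 0}"
    by (intro closed_Collect_eq continuous_on_const linear_continuous_on fg)
  ultimately have "closure (span V) \<subseteq> {x. f x - g x = 0}" by (rule closure_minimal)
  then show ?thesis using x by auto
qed

text \<open>The relation spanned by the pairs \<open>(\<beta> b, c b)\<close> is bounded because the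
  Clifford relations make the square of \<open>y\<close> a scalar of absolute value
  \<open>(norm x)\<^sup>2\<close>. The sign \<open>\<epsilon>\<close> treats the self-adjoint and
  the skew-adjoint generators at once.\<close>

lemma clifford_extension:
  fixes \<beta> :: "'b \<Rightarrow> 'k::chilbert_space" and c :: "'b \<Rightarrow> 'f::chilbert_space \<Rightarrow>\<^sub>L 'f" and \<epsilon> :: real
  assumes \<beta>: "\<And>a b. inner (\<beta> a) (\<beta> b) = (if a = b then 1 else 0)" "dense_span (range \<beta>)"
    and \<epsilon>: "\<epsilon> = 1 \<or> \<epsilon> = - 1"
    and c: "\<And>b. c b \<in> clinear_ops" "\<And>b. adj (c b) = \<epsilon> *\<^sub>R c b"
      "\<And>a b x. c a (c b x) + c b (c a x) = (if a = b then 2 * \<epsilon> else 0) *\<^sub>R x"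
  shows "\<exists>s :: 'k \<Rightarrow>\<^sub>L 'f \<Rightarrow>\<^sub>L 'f. (\<forall>b. s (\<beta> b) = c b) \<and> (\<forall>\<xi>. s \<xi> \<in> clinear_ops) \<and>
    (\<forall>\<xi>. adj (s \<xi>) = \<epsilon> *\<^sub>R s \<xi>) \<and> (\<forall>\<xi> \<eta> x. s \<xi> (s \<eta> x) + s \<eta> (s \<xi> x) = (2 * \<epsilon> * inner \<xi> \<eta>) *\<^sub>R x)"
proof -
  let ?B = "range (\<lambda>b. (\<beta> b, c b))"
  let ?S = "span ?B"
  note bl_left = blinfun.bounded_linear_left and bl_right = blinfun.bounded_linear_right
  have blR: "bounded_linear (\<lambda>q. (r * inner a (h q)) *\<^sub>R x)" if "bounded_linear h" for r :: real and a and h :: "'c::real_normed_vector \<Rightarrow> 'k" and x :: 'f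
    by (rule bounded_linear_compose[OF bounded_linear_scaleR_left],
        rule bounded_linear_compose[OF bounded_linear_mult_right],
        rule bounded_linear_compose[OF bounded_linear_inner_right that])
  have blL: "bounded_linear (\<lambda>q. T (h q x) + h q (T x))"
    if "bounded_linear h" for T :: "'f \<Rightarrow>\<^sub>L 'f" and h :: "'c::real_normed_vector \<Rightarrow> 'f \<Rightarrow>\<^sub>L 'f" and x :: 'f
    by (intro bounded_linear_add bounded_linear_compose[OF bl_right[of T] bounded_linear_compose[OF bl_left that]]
        bounded_linear_compose[OF bl_left that])
  have span_closure: "p \<in> closure ?S" if "p \<in> ?S" for p using that closure_subset by blast
  have gen: "cinner (c b x) y = complex_of_real \<epsilon> * cinner x (c b y)" for b x y
  proof -
    have "cinner x (c b y) = cinner (adj (c b) x) y" using c(1) by (simp add: adj_left)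
    then show ?thesis using \<epsilon> by (auto simp: c(2) blinfun.scaleR_left cinner_scaleR_left)
  qed
  have bl_ad: "bounded_linear (\<lambda>q. cinner (h q x) y)" "bounded_linear (\<lambda>q. complex_of_real \<epsilon> * cinner x (h q y))"
    if "bounded_linear h" for h :: "'c::real_normed_vector \<Rightarrow> 'f \<Rightarrow>\<^sub>L 'f" and x y :: 'f
    by (rule bounded_linear_compose[OF bounded_linear_cinner_left bounded_linear_compose[OF bl_left that]],
        rule bounded_linear_compose[OF bounded_linear_mult_right bounded_linear_compose[OF bounded_linear_cinner_right bounded_linear_compose[OF bl_left that]]])
  have ad: "cinner (snd p x) y = complex_of_real \<epsilon> * cinner x (snd p y)" if "p \<in> ?S" for p x y
    by (rule bounded_linear_eq_on_closure[OF bl_ad[OF bounded_linear_snd] _ span_closure[OF that]]) (auto simp: gen)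
  have car: "snd p (snd q x) + snd q (snd p x) = (2 * \<epsilon> * inner (fst p) (fst q)) *\<^sub>R x" if "p \<in> ?S" "q \<in> ?S" for p q x
  proof -
    have 1: "c b (snd p x) + snd p (c b x) = (2 * \<epsilon> * inner (\<beta> b) (fst p)) *\<^sub>R x" if "p \<in> ?S" for p b x
      by (rule bounded_linear_eq_on_closure[OF blL[OF bounded_linear_snd] blR[OF bounded_linear_fst] _ span_closure[OF that]])
        (auto simp: c(3) \<beta>(1))
    show ?thesis
      by (rule bounded_linear_eq_on_closure[OF blL[OF bounded_linear_snd] blR[OF bounded_linear_fst] _ span_closure[OF that(2)]])
        (use 1[OF that(1)] in \<open>auto simp: add.commute inner_commute\<close>)
  qed
  have bound: "norm y \<le> 1 * norm x" if xy: "(x, y) \<in> ?S" for x y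
  proof -
    have "norm (y \<zeta>) \<le> norm x * norm \<zeta>" for \<zeta>
    proof -
      have "2 *\<^sub>R y (y \<zeta>) = 2 *\<^sub>R (\<epsilon> * (norm x)\<^sup>2) *\<^sub>R \<zeta>"
        using car[OF xy xy, of \<zeta>] by (simp add: scaleR_2[symmetric] power2_norm_eq_inner mult.assoc)
      then have yy: "y (y \<zeta>) = (\<epsilon> * (norm x)\<^sup>2) *\<^sub>R \<zeta>" by (simp only: scaleR_cancel_left) simp
      have "cinner (y \<zeta>) (y \<zeta>) = complex_of_real \<epsilon> * cinner \<zeta> (y (y \<zeta>))"
        using ad[OF xy, of \<zeta> "y \<zeta>"] by simp
      also have "\<dots> = complex_of_real ((norm x * norm \<zeta>)\<^sup>2)"
        using \<epsilon> by (auto simp: yy cinner_scaleR_right cinner_minus_right cinner_self power_mult_distrib)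
      finally have "(norm (y \<zeta>))\<^sup>2 = (norm x * norm \<zeta>)\<^sup>2" unfolding cinner_self by (simp only: of_real_eq_iff)
      then show ?thesis by (simp add: power2_eq_iff_nonneg)
    qed
    then have "norm y \<le> norm x" by (intro norm_blinfun_bound) auto
    then show ?thesis by simp
  qed
  have fstS: "fst ` ?S = span (range \<beta>)"
    using span_linear_image[OF bounded_linear.linear[OF bounded_linear_fst], of ?B]
    by (simp add: image_image)
  obtain s :: "'k \<Rightarrow>\<^sub>L 'f \<Rightarrow>\<^sub>L 'f" where s: "\<forall>(x, y)\<in>?S. s x = y"
    using bounded_extension[OF subspace_span bound fstS] by auto
  have sc: "s (\<beta> b) = c b" for b
    using s span_base[of "(\<beta> b, c b)" ?B] by auto
  have dense: "\<xi> \<in> closure (span (range \<beta>))" for \<xi> using \<beta>(2) by (simp add: dense_span_def)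
  note bl_s = blinfun.bounded_linear_right[of s]
  have s_cl: "s \<xi> \<in> clinear_ops" for \<xi>
  proof (rule clinear_opsI)
    fix z x
    show "s \<xi> (z *\<^sub>C x) = z *\<^sub>C s \<xi> x"
      by (rule bounded_linear_eq_on_closure[OF bounded_linear_compose[OF bl_left bl_s]
            bounded_linear_compose[OF bounded_linear_scaleC bounded_linear_compose[OF bl_left bl_s]] _ dense])
        (auto simp: sc clinear_opsD[OF c(1)])
  qed
  have s_ad: "cinner (s \<xi> x) y = complex_of_real \<epsilon> * cinner x (s \<xi> y)" for \<xi> x y
    by (rule bounded_linear_eq_on_closure[OF bl_ad[OF bl_s] _ dense]) (auto simp: gen sc)
  have s_car1: "c b (s \<xi> x) + s \<xi> (c b x) = (2 * \<epsilon> * inner (\<beta> b) \<xi>) *\<^sub>R x" for \<xi> b x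
    by (rule bounded_linear_eq_on_closure[OF blL[OF bl_s] blR[OF bounded_linear_ident] _ dense])
      (auto simp: c(3) \<beta>(1) sc)
  have s_car: "s \<xi> (s \<eta> x) + s \<eta> (s \<xi> x) = (2 * \<epsilon> * inner \<xi> \<eta>) *\<^sub>R x" for \<xi> \<eta> x
    by (rule bounded_linear_eq_on_closure[OF blL[OF bl_s] blR[OF bounded_linear_ident] _ dense])
      (use s_car1[of _ \<xi>] in \<open>auto simp: sc add.commute inner_commute\<close>)
  have "adj (s \<xi>) = \<epsilon> *\<^sub>R s \<xi>" for \<xi>
  proof (rule adj_eqI[OF _ s_cl])
    show "cinner ((\<epsilon> *\<^sub>R s \<xi>) x) y = cinner x (s \<xi> y)" for x y
      using \<epsilon> by (auto simp: blinfun.scaleR_left cinner_scaleR_left s_ad blinfun.minus_left cinner_minus_left)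
  qed
  then show ?thesis using sc s_cl s_car by blast
qed

section \<open>Vacuum expectations and second quantization\<close>

definition inner_preserving :: "('k::real_inner \<Rightarrow> 'k) \<Rightarrow> bool"
  where "inner_preserving O1 \<longleftrightarrow> (\<forall>\<xi> \<eta>. inner (O1 \<xi>) (O1 \<eta>) = inner \<xi> \<eta>)"

text \<open>The terms of Wick's rule for moving one annihilation operator through a word: a letter
  is removed, weighted by its inner product and an alternating sign.\<close>

primrec contractions :: "'k::real_inner \<Rightarrow> 'k list \<Rightarrow> (real \<times> 'k list) list"
  where "contractions \<xi> [] = []"
  | "contractions \<xi> (\<eta> # w) = (inner \<xi> \<eta>, w) # map (\<lambda>(r, v). (- r, \<eta> # v)) (contractions \<xi> w)"

lemma contractions_length: "(r, v) \<in> set (contractions \<xi> w) \<Longrightarrow> length w = Suc (length v)"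
  by (induction w arbitrary: r v) auto

lemma contractions_map:
  "inner_preserving O1 \<Longrightarrow> contractions (O1 \<xi>) (map O1 w) = map (\<lambda>(r, v). (r, map O1 v)) (contractions \<xi> w)"
  by (induction w) (auto simp: inner_preserving_def)

text \<open>\<open>s\<close> and \<open>d \<gamma>\<close> are the left and the right multiplications of the Clifford algebra.\<close>

locale fock =
  fixes s d :: "'k::chilbert_space \<Rightarrow>\<^sub>L ('f::chilbert_space \<Rightarrow>\<^sub>L 'f)" and \<gamma> :: "'f \<Rightarrow>\<^sub>L 'f" and \<Omega> :: 'f
  assumes s_clinear: "s \<xi> \<in> clinear_ops" and d_clinear: "d \<xi> \<in> clinear_ops" and \<gamma>_clinear: "\<gamma> \<in> clinear_ops"
    and s_adj: "adj (s \<xi>) = s \<xi>" and d_adj: "adj (d \<xi>) = - d \<xi>" and \<gamma>_adj: "adj \<gamma> = \<gamma>"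
    and car: "s \<xi> (s \<eta> x) + s \<eta> (s \<xi> x) = (2 * inner \<xi> \<eta>) *\<^sub>R x"
    and s_d: "s \<xi> (d \<eta> x) = - d \<eta> (s \<xi> x)"
    and \<gamma>_\<gamma>: "\<gamma> (\<gamma> x) = x" and \<gamma>_s: "\<gamma> (s \<xi> x) = - s \<xi> (\<gamma> x)" and \<gamma>_d: "\<gamma> (d \<xi> x) = - d \<xi> (\<gamma> x)"
    and s_\<Omega>: "s \<xi> \<Omega> = d \<xi> \<Omega>" and \<gamma>_\<Omega>: "\<gamma> \<Omega> = \<Omega>" and norm_\<Omega>: "norm \<Omega> = 1"
    and dense_words: "dense_span {c *\<^sub>C foldr (\<lambda>\<xi>. blinfun_apply (s \<xi>)) w \<Omega> | c w. True}"
begin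

abbreviation word :: "'k list \<Rightarrow> 'f"
  where "word w \<equiv> foldr (\<lambda>\<xi>. blinfun_apply (s \<xi>)) w \<Omega>"

text \<open>As \<open>s\<close> is creation plus annihilation and \<open>d\<close> is creation minus
  annihilation, half their difference is the annihilation operator.\<close>

definition annihilate :: "'k \<Rightarrow> 'f \<Rightarrow> 'f"
  where "annihilate \<xi> x = (1/2) *\<^sub>R (s \<xi> x - d \<xi> x)"

lemma cinner_s: "cinner (s \<xi> x) y = cinner x (s \<xi> y)"
  using adj_left[OF s_clinear, of \<xi> x y] by (simp add: s_adj)

lemma cinner_d: "cinner (d \<xi> x) y = - cinner x (d \<xi> y)"
  using adj_left[OF d_clinear, of \<xi> x y] by (simp add: d_adj blinfun.minus_left cinner_minus_left minus_equation_iff eq_commute)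

lemma s_square: "s \<xi> (s \<xi> x) = (norm \<xi>)\<^sup>2 *\<^sub>R x"
proof -
  have "2 *\<^sub>R s \<xi> (s \<xi> x) = 2 *\<^sub>R (norm \<xi>)\<^sup>2 *\<^sub>R x"
    using car[of \<xi> \<xi> x] by (simp add: scaleR_2[symmetric] power2_norm_eq_inner)
  then show ?thesis by (simp only: scaleR_cancel_left) simp
qed

lemma norm_s: "norm (s \<xi> x) = norm \<xi> * norm x"
proof -
  have "complex_of_real ((norm (s \<xi> x))\<^sup>2) = complex_of_real ((norm \<xi> * norm x)\<^sup>2)"
    using cinner_s[of \<xi> x "s \<xi> x"]
    by (simp add: cinner_self s_square cinner_scaleR_right power_mult_distrib)
  then have "(norm (s \<xi> x))\<^sup>2 = (norm \<xi> * norm x)\<^sup>2" by (simp only: of_real_eq_iff)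
  then show ?thesis by (simp add: power2_eq_iff_nonneg)
qed

lemma annihilate_s: "annihilate \<xi> (s \<eta> x) = inner \<xi> \<eta> *\<^sub>R x - s \<eta> (annihilate \<xi> x)"
proof -
  have "s \<xi> (s \<eta> x) = (2 * inner \<xi> \<eta>) *\<^sub>R x - s \<eta> (s \<xi> x)"
    using car[of \<xi> \<eta> x] by (simp add: algebra_simps)
  then show ?thesis
    by (simp add: annihilate_def s_d blinfun.scaleR_right blinfun.diff_right scaleR_diff_right scaleR_add_right)
qed

lemma annihilate_word: "annihilate \<xi> (word w) = (\<Sum>(r, v)\<leftarrow>contractions \<xi> w. r *\<^sub>R word v)"
proof (induction w)
  case Nil
  show ?case by (simp add: annihilate_def s_\<Omega>)
next
  case (Cons \<eta> w)
  have "s \<eta> (\<Sum>(r, v)\<leftarrow>l. r *\<^sub>R word v) = - (\<Sum>(r, v)\<leftarrow>map (\<lambda>(r, v). (- r, \<eta> # v)) l. r *\<^sub>R word v)" for l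
    by (induction l) (auto simp: blinfun.add_right blinfun.scaleR_right)
  then show ?case by (simp add: annihilate_s Cons.IH)
qed

lemma cinner_vacuum_s: "cinner \<Omega> (s \<xi> x) = cinner \<Omega> (annihilate \<xi> x)"
proof -
  have "cinner \<Omega> (d \<xi> x) = - cinner \<Omega> (s \<xi> x)"
    using cinner_d[of \<xi> \<Omega> x] cinner_s[of \<xi> \<Omega> x] unfolding s_\<Omega> by (metis minus_minus)
  then show ?thesis by (simp add: annihilate_def cinner_scaleR_right cinner_diff_right)
qed

text \<open>Vacuum expectations are computed by repeated contraction, which uses inner products only
  and shortens the word by two letters each time.\<close>

lemma vacuum_word_map:
  assumes O1: "inner_preserving O1"
  shows "cinner \<Omega> (word (map O1 w)) = cinner \<Omega> (word w)"
proof (induction w rule: length_induct)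
  case (1 w)
  show ?case
  proof (cases w)
    case (Cons \<xi> u)
    have sum: "cinner \<Omega> (\<Sum>(r, v)\<leftarrow>l. r *\<^sub>R word v) = (\<Sum>(r, v)\<leftarrow>l. complex_of_real r * cinner \<Omega> (word v))" for l
      by (induction l) (auto simp: cinner_add_right cinner_scaleR_right)
    have "cinner \<Omega> (word (map O1 w)) = cinner \<Omega> (annihilate (O1 \<xi>) (word (map O1 u)))"
      by (simp add: Cons cinner_vacuum_s)
    also have "\<dots> = (\<Sum>(r, v)\<leftarrow>contractions \<xi> u. complex_of_real r * cinner \<Omega> (word (map O1 v)))"
      unfolding annihilate_word sum contractions_map[OF O1] by (simp add: o_def case_prod_unfold)
    also have "\<dots> = (\<Sum>(r, v)\<leftarrow>contractions \<xi> u. complex_of_real r * cinner \<Omega> (word v))"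
    proof (rule arg_cong[of _ _ sum_list], rule map_cong[OF refl])
      fix p assume p: "p \<in> set (contractions \<xi> u)"
      obtain r v where rv: "p = (r, v)" by fastforce
      then have "length v < length w" using contractions_length p by (fastforce simp: Cons)
      then show "(case p of (r, v) \<Rightarrow> complex_of_real r * cinner \<Omega> (word (map O1 v))) =
          (case p of (r, v) \<Rightarrow> complex_of_real r * cinner \<Omega> (word v))"
        using 1 by (simp add: rv)
    qed
    also have "\<dots> = cinner \<Omega> (word w)"
      by (simp add: Cons cinner_vacuum_s annihilate_word sum)
    finally show ?thesis .
  qed simp
qed

lemma cinner_words: "cinner (word w) (word v) = cinner \<Omega> (word (rev w @ v))"
  by (induction w arbitrary: v) (simp_all add: cinner_s, metis comp_apply foldr.simps(2) foldr_append)

lemma cinner_words_map: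
  "inner_preserving O1 \<Longrightarrow> cinner (word (map O1 w)) (word (map O1 v)) = cinner (word w) (word v)"
  using vacuum_word_map[of O1 "rev w @ v"] by (simp add: cinner_words rev_map)

lemma word_eqI:
  fixes S T :: "'f \<Rightarrow>\<^sub>L 'f"
  assumes "S \<in> clinear_ops" "T \<in> clinear_ops" "\<And>w. S (word w) = T (word w)"
  shows "S = T"
  by (rule dense_span_eqI[OF dense_words]) (use assms in \<open>auto simp: clinear_opsD\<close>)

text \<open>Second quantization: invariance of vacuum expectations makes the Gram matrix of the
  words invariant. Complex scalars are attached to the words because spans are real.\<close>

lemma quantization_exists:
  assumes O1: "inner_preserving O1"
  shows "\<exists>T\<in>clinear_ops. \<forall>w. blinfun_apply T (word w) = word (map O1 w)"
proof -
  let ?v = "\<lambda>(c, w). c *\<^sub>C word w" and ?v' = "\<lambda>(c, w). c *\<^sub>C word (map O1 w)"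
  have dense: "closure (span (range ?v)) = UNIV"
    using dense_words unfolding dense_span_def by (simp add: full_SetCompr_eq image_def) 
  have "inner (?v p) (?v q) = inner (?v' p) (?v' q)" for p q
    by (cases p; cases q)
      (simp add: inner_eq_Re_cinner cinner_scaleC_left cinner_scaleC_right cinner_words_map[OF O1])
  from isometric_extension[of ?v ?v', OF this]
  obtain T :: "'f \<Rightarrow>\<^sub>L 'f" where T: "\<forall>p. T (?v p) = ?v' p" by blast
  have Tv: "T (c *\<^sub>C word w) = c *\<^sub>C word (map O1 w)" for c w using T[rule_format, of "(c, w)"] by simp
  have "T \<in> clinear_ops"
  proof (rule clinear_opsI)
    fix c x
    show "T (c *\<^sub>C x) = c *\<^sub>C T x"
    proof (rule bounded_linear_eq_on_closure[where V = "range ?v" and f = "\<lambda>x. T (c *\<^sub>C x)" and g = "\<lambda>x. c *\<^sub>C T x"])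
      show "bounded_linear (\<lambda>x. T (c *\<^sub>C x))"
        by (rule bounded_linear_compose[OF blinfun.bounded_linear_right bounded_linear_scaleC])
      show "bounded_linear (\<lambda>x. c *\<^sub>C T x)"
        by (rule bounded_linear_compose[OF bounded_linear_scaleC blinfun.bounded_linear_right])
    qed (auto simp: Tv scaleC_scaleC dense)
  qed
  moreover have "T (word w) = word (map O1 w)" for w using Tv[of 1 w] by simp
  ultimately show ?thesis by blast
qed

definition quantize :: "('k \<Rightarrow> 'k) \<Rightarrow> 'f \<Rightarrow>\<^sub>L 'f"
  where "quantize O1 = (SOME T. T \<in> clinear_ops \<and> (\<forall>w. blinfun_apply T (word w) = word (map O1 w)))"

lemma quantize:
  assumes "inner_preserving O1"
  shows "quantize O1 \<in> clinear_ops" "quantize O1 (word w) = word (map O1 w)"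
proof -
  have "\<exists>T. T \<in> clinear_ops \<and> (\<forall>w. blinfun_apply T (word w) = word (map O1 w))"
    using quantization_exists[OF assms] by blast
  from someI_ex[OF this] show "quantize O1 \<in> clinear_ops" "quantize O1 (word w) = word (map O1 w)"
    unfolding quantize_def by auto
qed

lemma quantize_id: "quantize (\<lambda>x. x) = id_blinfun"
proof (rule word_eqI)
  have "inner_preserving (\<lambda>x :: 'k. x)" by (simp add: inner_preserving_def)
  then show "quantize (\<lambda>x. x) \<in> clinear_ops" "quantize (\<lambda>x. x) (word w) = id_blinfun (word w)" for w
    using quantize by simp_all
qed auto

lemma quantize_compose:
  assumes "inner_preserving O1" "inner_preserving O2"
  shows "quantize O1 (quantize O2 x) = quantize (\<lambda>\<xi>. O1 (O2 \<xi>)) x"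
proof -
  have *: "inner_preserving (\<lambda>\<xi>. O1 (O2 \<xi>))" using assms by (simp add: inner_preserving_def)
  have "quantize O1 o\<^sub>L quantize O2 = quantize (\<lambda>\<xi>. O1 (O2 \<xi>))"
    by (rule word_eqI) (auto simp: quantize assms * o_def)
  then show ?thesis by (metis blinfun_apply_blinfun_compose)
qed

lemma quantize_vacuum: "inner_preserving O1 \<Longrightarrow> quantize O1 \<Omega> = \<Omega>"
  using quantize(2)[of O1 "[]"] by simp

lemma quantize_s:
  assumes "inner_preserving O1"
  shows "quantize O1 (s \<xi> x) = s (O1 \<xi>) (quantize O1 x)"
proof -
  have "quantize O1 o\<^sub>L s \<xi> = s (O1 \<xi>) o\<^sub>L quantize O1"
  proof (rule word_eqI)
    show "(quantize O1 o\<^sub>L s \<xi>) (word w) = (s (O1 \<xi>) o\<^sub>L quantize O1) (word w)" for w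
      using quantize(2)[OF assms, of "\<xi> # w"] by (simp add: quantize assms)
  qed (auto simp: quantize assms s_clinear)
  then show ?thesis by (metis blinfun_apply_blinfun_compose)
qed

lemma d_annihilate: "d \<xi> x = s \<xi> x - 2 *\<^sub>R annihilate \<xi> x"
  by (simp add: annihilate_def)

text \<open>The operators \<open>d\<close> do not appear in words; they are reached through the
  annihilation operators, whose action on words is given by contractions and is natural under
  isometries.\<close>

lemma quantize_d:
  assumes O1: "inner_preserving O1"
  shows "quantize O1 (d \<xi> x) = d (O1 \<xi>) (quantize O1 x)"
proof -
  have "quantize O1 o\<^sub>L d \<xi> = d (O1 \<xi>) o\<^sub>L quantize O1"
  proof (rule word_eqI)
    fix w
    have "quantize O1 (\<Sum>(r, v)\<leftarrow>l. r *\<^sub>R word v) = (\<Sum>(r, v)\<leftarrow>map (\<lambda>(r, v). (r, map O1 v)) l. r *\<^sub>R word v)" for l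
      by (induction l) (auto simp: blinfun.add_right blinfun.scaleR_right quantize(2)[OF O1])
    then have "quantize O1 (annihilate \<xi> (word w)) = annihilate (O1 \<xi>) (word (map O1 w))"
      by (simp add: annihilate_word contractions_map[OF O1])
    then show "(quantize O1 o\<^sub>L d \<xi>) (word w) = (d (O1 \<xi>) o\<^sub>L quantize O1) (word w)"
      by (simp add: d_annihilate blinfun.diff_right blinfun.scaleR_right quantize_s[OF O1] quantize(2)[OF O1])
  qed (auto simp: quantize assms d_clinear)
  then show ?thesis by (metis blinfun_apply_blinfun_compose)
qed

lemma cinner_quantize:
  assumes O1: "inner_preserving O1" and O2: "inner_preserving O2" and inv: "\<And>\<xi>. O1 (O2 \<xi>) = \<xi>"
  shows "cinner (quantize O2 x) y = cinner x (quantize O1 y)"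
proof -
  have q: "quantize O2 \<in> clinear_ops" "quantize O1 \<in> clinear_ops" using quantize O1 O2 by auto
  have "quantize O2 = adj (quantize O1)"
  proof (rule word_eqI[OF q(1) clinear_ops_adj[OF q(2)]])
    fix w
    have *: "cinner (word v) (quantize O2 (word w)) = cinner (word v) (adj (quantize O1) (word w))" for v
      using cinner_words_map[OF O1, of v "map O2 w"]
      by (simp add: adj_right[OF q(2)] quantize O1 O2 o_def inv)
    show "quantize O2 (word w) = adj (quantize O1) (word w)"
      by (rule dense_span_inner_eqI[OF dense_words]) (auto simp: inner_eq_Re_cinner cinner_scaleC_left *)
  qed
  then show ?thesis by (simp add: adj_left[OF q(2)])
qed

text \<open>The assumptions say that \<open>\<eta>\<close> annihilates \<open>x\<close> and \<open>y\<close>.  This is where the inner products of the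
  vectors, and thereby the symbols, enter the matrix entries of the dilation.\<close>

lemma cinner_s_s:
  assumes "s \<eta> x = d \<eta> x" "s \<eta> y = d \<eta> y"
  shows "cinner (s \<xi> x) (s \<eta> y) = complex_of_real (inner \<xi> \<eta>) * cinner x y"
proof -
  have "2 * cinner (s \<xi> x) (s \<eta> y) = cinner (s \<xi> x) (s \<eta> y + d \<eta> y)" by (simp add: cinner_add_right assms(2))
  also have "\<dots> = cinner (s \<eta> (s \<xi> x) - d \<eta> (s \<xi> x)) y"
    by (simp add: cinner_add_right cinner_diff_left cinner_s cinner_d)
  also have "s \<eta> (s \<xi> x) - d \<eta> (s \<xi> x) = s \<eta> (s \<xi> x) + s \<xi> (s \<eta> x)"
    using s_d[of \<xi> \<eta> x] by (simp add: assms(1))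
  also have "\<dots> = (2 * inner \<xi> \<eta>) *\<^sub>R x" by (subst car) (simp add: inner_commute)
  finally show ?thesis by (simp add: cinner_scaleR_left)
qed

text \<open>Applying the generator of an orthogonal vector does not spoil annihilation by
  \<open>\<xi>\<close>: the sign from the Clifford relation matches the one from
  \<open>s_d\<close>.\<close>

lemma d_s_orthogonal:
  assumes "inner \<xi> \<eta> = 0" "s \<xi> x = d \<xi> x"
  shows "s \<xi> (s \<eta> x) = d \<xi> (s \<eta> x)"
proof -
  have "s \<xi> (s \<eta> x) = - s \<eta> (s \<xi> x)" using car[of \<xi> \<eta> x] assms(1) by (simp add: eq_neg_iff_add_eq_0)
  also have "\<dots> = d \<xi> (s \<eta> x)" using s_d[of \<eta> \<xi> x] by (simp add: assms(2))
  finally show ?thesis .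
qed

end

text \<open>The one-particle space is used as a real Hilbert space with orthonormal basis
  \<open>\<beta>\<close>, and the finite subsets of its index set label the basis of Fock space.
  Relations are checked on basis vectors and extended to all vectors by continuity.\<close>

lemma fock_exists:
  fixes \<beta> :: "'b \<Rightarrow> 'k::chilbert_space"
  assumes \<beta>: "\<And>a b. inner (\<beta> a) (\<beta> b) = (if a = b then 1 else 0)" "dense_span (range \<beta>)"
  shows "\<exists>(s :: 'k \<Rightarrow>\<^sub>L 'b fset ell2 \<Rightarrow>\<^sub>L 'b fset ell2) d. fock s d grading (ell2_basis {||})"
proof -
  have car: "cliff w a (cliff w b x) + cliff w b (cliff w a x) = (if a = b then 2 * (if w then - 1 else 1) else 0) *\<^sub>R x"
    for w a b x
  proof (cases "a = b")
    case True
    then show ?thesis by (simp add: cliff_square flip: scaleR_2)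
  next
    case False
    then show ?thesis using cliff_anticommute[of w w a b x] by simp
  qed
  have "\<exists>c :: 'k \<Rightarrow>\<^sub>L 'b fset ell2 \<Rightarrow>\<^sub>L 'b fset ell2. (\<forall>b. c (\<beta> b) = cliff w b) \<and> (\<forall>\<xi>. c \<xi> \<in> clinear_ops) \<and>
    (\<forall>\<xi>. adj (c \<xi>) = (if w then - 1 else 1) *\<^sub>R c \<xi>) \<and>
    (\<forall>\<xi> \<eta> x. c \<xi> (c \<eta> x) + c \<eta> (c \<xi> x) = (2 * (if w then - 1 else 1) * inner \<xi> \<eta>) *\<^sub>R x)" for w
    by (rule clifford_extension[OF \<beta>]) (simp_all add: cliff_clinear adj_cliff car)
  then obtain c :: "bool \<Rightarrow> 'k \<Rightarrow>\<^sub>L 'b fset ell2 \<Rightarrow>\<^sub>L 'b fset ell2"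
    where c: "\<And>w b. c w (\<beta> b) = cliff w b" "\<And>w \<xi>. c w \<xi> \<in> clinear_ops"
      "\<And>w \<xi>. adj (c w \<xi>) = (if w then - 1 else 1) *\<^sub>R c w \<xi>"
      "\<And>w \<xi> \<eta> x. c w \<xi> (c w \<eta> x) + c w \<eta> (c w \<xi> x) = (2 * (if w then - 1 else 1) * inner \<xi> \<eta>) *\<^sub>R x"
    by metis
  have dense: "\<xi> \<in> closure (span (range \<beta>))" for \<xi> using \<beta>(2) by (simp add: dense_span_def)
  note bl = bounded_linear_compose[OF blinfun.bounded_linear_left blinfun.bounded_linear_right]
  have bl': "bounded_linear (\<lambda>\<xi>. T (c w \<xi> x))" for T :: "'b fset ell2 \<Rightarrow>\<^sub>L 'b fset ell2" and w x
    by (rule bounded_linear_compose[OF blinfun.bounded_linear_right bl])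
  have sd1: "cliff False b (c True \<eta> x) = - c True \<eta> (cliff False b x)" for b \<eta> x
    by (rule bounded_linear_eq_on_closure[OF bl' bounded_linear_minus[OF bl] _ dense])
      (use cliff_anticommute[of False True b] in \<open>auto simp: c(1)\<close>)
  have sd: "c False \<xi> (c True \<eta> x) = - c True \<eta> (c False \<xi> x)" for \<xi> \<eta> x
    by (rule bounded_linear_eq_on_closure[OF bl bounded_linear_minus[OF bl'] _ dense])
      (auto simp: c(1) sd1)
  have gc: "grading (c w \<xi> x) = - c w \<xi> (grading x)" for w \<xi> x
    by (rule bounded_linear_eq_on_closure[OF bl' bounded_linear_minus[OF bl] _ dense])
      (auto simp: c(1) grading_cliff)
  let ?\<Omega> = "ell2_basis {||} :: 'b fset ell2"
  have vac: "c False \<xi> ?\<Omega> = c True \<xi> ?\<Omega>" for \<xi>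
    by (rule bounded_linear_eq_on_closure[OF bl bl _ dense]) (auto simp: c(1) cliff_vacuum)
  \<comment> \<open>Up to sign each basis vector is a product of generators applied to the vacuum,
    one for each element of the subset.\<close>
  have words: "\<exists>z w. ell2_basis A = z *\<^sub>C foldr (\<lambda>\<xi>. blinfun_apply (c False \<xi>)) w ?\<Omega>" for A
  proof (induction A)
    case empty
    show ?case by (intro exI[of _ 1] exI[of _ "[]"]) simp
  next
    case (insert b A)
    then obtain z w where zw: "ell2_basis A = z *\<^sub>C foldr (\<lambda>\<xi>. blinfun_apply (c False \<xi>)) w ?\<Omega>" by blast
    define \<sigma> where "\<sigma> = parity (cliff_sign False b) (finsert b A)"
    have \<sigma>: "\<sigma> * \<sigma> = 1" using parity_cliff_sign[of False b "finsert b A"] by (auto simp: \<sigma>_def)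
    have "cliff False b (ell2_basis A) = \<sigma> *\<^sub>C ell2_basis (finsert b A)"
      using insert(1) by (simp add: cliff_basis toggle_def \<sigma>_def)
    then have "ell2_basis (finsert b A) = \<sigma> *\<^sub>C c False (\<beta> b) (ell2_basis A)"
      by (simp add: c(1) scaleC_scaleC \<sigma>)
    also have "\<dots> = (\<sigma> * z) *\<^sub>C foldr (\<lambda>\<xi>. blinfun_apply (c False \<xi>)) (\<beta> b # w) ?\<Omega>"
      unfolding zw by (simp add: clinear_opsD[OF c(2)] scaleC_scaleC)
    finally show ?case by blast
  qed
  have "fock (c False) (c True) grading ?\<Omega>"
  proof
    show "dense_span {z *\<^sub>C foldr (\<lambda>\<xi>. blinfun_apply (c False \<xi>)) w ?\<Omega> | z w. True}"
    proof (rule dense_span_mono[OF dense_span_basis], rule subsetI)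
      fix v assume "v \<in> {z *\<^sub>C ell2_basis A | z (A :: 'b fset). z \<in> {1, \<i>}}"
      then obtain z0 and A :: "'b fset" where v: "v = z0 *\<^sub>C ell2_basis A" by blast
      obtain z w where "ell2_basis A = z *\<^sub>C foldr (\<lambda>\<xi>. blinfun_apply (c False \<xi>)) w ?\<Omega>" using words by blast
      then have "v = (z0 * z) *\<^sub>C foldr (\<lambda>\<xi>. blinfun_apply (c False \<xi>)) w ?\<Omega>" by (simp add: v scaleC_scaleC)
      then show "v \<in> {z *\<^sub>C foldr (\<lambda>\<xi>. blinfun_apply (c False \<xi>)) w ?\<Omega> | z w. True}" by blast
    qed
  qed (use c(3)[of False] c(3)[of True] c(4)[of False] sd in
      \<open>simp_all add: c(2) gc vac grading_clinear adj_grading grading_square grading_vacuum\<close>)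
  then show ?thesis by blast
qed

section \<open>Gram matrices and their symmetries\<close>

lemma before_trans: "before a b \<Longrightarrow> before b c \<Longrightarrow> before a c"
proof -
  define r where "r = (SOME r :: 'a rel. well_order_on UNIV r)"
  have "linear_order r" using before_well_order unfolding r_def well_order_on_def by blast
  then have *: "trans r" "antisym r" by (simp_all add: linear_order_on_def partial_order_on_def preorder_on_def)
  show "before a b \<Longrightarrow> before b c \<Longrightarrow> before a c"
    unfolding before_def r_def[symmetric] using *(1)[THEN transD] *(2)[THEN antisymD] by metis
qed

definition positive_kernel :: "('i \<Rightarrow> 'i \<Rightarrow> real) \<Rightarrow> bool"
  where "positive_kernel k \<longleftrightarrow> (\<forall>a b. k a b = k b a) \<and>
    (\<forall>F c. finite F \<longrightarrow> 0 \<le> (\<Sum>a\<in>F. \<Sum>b\<in>F. c a * c b * k a b))"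

lemma inner_basis_basis: "inner (ell2_basis a) (ell2_basis b) = (if a = b then 1 else 0)"
  by (simp add: inner_eq_Re_cinner cinner_basis_basis)

text \<open>One step of a transfinite Gram-Schmidt process run backwards: \<open>r\<close> is the orthogonal projection
  dictated by the kernel plus a multiple of a fresh basis vector.\<close>

lemma gram_step:
  fixes f :: "'i \<Rightarrow> 'k::chilbert_space"
  assumes k: "positive_kernel k" and x: "x \<notin> Y"
    and f: "\<And>y z. y \<in> Y \<Longrightarrow> z \<in> Y \<Longrightarrow> inner (f y) (f z) = k y z"
    and e: "inner e e = 1" "\<And>y. y \<in> Y \<Longrightarrow> inner e (f y) = 0"
  shows "\<exists>r. inner r r = k x x \<and> (\<forall>y\<in>Y. inner (f y) r = k y x) \<and>
    (\<forall>l. inner l e = 0 \<and> (\<forall>y\<in>Y. inner l (f y) = 0) \<longrightarrow> inner l r = 0)"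
proof -
  have ks: "k a b = k b a" for a b using k by (simp add: positive_kernel_def)
  \<comment> \<open>The second component is the value prescribed for the inner product of
    \<open>f y\<close> with the new vector.\<close>
  let ?g = "\<lambda>y. (f y, k y x)"
  let ?S = "span (?g ` Y)"
  \<comment> \<open>The quadratic form of the kernel with coefficient \<open>l\<close> at
    \<open>x\<close>; all bounds below are special choices of \<open>l\<close>.\<close>
  have quad: "0 \<le> (norm v)\<^sup>2 + 2 * l * t + l\<^sup>2 * k x x" if "(v, t) \<in> ?S" for v t l
  proof -
    have "\<exists>D r. (v, t) = (\<Sum>p\<in>D. r p *\<^sub>R p) \<and> finite D \<and> D \<subseteq> ?g ` Y"
      using that unfolding span_explicit by (simp only: mem_Collect_eq)
    then obtain D r where D: "finite D" "D \<subseteq> ?g ` Y" "(v, t) = (\<Sum>p\<in>D. r p *\<^sub>R p)"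
      by (elim exE conjE) (rule that; assumption)
    obtain F where F: "F \<subseteq> Y" "inj_on ?g F" "D = ?g ` F" using D(2) by (auto simp: subset_image_inj)
    have finF: "finite F" using D(1) F(2,3) by (simp add: finite_image_iff)
    define c where "c y = r (?g y)" for y
    have vt: "(v, t) = (\<Sum>y\<in>F. c y *\<^sub>R ?g y)"
      unfolding D(3) F(3) c_def by (subst sum.reindex[OF F(2)]) simp
    have v: "v = (\<Sum>y\<in>F. c y *\<^sub>R f y)" using arg_cong[OF vt, of fst] by (simp add: fst_sum)
    have t: "t = (\<Sum>y\<in>F. c y * k y x)" using arg_cong[OF vt, of snd] by (simp add: snd_sum)
    have nv: "(norm v)\<^sup>2 = (\<Sum>a\<in>F. \<Sum>b\<in>F. c a * c b * k a b)"
      unfolding power2_norm_eq_inner v inner_sum_left inner_sum_right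
      using F(1) f by (intro sum.cong refl) (auto simp: mult_ac subset_iff ks)
    have xF: "x \<notin> F" using x F(1) by blast
    define c' where "c' = c(x := l)"
    have c': "c' a = c a" if "a \<in> F" for a using that xF by (auto simp: c'_def)
    have "0 \<le> (\<Sum>a\<in>insert x F. \<Sum>b\<in>insert x F. c' a * c' b * k a b)"
      using k finF unfolding positive_kernel_def by blast
    also have "\<dots> = l * l * k x x + (\<Sum>b\<in>F. l * c b * k x b) + ((\<Sum>a\<in>F. c a * l * k a x) + (\<Sum>a\<in>F. \<Sum>b\<in>F. c a * c b * k a b))"
      using finF xF by (simp add: sum.distrib c' cong: sum.cong) (simp add: c'_def)
    also have "(\<Sum>b\<in>F. l * c b * k x b) = l * t"
      unfolding t sum_distrib_left using k by (intro sum.cong refl) (simp add: positive_kernel_def)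
    also have "(\<Sum>a\<in>F. c a * l * k a x) = l * t"
      unfolding t sum_distrib_left by (intro sum.cong refl) simp
    finally show ?thesis unfolding nv by (simp add: power2_eq_square mult_ac)
  qed
  have kxx: "0 \<le> k x x" using k[unfolded positive_kernel_def, THEN conjunct2, rule_format, of "{x}" "\<lambda>_. 1"] by simp
  have bound: "norm t \<le> sqrt (k x x) * norm v" if vt: "(v, t) \<in> ?S" for v t
  proof -
    have "t\<^sup>2 \<le> k x x * (norm v)\<^sup>2"
    proof (cases "k x x = 0")
      case True
      have "t = 0"
      proof (rule ccontr)
        assume "t \<noteq> 0"
        \<comment> \<open>With this \<open>l\<close> the expression equals -1, as its quadratic term
          vanishes.\<close>
        then show False using quad[OF vt, of "- ((norm v)\<^sup>2 + 1) / (2 * t)"] True by (simp add: field_simps)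
      qed
      then show ?thesis by (simp add: True)
    next
      case False
      then have "0 < k x x" using kxx by simp
      moreover have "0 \<le> (norm v)\<^sup>2 + 2 * (- t / k x x) * t + (- t / k x x)\<^sup>2 * k x x" by (rule quad[OF vt])
      ultimately show ?thesis by (simp add: power2_eq_square field_simps)
    qed
    then have "sqrt (t\<^sup>2) \<le> sqrt (k x x * (norm v)\<^sup>2)" by (rule real_sqrt_le_mono)
    then show ?thesis by (simp add: real_sqrt_mult)
  qed
  have fstS: "fst ` ?S = span (f ` Y)"
    using span_linear_image[OF bounded_linear.linear[OF bounded_linear_fst], of "?g ` Y"] by (simp add: image_image)
  obtain T :: "'k \<Rightarrow>\<^sub>L real" where T: "\<forall>(v, t)\<in>?S. T v = t" "\<forall>z. (\<forall>v\<in>closure (span (f ` Y)). inner z v = 0) \<longrightarrow> T z = 0"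
    "\<forall>v\<in>closure (span (f ` Y)). (v, T v) \<in> closure ?S"
    using bounded_extension[OF subspace_span bound fstS] by blast
  obtain \<eta> where \<eta>: "\<And>v. T v = inner \<eta> v"
    using Riesz_representation[OF blinfun.bounded_linear_right[of T]] by blast
  have \<eta>S: "\<eta> \<in> closure (span (f ` Y))"
  proof -
    obtain p where p: "p \<in> closure (span (f ` Y))" "\<And>y. y \<in> closure (span (f ` Y)) \<Longrightarrow> inner (\<eta> - p) y = 0"
      using orthogonal_projection_exists[OF subspace_closure[OF subspace_span] closed_closure] by blast
    have "inner \<eta> (\<eta> - p) = 0" unfolding \<eta>[symmetric] by (rule T(2)[rule_format]) (rule p(2))
    then have "inner (\<eta> - p) (\<eta> - p) = 0" using p(2)[OF p(1)] by (simp add: inner_diff_right inner_commute)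
    then show ?thesis using p(1) by simp
  qed
  have perp: "inner l \<eta> = 0" if "\<forall>y\<in>Y. inner l (f y) = 0" for l
  proof -
    have "span (f ` Y) \<subseteq> {v. inner l v = 0}"
      by (rule span_minimal) (use that in \<open>auto simp: subspace_def inner_add_right\<close>)
    then have "closure (span (f ` Y)) \<subseteq> {v. inner l v = 0}"
      by (rule closure_minimal) (auto intro!: closed_Collect_eq continuous_intros)
    then show ?thesis using \<eta>S by blast
  qed
  \<comment> \<open>The choice \<open>l = - 1\<close>, extended to the closure, bounds the
    projection, so the square root below is taken of a nonnegative number.\<close>
  have N: "(norm \<eta>)\<^sup>2 \<le> k x x"
  proof -
    have "closure ?S \<subseteq> {p. 0 \<le> (norm (fst p))\<^sup>2 + 2 * (- 1) * snd p + (- 1)\<^sup>2 * k x x}"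
    proof (rule closure_minimal)
      show "?S \<subseteq> {p. 0 \<le> (norm (fst p))\<^sup>2 + 2 * (- 1) * snd p + (- 1)\<^sup>2 * k x x}"
      proof
        fix p assume "p \<in> ?S"
        then show "p \<in> {p. 0 \<le> (norm (fst p))\<^sup>2 + 2 * (- 1) * snd p + (- 1)\<^sup>2 * k x x}"
          using quad[of "fst p" "snd p" "- 1"] by simp
      qed
      show "closed {p. 0 \<le> (norm (fst p))\<^sup>2 + 2 * (- 1) * snd p + (- 1)\<^sup>2 * k x x}"
        by (intro closed_Collect_le continuous_intros)
    qed
    then have "0 \<le> (norm \<eta>)\<^sup>2 + 2 * (- 1) * T \<eta> + (- 1)\<^sup>2 * k x x" using T(3)[rule_format, OF \<eta>S] by auto
    then show ?thesis by (simp add: \<eta> power2_norm_eq_inner)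
  qed
  let ?r = "\<eta> + sqrt (k x x - (norm \<eta>)\<^sup>2) *\<^sub>R e"
  have e\<eta>: "inner e \<eta> = 0" by (rule perp) (use e(2) in blast)
  show ?thesis
  proof (intro exI[of _ ?r] conjI ballI allI impI)
    have "inner (\<eta> + q *\<^sub>R e) (\<eta> + q *\<^sub>R e) = inner \<eta> \<eta> + q\<^sup>2" for q
      using e\<eta> e(1) by (simp add: inner_add_left inner_add_right inner_commute power2_eq_square)
    then have "inner ?r ?r = (norm \<eta>)\<^sup>2 + (sqrt (k x x - (norm \<eta>)\<^sup>2))\<^sup>2"
      by (simp only: power2_norm_eq_inner)
    then show "inner ?r ?r = k x x" using N by simp
    show "inner (f y) ?r = k y x" if y: "y \<in> Y" for y
    proof -
      have "T (f y) = k y x" using T(1) span_base[of "?g y" "?g ` Y"] y by auto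
      then show ?thesis using e(2)[OF y] by (simp add: \<eta> inner_add_right inner_commute)
    qed
    fix l assume l: "inner l e = 0 \<and> (\<forall>y\<in>Y. inner l (f y) = 0)"
    then show "inner l ?r = 0" using perp[of l] by (simp add: inner_add_right)
  qed
qed

lemma gram_realization:
  assumes k: "positive_kernel k"
  shows "\<exists>\<xi> :: 'i \<Rightarrow> 'i ell2. \<forall>a b. inner (\<xi> a) (\<xi> b) = k a b"
proof -
  define P where "P f x r \<longleftrightarrow> inner r r = k x x \<and> (\<forall>y\<in>{y. before y x}. inner (f y) r = k y x) \<and>
      (\<forall>l. before x l \<longrightarrow> inner (ell2_basis l) r = 0)" for f :: "'i \<Rightarrow> 'i ell2" and x r
  have gram: "inner (f y) (f z) = k y z"
    if "P f y (f y)" "P f z (f z)" for f y z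
  proof -
    consider "y = z" | "before y z" | "before z y" using before_total by metis
    then show ?thesis using that k unfolding P_def positive_kernel_def by cases (auto simp: inner_commute)
  qed
  have "\<exists>f. \<forall>x. P f x (f x)"
  proof (rule dependent_wf_choice[OF wf_before])
    show "P f x r = P g x r" if "\<And>z. (z, x) \<in> {(a, b). before a b} \<Longrightarrow> f z = g z" for f g x r
      using that by (simp add: P_def)
    fix x f assume "\<And>y. (y, x) \<in> {(a, b). before a b} \<Longrightarrow> P f y (f y)"
    then have P: "P f y (f y)" if "before y x" for y using that by simp
    have "\<exists>r. inner r r = k x x \<and> (\<forall>y\<in>{y. before y x}. inner (f y) r = k y x) \<and>
        (\<forall>l. inner l (ell2_basis x) = 0 \<and> (\<forall>y\<in>{y. before y x}. inner l (f y) = 0) \<longrightarrow> inner l r = 0)"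
    proof (rule gram_step[OF k])
      show "inner (f y) (f z) = k y z" if "y \<in> {y. before y x}" "z \<in> {y. before y x}" for y z
        using that gram[OF P P] by simp
      show "inner (ell2_basis x) (f y) = 0" if "y \<in> {y. before y x}" for y
        using that P[of y] by (simp add: P_def)
    qed (simp_all add: inner_basis_basis)
    then obtain r where r: "inner r r = k x x" "\<forall>y\<in>{y. before y x}. inner (f y) r = k y x"
        "\<And>l. inner l (ell2_basis x) = 0 \<Longrightarrow> (\<forall>y\<in>{y. before y x}. inner l (f y) = 0) \<Longrightarrow> inner l r = 0"
      by blast
    have "inner (ell2_basis l) r = 0" if l: "before x l" for l
    proof (rule r(3))
      show "inner (ell2_basis l) (ell2_basis x) = 0" using l by (auto simp: inner_basis_basis)
      show "\<forall>y\<in>{y. before y x}. inner (ell2_basis l) (f y) = 0"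
      proof
        fix y assume y: "y \<in> {y. before y x}"
        then have "before y l" using before_trans[OF _ l] by blast
        then show "inner (ell2_basis l) (f y) = 0" using P[of y] y by (simp add: P_def)
      qed
    qed
    then show "\<exists>r. P f x r" using r(1,2) unfolding P_def by blast
  qed
  then show ?thesis using gram by blast
qed

section \<open>Isometries from symmetries of a Gram matrix\<close>

definition gram_symmetry :: "('i \<Rightarrow> 'k::chilbert_space) \<Rightarrow> ('i \<Rightarrow> 'i) \<Rightarrow> bool"
  where "gram_symmetry \<xi> \<theta> \<longleftrightarrow> (\<forall>a b. inner (\<xi> (\<theta> a)) (\<xi> (\<theta> b)) = inner (\<xi> a) (\<xi> b))"

text \<open>Fixing the orthogonal complement of the family determines the isometry completely, which
  makes it multiplicative in \<open>\<theta>\<close>.\<close>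

definition orth :: "('i \<Rightarrow> 'k::chilbert_space) \<Rightarrow> ('i \<Rightarrow> 'i) \<Rightarrow> 'k \<Rightarrow>\<^sub>L 'k"
  where "orth \<xi> \<theta> = (SOME O1. (\<forall>a. blinfun_apply O1 (\<xi> a) = \<xi> (\<theta> a)) \<and>
    (\<forall>z. (\<forall>a. inner z (\<xi> a) = 0) \<longrightarrow> O1 z = z) \<and> inner_preserving (blinfun_apply O1))"

lemma dense_span_complemented: "dense_span (range \<xi> \<union> {z. \<forall>a. inner z (\<xi> a) = 0})"
proof (rule dense_spanI)
  fix x assume *: "\<And>v. v \<in> range \<xi> \<union> {z. \<forall>a. inner z (\<xi> a) = 0} \<Longrightarrow> inner v x = 0"
  have "inner x (\<xi> a) = 0" for a using *[of "\<xi> a"] by (simp add: inner_commute)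
  then have "inner x x = 0" by (intro *) simp
  then show "x = 0" by simp
qed

lemma orth:
  fixes \<xi> :: "'i \<Rightarrow> 'k::chilbert_space"
  assumes \<theta>: "gram_symmetry \<xi> \<theta>"
  shows "orth \<xi> \<theta> (\<xi> a) = \<xi> (\<theta> a)" "(\<forall>a. inner z (\<xi> a) = 0) \<Longrightarrow> orth \<xi> \<theta> z = z"
    "inner_preserving (blinfun_apply (orth \<xi> \<theta>))"
proof -
  let ?S = "closure (span (range \<xi>))"
  have S: "subspace ?S" by (intro subspace_closure subspace_span)
  obtain T :: "'k \<Rightarrow>\<^sub>L 'k" where T: "\<forall>a. T (\<xi> a) = \<xi> (\<theta> a)" "\<forall>z. (\<forall>a. inner z (\<xi> a) = 0) \<longrightarrow> T z = 0"
      "\<forall>x\<in>?S. \<forall>y\<in>?S. inner (T x) (T y) = inner x y" "\<forall>x. T x \<in> closure (span (range (\<lambda>a. \<xi> (\<theta> a))))"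
    using isometric_extension[of \<xi> "\<lambda>a. \<xi> (\<theta> a)"] \<theta> unfolding gram_symmetry_def by auto
  obtain P :: "'k \<Rightarrow>\<^sub>L 'k" where P: "\<forall>a. P (\<xi> a) = \<xi> a" "\<forall>z. (\<forall>a. inner z (\<xi> a) = 0) \<longrightarrow> P z = 0"
      "\<forall>x. P x \<in> ?S"
    using isometric_extension[of \<xi> \<xi>] by blast
  have TS: "T x \<in> ?S" for x
  proof -
    have "span (range (\<lambda>a. \<xi> (\<theta> a))) \<subseteq> span (range \<xi>)" by (rule span_mono) blast
    then show ?thesis using T(4) closure_mono by blast
  qed
  have perp_S: "inner z y = 0" if "\<forall>a. inner z (\<xi> a) = 0" "y \<in> ?S" for z y
    by (rule bounded_linear_eq_on_closure[OF bounded_linear_inner_right bounded_linear_zero _ that(2)]) (use that(1) in auto)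
  have PS: "P x = x" if "x \<in> ?S" for x
    by (rule bounded_linear_eq_on_closure[OF blinfun.bounded_linear_right bounded_linear_ident _ that]) (use P(1) in auto)
  have comp: "\<forall>a. inner (x - P x) (\<xi> a) = 0" for x
  proof -
    obtain p where p: "p \<in> ?S" "\<And>y. y \<in> ?S \<Longrightarrow> inner (x - p) y = 0"
      using orthogonal_projection_exists[OF S closed_closure, of x] by blast
    have x: "\<forall>a. inner (x - p) (\<xi> a) = 0"
    proof
      fix a have "\<xi> a \<in> ?S" by (meson closure_subset rangeI span_base subsetD)
      then show "inner (x - p) (\<xi> a) = 0" by (rule p(2))
    qed
    then have "P (x - p) = 0" using P(2) by blast
    then have "P x = p" using PS[OF p(1)] by (simp add: blinfun.diff_right)
    then show ?thesis using x by simp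
  qed
  \<comment> \<open>\<open>T\<close> vanishes on the complement, so adding
    \<open>id_blinfun - P\<close> puts the identity there without changing the values on the
    family.\<close>
  define O1 where "O1 = T + (id_blinfun - P)"
  have O1: "O1 x = T x + (x - P x)" for x by (simp add: O1_def blinfun.add_left blinfun.diff_left)
  have TP: "T x = T (P x)" for x
  proof -
    have "T (x - P x) = 0" using T(2) comp by blast
    then show ?thesis by (simp add: blinfun.diff_right)
  qed
  have "inner (O1 x) (O1 y) = inner x y" for x y
  proof -
    have "inner (O1 x) (O1 y) = inner (T (P x)) (T (P y)) + inner (x - P x) (y - P y)"
      using perp_S[OF comp[of x] TS[of y]] perp_S[OF comp[of y] TS[of x]]
      unfolding O1 inner_add_left inner_add_right TP[symmetric] by (simp add: inner_commute)
    also have "inner (T (P x)) (T (P y)) = inner (P x) (P y)" using T(3) P(3) by blast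
    also have "inner (P x) (P y) + inner (x - P x) (y - P y) = inner x y"
      using perp_S[OF comp[of x] P(3)[rule_format, of y]] perp_S[OF comp[of y] P(3)[rule_format, of x]]
      by (simp add: inner_diff_left inner_diff_right inner_commute)
    finally show ?thesis .
  qed
  then have "(\<forall>a. blinfun_apply O1 (\<xi> a) = \<xi> (\<theta> a)) \<and>
    (\<forall>z. (\<forall>a. inner z (\<xi> a) = 0) \<longrightarrow> O1 z = z) \<and> inner_preserving (blinfun_apply O1)"
    using T(1,2) P(1,2) by (auto simp: O1 inner_preserving_def)
  then have "\<exists>O1 :: 'k \<Rightarrow>\<^sub>L 'k. (\<forall>a. blinfun_apply O1 (\<xi> a) = \<xi> (\<theta> a)) \<and> (\<forall>z. (\<forall>a. inner z (\<xi> a) = 0) \<longrightarrow> O1 z = z) \<and> inner_preserving (blinfun_apply O1)"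
    by blast
  from someI_ex[OF this] show "orth \<xi> \<theta> (\<xi> a) = \<xi> (\<theta> a)" "(\<forall>a. inner z (\<xi> a) = 0) \<Longrightarrow> orth \<xi> \<theta> z = z"
    "inner_preserving (blinfun_apply (orth \<xi> \<theta>))"
    unfolding orth_def by auto
qed

lemma gram_symmetry_compose: "gram_symmetry \<xi> \<theta> \<Longrightarrow> gram_symmetry \<xi> \<theta>' \<Longrightarrow> gram_symmetry \<xi> (\<lambda>a. \<theta> (\<theta>' a))"
  by (simp add: gram_symmetry_def)

lemma orth_compose:
  assumes "gram_symmetry \<xi> \<theta>" "gram_symmetry \<xi> \<theta>'"
  shows "orth \<xi> \<theta> (orth \<xi> \<theta>' x) = orth \<xi> (\<lambda>a. \<theta> (\<theta>' a)) x"
proof -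
  have "orth \<xi> \<theta> o\<^sub>L orth \<xi> \<theta>' = orth \<xi> (\<lambda>a. \<theta> (\<theta>' a))"
    by (rule dense_span_eqI[OF dense_span_complemented[of \<xi>]])
      (use assms gram_symmetry_compose[OF assms] in \<open>auto simp: orth\<close>)
  then show ?thesis by (metis blinfun_apply_blinfun_compose)
qed

lemma orth_id: "orth \<xi> (\<lambda>a. a) x = x"
proof -
  have *: "gram_symmetry \<xi> (\<lambda>a. a)" by (simp add: gram_symmetry_def)
  have "orth \<xi> (\<lambda>a. a) = id_blinfun"
    by (rule dense_span_eqI[OF dense_span_complemented[of \<xi>]]) (use * in \<open>auto simp: orth\<close>)
  then show ?thesis by simp
qed

section \<open>Positive definite symbols\<close>

text \<open>The matrix with entries \<open>left_regular (- g i + g j)\<close> is a Gram matrix of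
  operators, hence positive. Its image is tested on multiples of the vectors
  \<open>ell2_basis (- g j)\<close>, since the entry in row \<open>i\<close> maps each of them to
  \<open>ell2_basis (- g i)\<close> up to a scalar.\<close>

lemma fourier_multiplier_positive:
  fixes t :: "'g::group_add \<Rightarrow> complex"
  assumes T: "fourier_multiplier t T" and cp: "completely_positive VN T"
  shows "(\<Sum>i<(m::nat). \<Sum>j<m. cnj (c i) * c j * t (- g i + g j)) \<in> \<real>\<^sub>\<ge>\<^sub>0"
proof -
  let ?X = "\<lambda>i j. left_regular (- g i + g j) :: 'g ell2 \<Rightarrow>\<^sub>L 'g ell2"
  have "positive_matrix m ?X"
    unfolding positive_matrix_def
  proof (intro conjI allI impI)
    fix \<xi> :: "nat \<Rightarrow> 'g ell2"
    have "cinner (\<xi> i) (?X i j (\<xi> j)) = cinner (left_regular (g i) (\<xi> i)) (left_regular (g j) (\<xi> j))" for i j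
    proof -
      have "?X i j (\<xi> j) = adj (left_regular (g i)) (left_regular (g j) (\<xi> j))"
        unfolding adj_left_regular left_regular_compose[symmetric] by simp
      then show ?thesis by (simp add: adj_right)
    qed
    then have "(\<Sum>i<m. \<Sum>j<m. cinner (\<xi> i) (?X i j (\<xi> j))) =
        cinner (\<Sum>i<m. left_regular (g i) (\<xi> i)) (\<Sum>j<m. left_regular (g j) (\<xi> j))"
      by (simp add: cinner_sum_left cinner_sum_right) (rule sum.swap)
    then show "(\<Sum>i<m. \<Sum>j<m. cinner (\<xi> i) (?X i j (\<xi> j))) \<in> \<real>\<^sub>\<ge>\<^sub>0"
      by (simp add: cinner_self)
  qed simp
  then have "positive_matrix m (\<lambda>i j. T (?X i j))"
    using cp[unfolded completely_positive_def, rule_format, of m ?X] left_regular_VN by blast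
  then have "(\<Sum>i<m. \<Sum>j<m. cinner (c i *\<^sub>C ell2_basis (- g i)) (T (?X i j) (c j *\<^sub>C ell2_basis (- g j)))) \<in> \<real>\<^sub>\<ge>\<^sub>0"
    unfolding positive_matrix_def by (elim conjE allE[of _ "\<lambda>i. c i *\<^sub>C ell2_basis (- g i)"])
  moreover have "cinner (c i *\<^sub>C ell2_basis (- g i)) (T (?X i j) (c j *\<^sub>C ell2_basis (- g j))) =
      cnj (c i) * c j * t (- g i + g j)" for i j
  proof -
    have "T (?X i j) = t (- g i + g j) *\<^sub>C ?X i j" using T by (simp add: fourier_multiplier_def)
    then show ?thesis
      by (simp add: scaleC_blinfun.rep_eq clinear_opsD left_regular_basis cinner_scaleC_left cinner_scaleC_right
          cinner_basis_basis add.assoc)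
  qed
  ultimately show ?thesis by simp
qed

lemma fourier_multiplier_unital:
  fixes t :: "'a::group_add \<Rightarrow> complex"
  assumes T: "fourier_multiplier t T" and u: "unital_map T"
  shows "t 0 = 1"
proof -
  have "T (left_regular 0) = t 0 *\<^sub>C left_regular 0" using T by (simp add: fourier_multiplier_def)
  then have "t 0 *\<^sub>C (id_blinfun :: 'a ell2 \<Rightarrow>\<^sub>L 'a ell2) = id_blinfun"
    using u by (simp add: left_regular_zero unital_map_def)
  then have "(t 0 *\<^sub>C id_blinfun) (ell2_basis (0 :: 'a)) = id_blinfun (ell2_basis 0)" by simp
  then have "cinner (ell2_basis (0 :: 'a)) (t 0 *\<^sub>C ell2_basis 0) = cinner (ell2_basis (0 :: 'a)) (ell2_basis 0)"
    by (simp add: scaleC_blinfun.rep_eq)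
  then show ?thesis by (simp add: cinner_scaleC_right cinner_basis_basis)
qed

text \<open>A positive definite function takes conjugate values at \<open>g\<close> and
  \<open>- g\<close>; realness turns this into symmetry. The coefficients 1 and \<i> isolate the
  relevant imaginary part.\<close>

lemma fourier_multiplier_symmetric:
  assumes T: "fourier_multiplier t T" and cp: "completely_positive VN T" and real: "\<And>g. t g \<in> \<real>"
  shows "t (- g) = t g"
proof -
  have "(\<Sum>i<(2::nat). \<Sum>j<(2::nat). cnj (if i = 0 then 1 else \<i>) * (if j = 0 then 1 else \<i>) *
      t (- (if i = 0 then 0 else g) + (if j = 0 then 0 else g))) \<in> \<real>\<^sub>\<ge>\<^sub>0"
    by (rule fourier_multiplier_positive[OF T cp])
  then have "Im (t 0 + \<i> * t g + (- \<i> * t (- g) + t 0)) = 0"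
    by (simp add: numeral_2_eq_2 complex_nonneg_Reals_iff)
  moreover have "Im (t h) = 0" for h using real by (simp add: complex_is_Real_iff)
  ultimately show ?thesis by (simp add: complex_eq_iff)
qed

text \<open>The first two components of an index enumerate independent copies of the vectors of the symbols.\<close>

definition symbol_kernel :: "('i \<Rightarrow> 'g::group_add \<Rightarrow> real) \<Rightarrow> ('i \<times> int \<times> 'g) \<Rightarrow> ('i \<times> int \<times> 'g) \<Rightarrow> real"
  where "symbol_kernel r = (\<lambda>(i, j, g) (i', j', g'). if i = i' \<and> j = j' then r i (- g + g') else 0)"

text \<open>The kernel is block diagonal with respect to the first two components; in each block
  positivity is that of one symbol, after enumerating the finitely many indices involved.\<close>

lemma positive_symbol_kernel:
  fixes r :: "'i \<Rightarrow> 'g::group_add \<Rightarrow> real"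
  assumes sym: "\<And>i g. r i (- g) = r i g"
    and pos: "\<And>i m c g. 0 \<le> (\<Sum>a<(m::nat). \<Sum>b<m. c a * c b * r i (- g a + g b))"
  shows "positive_kernel (symbol_kernel r)"
  unfolding positive_kernel_def
proof (intro conjI allI impI)
  show "symbol_kernel r a b = symbol_kernel r b a" for a b
  proof -
    have "r i (- g + h) = r i (- h + g)" for i g h
      using sym[of i "- g + h"] by (simp add: minus_add)
    then show ?thesis by (auto simp: symbol_kernel_def split: prod.splits)
  qed
  fix F :: "('i \<times> int \<times> 'g) set" and c :: "'i \<times> int \<times> 'g \<Rightarrow> real" assume F: "finite F"
  let ?p = "\<lambda>(i, j, g). (i, j)" and ?q = "\<lambda>(i, j, g). g"
  have fin: "0 \<le> (\<Sum>a\<in>A. \<Sum>b\<in>A. c a * c b * r i (- ?q a + ?q b))" if A: "finite A" for A :: "('i \<times> int \<times> 'g) set" and i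
  proof -
    obtain h where h: "bij_betw h {0..<card A} A" using ex_bij_betw_nat_finite[OF A] by blast
    have "(\<Sum>a\<in>A. \<Sum>b\<in>A. c a * c b * r i (- ?q a + ?q b)) =
        (\<Sum>a<card A. \<Sum>b<card A. c (h a) * c (h b) * r i (- ?q (h a) + ?q (h b)))"
      unfolding sum.reindex_bij_betw[OF h, symmetric] by (simp add: atLeast0LessThan)
    also have "0 \<le> \<dots>" by (rule pos)
    finally show ?thesis .
  qed
  have "(\<Sum>a\<in>F. \<Sum>b\<in>F. c a * c b * symbol_kernel r a b) =
      (\<Sum>u\<in>?p ` F. \<Sum>a\<in>{a \<in> F. ?p a = u}. \<Sum>b\<in>F. c a * c b * symbol_kernel r a b)"
    by (rule sum.group[symmetric]) (use F in auto)
  also have "\<dots> = (\<Sum>u\<in>?p ` F. \<Sum>a\<in>{a \<in> F. ?p a = u}. \<Sum>b\<in>{b \<in> F. ?p b = u}. c a * c b * r (fst u) (- ?q a + ?q b))"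
  proof (rule sum.cong[OF refl], rule sum.cong[OF refl])
    fix u a assume a: "a \<in> {a \<in> F. ?p a = u}"
    have "(\<Sum>b\<in>{b \<in> F. ?p b = u}. c a * c b * r (fst u) (- ?q a + ?q b)) =
        (\<Sum>b\<in>{b \<in> F. ?p b = u}. c a * c b * symbol_kernel r a b)"
      using a by (cases a) (auto simp: symbol_kernel_def intro!: sum.cong)
    also have "\<dots> = (\<Sum>b\<in>F. c a * c b * symbol_kernel r a b)"
      using F a by (cases a) (auto simp: symbol_kernel_def intro!: sum.mono_neutral_left split: if_splits)
    finally show "(\<Sum>b\<in>F. c a * c b * symbol_kernel r a b) = (\<Sum>b\<in>{b \<in> F. ?p b = u}. c a * c b * r (fst u) (- ?q a + ?q b))" ..
  qed
  also have "0 \<le> \<dots>" by (intro sum_nonneg fin) (use F in auto)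
  finally show "0 \<le> (\<Sum>a\<in>F. \<Sum>b\<in>F. c a * c b * symbol_kernel r a b)" .
qed

section \<open>The index set of the dilation\<close>

text \<open>Schroeder-Bernstein with two explicit injections. A finite subset is listed in some
  order with its discrete data packed into numbers; conversely a list is stored as the finite set of
  its entries tagged by position.\<close>

lemma dilation_pairing:
  "\<exists>\<iota> :: 'g::group_add \<Rightarrow> ((nat \<times> int \<times> 'g) \<times> bool) fset \<Rightarrow> 'g dilation_index. pairing \<iota>"
proof -
  let ?enc = "\<lambda>((i, j, h), b). (h, to_nat (i :: nat, j :: int, b :: bool))"
  have enc: "inj (?enc :: (nat \<times> int \<times> 'g) \<times> bool \<Rightarrow> 'g \<times> nat)" by (rule injI) auto
  define lst where "lst A = (SOME l. set l = fset A)" for A :: "((nat \<times> int \<times> 'g) \<times> bool) fset"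
  have lst: "set (lst A) = fset A" for A
    unfolding lst_def by (rule someI_ex) (use finite_list[OF finite_fset] in blast)
  define F where "F p = (case p of (g, A) \<Rightarrow> (g, 0) # map ?enc (lst A))" for p :: "'g \<times> ((nat \<times> int \<times> 'g) \<times> bool) fset"
  have F: "inj F"
  proof (rule injI)
    fix p q assume pq: "F p = F q"
    obtain g A h B where eq: "p = (g, A)" "q = (h, B)" by fastforce
    have "g = h" and "map ?enc (lst A) = map ?enc (lst B)" using pq by (simp_all add: F_def eq)
    then have "set (map ?enc (lst A)) = set (map ?enc (lst B))" by (simp only:)
    then have "?enc ` fset A = ?enc ` fset B" unfolding set_map lst .
    then have "fset A = fset B" using inj_image_eq_iff[OF enc] by blast
    then show "p = q" using \<open>g = h\<close> by (simp add: eq fset_inject)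
  qed
  \<comment> \<open>The position goes into the symbol slot and the number into the copy slot, so the
    set remembers order and repetitions.\<close>
  define R where "R l = {((p, int (snd (l ! p)), fst (l ! p)), False) | p. p < length l}" for l :: "('g \<times> nat) list"
  have R_fin: "finite (R l)" for l unfolding R_def by simp
  define H where "H l = (0 :: 'g, Abs_fset (R l))" for l
  have H: "inj H"
  proof (rule injI)
    fix l m assume "H l = H m"
    then have lm: "R l = R m" using R_fin by (simp add: H_def Abs_fset_inject)
    have mem: "((p, n, g), False) \<in> R l \<longleftrightarrow> p < length l \<and> n = int (snd (l ! p)) \<and> g = fst (l ! p)" for l p n g
      by (auto simp: R_def)
    have len: "p < length m" if "p < length l" "R l = R m" for p and l m :: "('g \<times> nat) list"
    proof -
      have "((p, int (snd (l ! p)), fst (l ! p)), False) \<in> R m" using mem[of p "int (snd (l ! p))" "fst (l ! p)" l] that by simp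
      then show ?thesis by (simp add: mem)
    qed
    show "l = m"
    proof (rule nth_equalityI)
      show "length l = length m" using len[of "length l" m l] len[of "length m" l m] lm by (cases "length l" "length m" rule: linorder_cases) auto
      fix p assume "p < length l"
      then have "((p, int (snd (l ! p)), fst (l ! p)), False) \<in> R m" using mem[of p "int (snd (l ! p))" "fst (l ! p)" l] lm by simp
      then show "l ! p = m ! p" unfolding mem by (simp add: prod_eq_iff)
    qed
  qed
  obtain h where "bij_betw h (UNIV :: ('g \<times> ((nat \<times> int \<times> 'g) \<times> bool) fset) set) (UNIV :: 'g dilation_index set)"
    using Schroeder_Bernstein[of F UNIV UNIV H] F H by auto
  then have "pairing (\<lambda>g A. h (g, A))" by (simp add: pairing_def case_prod_beta')
  then show ?thesis by blast
qed

section \<open>The crossed product\<close>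

lemma blinfun_compose_assoc: "(S o\<^sub>L T) o\<^sub>L R = S o\<^sub>L (T o\<^sub>L R)"
  by (rule blinfun_eqI) simp

lemma scaleC_minus_one: "(- 1) *\<^sub>C (x :: 'h::chilbert_space) = - x"
  using scaleC_of_real[of "- 1" x] by simp

text \<open>Since conjugation by \<open>W\<close> maps \<open>B\<close> into itself, conjugation by
  \<open>W'\<close> preserves the commutant, and dually conjugation by \<open>W\<close> preserves
  the bicommutant.\<close>

lemma conjugation_bicommutant:
  fixes W W' :: "'h::chilbert_space \<Rightarrow>\<^sub>L 'h"
  assumes W: "W \<in> clinear_ops" "W' \<in> clinear_ops" and inv: "W o\<^sub>L W' = id_blinfun" "W' o\<^sub>L W = id_blinfun"
    and B: "\<And>b. b \<in> B \<Longrightarrow> W o\<^sub>L b o\<^sub>L W' \<in> B" and x: "x \<in> commutant (commutant B)"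
  shows "W o\<^sub>L x o\<^sub>L W' \<in> commutant (commutant B)"
proof (rule commutantI)
  have inv': "W (W' z) = z" "W' (W z) = z" for z
    using inv by (metis blinfun_apply_blinfun_compose blinfun_apply_id_blinfun id_apply)+
  show "W o\<^sub>L x o\<^sub>L W' \<in> clinear_ops" using W commutant_clinear[OF x] by blast
  fix T assume T: "T \<in> commutant B"
  have "W' o\<^sub>L T o\<^sub>L W \<in> commutant B"
  proof (rule commutantI)
    show "W' o\<^sub>L T o\<^sub>L W \<in> clinear_ops" using W commutant_clinear[OF T] by blast
    fix b assume b: "b \<in> B"
    show "(W' o\<^sub>L T o\<^sub>L W) o\<^sub>L b = b o\<^sub>L (W' o\<^sub>L T o\<^sub>L W)"
    proof (rule blinfun_eqI)
      fix z
      show "((W' o\<^sub>L T o\<^sub>L W) o\<^sub>L b) z = (b o\<^sub>L (W' o\<^sub>L T o\<^sub>L W)) z"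
        using commutant_apply[OF T B[OF b], of "W z"] by (simp add: inv')
    qed
  qed
  from commutant_apply[OF x this] have *: "x (W' (T (W z))) = W' (T (W (x z)))" for z by simp
  show "(W o\<^sub>L x o\<^sub>L W') o\<^sub>L T = T o\<^sub>L (W o\<^sub>L x o\<^sub>L W')"
  proof (rule blinfun_eqI)
    fix z
    show "((W o\<^sub>L x o\<^sub>L W') o\<^sub>L T) z = (T o\<^sub>L (W o\<^sub>L x o\<^sub>L W')) z"
      using *[of "W' z"] by (simp add: inv')
  qed
qed

definition translate_index :: "'g::group_add \<Rightarrow> 'i \<times> int \<times> 'g \<Rightarrow> 'i \<times> int \<times> 'g"
  where "translate_index g = (\<lambda>(i, j, h). (i, j, g + h))"

definition shift_index :: "'i \<Rightarrow> int \<Rightarrow> 'i \<times> int \<times> 'g \<Rightarrow> 'i \<times> int \<times> 'g"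
  where "shift_index i m = (\<lambda>(i', j, h). (i', if i' = i then j + m else j, h))"

text \<open>The setting for the crossed product on square summable families over the group tensored
  with Fock space. An index of \<open>\<xi>\<close> consists of a symbol, an integer labelling the
  copy, and a group element; the normalization \<open>r_0\<close> makes the \<open>\<xi>\<close>
  unit vectors.\<close>

locale crossed_product = fock s d \<gamma> \<omega>
  for s d :: "'k::chilbert_space \<Rightarrow>\<^sub>L ('y ell2 \<Rightarrow>\<^sub>L 'y ell2)" and \<gamma> :: "'y ell2 \<Rightarrow>\<^sub>L 'y ell2" and \<omega> :: "'y ell2" +
  fixes \<iota> :: "'g::group_add \<Rightarrow> 'y \<Rightarrow> 'x" and \<xi> :: "'i \<times> int \<times> 'g \<Rightarrow> 'k" and r :: "'i \<Rightarrow> 'g \<Rightarrow> real"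
  assumes \<iota>: "pairing \<iota>" and gram: "inner (\<xi> a) (\<xi> b) = symbol_kernel r a b" and r_0: "r i 0 = 1"
begin

section \<open>Group action and shifts on the one-particle space\<close>

lemma gram_symmetry_translate: "gram_symmetry \<xi> (translate_index g)"
proof -
  have "- (g + h) + (g + h') = - h + h'" for h h' :: 'g
    by (simp add: minus_add diff_conv_add_uminus add.assoc del: add_uminus_conv_diff)
  then show ?thesis by (auto simp: gram_symmetry_def gram symbol_kernel_def translate_index_def split: prod.splits)
qed

lemma gram_symmetry_shift: "gram_symmetry \<xi> (shift_index i m)"
  by (auto simp: gram_symmetry_def gram symbol_kernel_def shift_index_def split: prod.splits)

definition \<pi> :: "'g \<Rightarrow> 'k \<Rightarrow> 'k"
  where "\<pi> g = orth \<xi> (translate_index g)"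

definition \<sigma> :: "'i \<Rightarrow> int \<Rightarrow> 'k \<Rightarrow> 'k"
  where "\<sigma> i m = orth \<xi> (shift_index i m)"

lemma \<pi>_inner: "inner_preserving (\<pi> g)" and \<sigma>_inner: "inner_preserving (\<sigma> i m)"
  unfolding \<pi>_def \<sigma>_def by (rule orth(3)[OF gram_symmetry_translate], rule orth(3)[OF gram_symmetry_shift])

lemma \<pi>_\<xi>: "\<pi> g (\<xi> (i, j, h)) = \<xi> (i, j, g + h)"
  using orth(1)[OF gram_symmetry_translate, of g "(i, j, h)"] by (simp add: \<pi>_def translate_index_def)

lemma \<sigma>_\<xi>: "\<sigma> i m (\<xi> (i', j, h)) = \<xi> (i', if i' = i then j + m else j, h)"
  using orth(1)[OF gram_symmetry_shift, of i m "(i', j, h)"] by (simp add: \<sigma>_def shift_index_def)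

lemma \<pi>_add: "\<pi> g (\<pi> h \<eta>) = \<pi> (g + h) \<eta>"
proof -
  have "(\<lambda>a. translate_index g (translate_index h a)) = (translate_index (g + h) :: 'i \<times> int \<times> 'g \<Rightarrow> _)"
    by (auto simp: translate_index_def fun_eq_iff add.assoc)
  then show ?thesis unfolding \<pi>_def by (simp add: orth_compose gram_symmetry_translate)
qed

lemma \<pi>_0: "\<pi> 0 \<eta> = \<eta>"
proof -
  have "(translate_index 0 :: 'i \<times> int \<times> 'g \<Rightarrow> _) = (\<lambda>a. a)" by (auto simp: translate_index_def fun_eq_iff)
  then show ?thesis unfolding \<pi>_def by (simp add: orth_id)
qed

lemma norm_\<pi>: "norm (\<pi> g \<eta>) = norm \<eta>"
  using \<pi>_inner[of g] by (simp add: inner_preserving_def norm_eq_sqrt_inner)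

lemma \<sigma>_\<pi>: "\<sigma> i m (\<pi> g \<eta>) = \<pi> g (\<sigma> i m \<eta>)"
proof -
  have "(\<lambda>a. shift_index i m (translate_index g a)) = (\<lambda>a. translate_index g (shift_index i m a))"
    by (auto simp: translate_index_def shift_index_def fun_eq_iff)
  then show ?thesis unfolding \<pi>_def \<sigma>_def
    by (simp add: orth_compose gram_symmetry_translate gram_symmetry_shift)
qed

lemma \<sigma>_\<sigma>: "\<sigma> i m (\<sigma> i' m' \<eta>) = \<sigma> i' m' (\<sigma> i m \<eta>)"
proof -
  have "(\<lambda>a. shift_index i m (shift_index i' m' a)) = (\<lambda>a. shift_index i' m' (shift_index i m (a :: 'i \<times> int \<times> 'g)))"
    by (auto simp: shift_index_def fun_eq_iff)
  then show ?thesis unfolding \<sigma>_def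
    by (simp add: orth_compose gram_symmetry_shift)
qed

lemma \<sigma>_inverse: "\<sigma> i m (\<sigma> i (- m) \<eta>) = \<eta>"
proof -
  have "(\<lambda>a. shift_index i m (shift_index i (- m) a)) = (\<lambda>a :: 'i \<times> int \<times> 'g. a)"
    by (auto simp: shift_index_def fun_eq_iff)
  then show ?thesis unfolding \<sigma>_def by (simp add: orth_compose gram_symmetry_shift orth_id)
qed

section \<open>Generators of the crossed product and their commutant\<close>

definition \<Omega> :: "'x ell2"
  where "\<Omega> = tens \<iota> (ell2_basis 0) \<omega>"

text \<open>The Clifford generator inside the crossed product: twisting by
  \<open>\<pi> (- h)\<close> in the fibre over \<open>h\<close> makes conjugation by the translation
  of \<open>g\<close> send \<open>L \<eta>\<close> to \<open>L (\<pi> g \<eta>)\<close>.\<close>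

definition L :: "'k \<Rightarrow> 'x ell2 \<Rightarrow>\<^sub>L 'x ell2"
  where "L \<eta> = blockdiag \<iota> (\<lambda>h. s (\<pi> (- h) \<eta>))"

definition B :: "('x ell2 \<Rightarrow>\<^sub>L 'x ell2) set"
  where "B = range (\<lambda>g. amp \<iota> (left_regular g)) \<union> range L"

definition fib :: "('y ell2 \<Rightarrow>\<^sub>L 'y ell2) \<Rightarrow> 'x ell2 \<Rightarrow>\<^sub>L 'x ell2"
  where "fib = amp (swap_pairing \<iota>)"

lemma fib_clinear: "T \<in> clinear_ops \<Longrightarrow> fib T \<in> clinear_ops"
  unfolding fib_def by (rule amp_clinear[OF pairing_swap[OF \<iota>]])

lemma fib_tens: "T \<in> clinear_ops \<Longrightarrow> fib T (tens \<iota> \<phi> x) = tens \<iota> \<phi> (T x)"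
  unfolding fib_def using amp_tens[OF pairing_swap[OF \<iota>], of T x \<phi>] by (simp add: tens_swap[OF \<iota>])

lemma adj_fib: "T \<in> clinear_ops \<Longrightarrow> adj (fib T) = fib (adj T)"
  unfolding fib_def by (rule amp_adj[OF pairing_swap[OF \<iota>]])

lemma bounded_L: "bounded (range (\<lambda>h. s (\<pi> (- h) \<eta>)))"
proof -
  have "norm (s (\<pi> (- h) \<eta>)) \<le> norm \<eta>" for h
    by (rule norm_blinfun_bound) (simp_all add: norm_s norm_\<pi>)
  then show ?thesis unfolding bounded_iff by blast
qed

lemma L_clinear: "L \<eta> \<in> clinear_ops"
  unfolding L_def by (rule blockdiag_clinear[OF \<iota> bounded_L s_clinear])

lemma L_tens: "L \<eta> (tens \<iota> (ell2_basis h) x) = tens \<iota> (ell2_basis h) (s (\<pi> (- h) \<eta>) x)"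
  unfolding L_def by (rule blockdiag_tens[OF \<iota> bounded_L s_clinear])

lemma adj_L: "adj (L \<eta>) = L \<eta>"
  unfolding L_def using adj_blockdiag[OF \<iota> bounded_L s_clinear] bounded_L by (simp add: s_adj)

lemma L_L: "norm \<eta> = 1 \<Longrightarrow> L \<eta> (L \<eta> x) = x"
proof -
  assume "norm \<eta> = 1"
  then have "L \<eta> o\<^sub>L L \<eta> = id_blinfun"
    by (intro tens_op_eqI[OF \<iota>]) (simp add: L_tens s_square norm_\<pi>)
  then show ?thesis by (metis blinfun_apply_blinfun_compose blinfun_apply_id_blinfun id_apply)
qed

lemma amp_left_tens: "amp \<iota> (left_regular g) (tens \<iota> (ell2_basis h) x) = tens \<iota> (ell2_basis (g + h)) x"
  by (simp add: amp_tens[OF \<iota>] left_regular_basis)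

text \<open>Right translation by \<open>g\<close> moves the fibre over \<open>h\<close> to
  \<open>h - g\<close>; quantizing \<open>\<pi> g\<close> compensates for the changed twist in
  \<open>L\<close>, so these operators lie in the commutant.\<close>

definition R :: "'g \<Rightarrow> 'x ell2 \<Rightarrow>\<^sub>L 'x ell2"
  where "R g = amp \<iota> (right_regular g) o\<^sub>L fib (quantize (\<pi> g))"

lemma quantize_\<pi>_clinear: "quantize (\<pi> g) \<in> clinear_ops"
  by (rule quantize(1)[OF \<pi>_inner])

lemma adj_quantize_\<pi>: "adj (quantize (\<pi> g)) = quantize (\<pi> (- g))"
  by (rule adj_eqI[OF cinner_quantize[OF \<pi>_inner \<pi>_inner] quantize_\<pi>_clinear]) (simp add: \<pi>_add \<pi>_0)

lemma R_clinear: "R g \<in> clinear_ops"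
  unfolding R_def by (intro clinear_ops_compose amp_clinear[OF \<iota>] fib_clinear quantize_\<pi>_clinear) auto

lemma R_tens: "R g (tens \<iota> \<phi> x) = tens \<iota> (right_regular g \<phi>) (quantize (\<pi> g) x)"
  by (simp add: R_def fib_tens quantize_\<pi>_clinear amp_tens[OF \<iota>])

lemma adj_R_tens: "adj (R g) (tens \<iota> \<phi> x) = tens \<iota> (right_regular (- g) \<phi>) (quantize (\<pi> (- g)) x)"
  unfolding R_def
  by (simp add: adj_compose amp_clinear[OF \<iota>] fib_clinear quantize_\<pi>_clinear amp_adj[OF \<iota>] adj_right_regular
      adj_fib adj_quantize_\<pi> amp_tens[OF \<iota>] fib_tens)

lemma R_commutant: "R g \<in> commutant B"
proof (rule commutantI[OF R_clinear])
  fix S assume "S \<in> B"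
  then consider k where "S = amp \<iota> (left_regular k)" | \<eta> where "S = L \<eta>" unfolding B_def by blast
  then show "R g o\<^sub>L S = S o\<^sub>L R g"
  proof cases
    case 1
    show ?thesis unfolding 1
      by (rule tens_op_eqI[OF \<iota>])
        (simp add: amp_left_tens R_tens right_regular_basis left_regular_basis diff_conv_add_uminus add.assoc del: add_uminus_conv_diff)
  next
    case 2
    have "g + - h = - (h - g)" for h by (simp add: minus_diff_eq)
    then show ?thesis unfolding 2
      by (intro tens_op_eqI[OF \<iota>])
        (simp add: L_tens R_tens right_regular_basis quantize_s[OF \<pi>_inner] \<pi>_add)
  qed
qed

lemma d_\<gamma>_clinear: "d \<eta> o\<^sub>L \<gamma> \<in> clinear_ops"
  by (rule clinear_ops_compose[OF d_clinear \<gamma>_clinear])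

lemma adj_d_\<gamma>: "adj (d \<eta> o\<^sub>L \<gamma>) = d \<eta> o\<^sub>L \<gamma>"
  by (rule blinfun_eqI) (simp add: adj_compose d_clinear \<gamma>_clinear d_adj \<gamma>_adj blinfun.minus_left blinfun.minus_right \<gamma>_d)

text \<open>Both \<open>d \<eta>\<close> and the grading anticommute with every \<open>s\<close>, so
  their product commutes. On the vacuum it acts as \<open>s \<eta>\<close>: it is Clifford
  multiplication by \<open>\<eta>\<close> from the right.\<close>

lemma fib_d_\<gamma>_commutant: "fib (d \<eta> o\<^sub>L \<gamma>) \<in> commutant B"
proof (rule commutantI[OF fib_clinear[OF d_\<gamma>_clinear]])
  fix S assume "S \<in> B"
  then consider k where "S = amp \<iota> (left_regular k)" | \<zeta> where "S = L \<zeta>" unfolding B_def by blast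
  then show "fib (d \<eta> o\<^sub>L \<gamma>) o\<^sub>L S = S o\<^sub>L fib (d \<eta> o\<^sub>L \<gamma>)"
  proof cases
    case 1
    show ?thesis unfolding 1
      by (rule tens_op_eqI[OF \<iota>]) (simp add: amp_left_tens fib_tens[OF d_\<gamma>_clinear])
  next
    case 2
    show ?thesis unfolding 2
      by (rule tens_op_eqI[OF \<iota>])
        (simp add: L_tens fib_tens[OF d_\<gamma>_clinear] \<gamma>_s s_d blinfun.minus_right)
  qed
qed

lemma L_\<Omega>: "L \<eta> \<Omega> = tens \<iota> (ell2_basis 0) (s \<eta> \<omega>)"
  by (simp add: \<Omega>_def L_tens \<pi>_0)

lemma word_op: "\<exists>y\<in>words B. blinfun_apply y \<Omega> = tens \<iota> (ell2_basis 0) (word w)"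
proof (induction w)
  case Nil
  show ?case by (rule bexI[OF _ words_id]) (simp add: \<Omega>_def)
next
  case (Cons \<eta> w)
  then obtain y where y: "y \<in> words B" "y \<Omega> = tens \<iota> (ell2_basis 0) (word w)" by blast
  have "L \<eta> \<in> B" by (simp add: B_def)
  from words_step[OF this y(1)] show ?case
    by (rule bexI[rotated]) (simp add: y(2) L_tens \<pi>_0)
qed

text \<open>Translation by \<open>k\<close> is mirrored by \<open>R (- k)\<close>, and
  \<open>L \<eta>\<close> by the graded right multiplication. Products of the
  \<open>L \<eta>\<close> produce a total set in the fibre over 0, up to complex multiples, and a
  translation carries it to any other fibre.\<close>

sublocale tracial_vector B \<Omega>
proof
  show "B \<subseteq> clinear_ops" using amp_clinear[OF \<iota>] L_clinear by (auto simp: B_def)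
  show "adj y \<in> B" if "y \<in> B" for y
    using that by (auto simp: B_def adj_L amp_adj[OF \<iota>] adj_left_regular)
  show "\<exists>y'\<in>commutant B. blinfun_apply y' \<Omega> = y \<Omega> \<and> adj y' \<Omega> = adj y \<Omega>" if "y \<in> B" for y
  proof -
    from that consider k where "y = amp \<iota> (left_regular k)" | \<eta> where "y = L \<eta>" unfolding B_def by blast
    then show ?thesis
    proof cases
      case 1
      show ?thesis unfolding 1
        by (rule bexI[OF _ R_commutant[of "- k"]])
          (simp add: \<Omega>_def R_tens adj_R_tens amp_left_tens amp_adj[OF \<iota>] adj_left_regular right_regular_basis
            quantize_vacuum[OF \<pi>_inner])
    next
      case 2
      show ?thesis unfolding 2
        by (rule bexI[OF _ fib_d_\<gamma>_commutant[of \<eta>]])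
          (simp add: L_\<Omega> adj_L adj_fib d_\<gamma>_clinear adj_d_\<gamma>, simp add: \<Omega>_def fib_tens[OF d_\<gamma>_clinear] \<gamma>_\<Omega> s_\<Omega>)
    qed
  qed
  show "dense_span {c *\<^sub>C blinfun_apply w \<Omega> | c w. w \<in> words B}"
  proof (rule dense_spanI, rule slice_eqI[OF \<iota>])
    fix x g
    assume *: "\<And>v. v \<in> {c *\<^sub>C blinfun_apply w \<Omega> | c w. w \<in> words B} \<Longrightarrow> inner v x = 0"
    have "inner (c *\<^sub>C word v) (slice \<iota> g x) = 0" for c v
    proof -
      obtain y where y: "y \<in> words B" "y \<Omega> = tens \<iota> (ell2_basis 0) (word v)" using word_op by blast
      have "amp \<iota> (left_regular g) o\<^sub>L y \<in> words B" by (rule words_step[OF _ y(1)]) (simp add: B_def)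
      then have "inner (c *\<^sub>C (amp \<iota> (left_regular g) o\<^sub>L y) \<Omega>) x = 0" by (intro *) blast
      then have "inner (c *\<^sub>C tens \<iota> (ell2_basis g) (word v)) x = 0" by (simp add: y(2) amp_left_tens)
      then show ?thesis
        by (simp add: inner_eq_Re_cinner cinner_scaleC_left cinner_tens_basis[OF \<iota>])
    qed
    then have "slice \<iota> g x = 0"
      by (intro dense_span_inner_eqI[OF dense_words]) auto
    moreover have "slice \<iota> g 0 = 0" using slice_diff[of \<iota> g x x] by simp
    ultimately show "slice \<iota> g x = slice \<iota> g 0" by simp
  qed
qed

lemma amp_VN: "x \<in> VN \<Longrightarrow> amp \<iota> x \<in> M"
proof (rule commutantI)
  assume x: "x \<in> VN"
  then show "amp \<iota> x \<in> clinear_ops"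
    using von_neumann_algebra_closed(1)[OF von_neumann_algebra_VN] amp_clinear[OF \<iota>] by blast
  fix T assume "T \<in> commutant B"
  then have "T \<in> commutant (amp \<iota> ` range left_regular)"
    using commutant_antimono[of "amp \<iota> ` range left_regular" B] by (auto simp: B_def)
  from amp_bicommutant[OF \<iota> range_left_regular(1) this x[unfolded VN_eq_bicommutant]]
  show "amp \<iota> x o\<^sub>L T = T o\<^sub>L amp \<iota> x" by simp
qed

section \<open>The conditional expectation as a vacuum compression\<close>

definition V :: "'g ell2 \<Rightarrow>\<^sub>L 'x ell2"
  where "V = Blinfun (\<lambda>\<phi>. tens \<iota> \<phi> \<omega>)"

lemma V: "V \<phi> = tens \<iota> \<phi> \<omega>"
  by (simp add: V_def bounded_linear_Blinfun_apply[OF bounded_linear_tens_left[OF \<iota>]])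

definition V_adj :: "'x ell2 \<Rightarrow>\<^sub>L 'g ell2"
  where "V_adj = (SOME S. \<forall>x y. cinner (blinfun_apply S x) y = cinner x (V y))"

lemma V_adj: "cinner (V_adj x) y = cinner x (V y)"
proof -
  have "\<exists>S :: 'x ell2 \<Rightarrow>\<^sub>L 'g ell2. \<forall>x y. cinner (S x) y = cinner x (V y)"
    by (rule adjoint_exists) (simp add: V tens_scaleC_left[OF \<iota>])
  from someI_ex[OF this] show ?thesis unfolding V_adj_def by blast
qed

definition E :: "('x ell2 \<Rightarrow>\<^sub>L 'x ell2) \<Rightarrow> 'g ell2 \<Rightarrow>\<^sub>L 'g ell2"
  where "E y = V_adj o\<^sub>L y o\<^sub>L V"

lemma E: "cinner \<phi> (E y \<psi>) = cinner (V \<phi>) (y (V \<psi>))"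
proof -
  have "cinner (E y \<psi>) \<phi> = cinner (y (V \<psi>)) (V \<phi>)" by (simp add: E_def V_adj)
  then show ?thesis by (metis cinner_commute)
qed

lemma cinner_tens_\<omega>: "cinner (V \<phi>) (V \<psi>) = cinner \<phi> \<psi>"
  by (simp add: V cinner_tens[OF \<iota>] cinner_self norm_\<Omega>)

lemma E_linear: "E (x + y) = E x + E y" "y \<in> clinear_ops \<Longrightarrow> E (c *\<^sub>C y) = c *\<^sub>C E y"
proof -
  show "E (x + y) = E x + E y"
    by (rule blinfun_eqI, rule cinner_eqI) (simp add: E blinfun.add_left cinner_add_right)
  show "E (c *\<^sub>C y) = c *\<^sub>C E y"
    by (rule blinfun_eqI, rule cinner_eqI) (simp add: E scaleC_blinfun.rep_eq cinner_scaleC_right)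
qed

lemma E_clinear: "y \<in> clinear_ops \<Longrightarrow> E y \<in> clinear_ops"
  by (rule clinear_opsI, rule cinner_eqI)
    (simp add: E V tens_scaleC_left[OF \<iota>] clinear_opsD cinner_scaleC_right)

text \<open>The embedding \<open>V\<close> intertwines right translations with the operators
  \<open>R g\<close> because second quantization fixes the vacuum. The compression therefore
  commutes with right translations, and \<open>VN_eq_commutant_right\<close> applies.\<close>

lemma E_VN:
  assumes y: "y \<in> M"
  shows "E y \<in> VN"
  unfolding VN_eq_commutant_right
proof (rule commutantI)
  show "E y \<in> clinear_ops" using E_clinear M_closed(1) y by blast
  fix S :: "'g ell2 \<Rightarrow>\<^sub>L 'g ell2" assume "S \<in> range right_regular"
  then obtain g where S: "S = right_regular g" by blast
  have VR: "V (right_regular g \<phi>) = R g (V \<phi>)" "V (right_regular (- g) \<phi>) = adj (R g) (V \<phi>)" for \<phi>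
    by (simp_all add: V R_tens adj_R_tens quantize_vacuum[OF \<pi>_inner])
  show "E y o\<^sub>L S = S o\<^sub>L E y"
  proof (rule blinfun_eqI, rule cinner_eqI)
    fix \<psi> \<phi>
    have "cinner \<phi> (S (E y \<psi>)) = cinner (right_regular (- g) \<phi>) (E y \<psi>)"
      using adj_left[of "right_regular g" \<phi>] by (simp add: S adj_right_regular)
    also have "\<dots> = cinner (V \<phi>) (R g (y (V \<psi>)))"
      by (simp add: E VR adj_left[OF R_clinear])
    also have "\<dots> = cinner (V \<phi>) (y (R g (V \<psi>)))" using commutant_apply[OF y R_commutant] by simp
    finally show "cinner \<phi> ((E y o\<^sub>L S) \<psi>) = cinner \<phi> ((S o\<^sub>L E y) \<psi>)" by (simp add: E VR S)
  qed
qed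

lemma V_basis: "V (ell2_basis 0) = \<Omega>"
  by (simp add: V \<Omega>_def)

lemma VN_trace_E: "VN_trace (E y) = cinner \<Omega> (y \<Omega>)"
  by (simp add: VN_trace_def E V_basis)

lemma VN_trace_pos_E: "VN_trace_pos (E y) = vector_trace \<Omega> y"
  by (simp add: VN_trace_pos_def vector_trace_def VN_trace_E)

lemma VN_trace_pos_vector_trace: "VN_trace_pos = vector_trace (ell2_basis 0)"
  by (simp add: fun_eq_iff VN_trace_pos_def vector_trace_def VN_trace_def)

lemma amp_V: "x \<in> clinear_ops \<Longrightarrow> amp \<iota> x (V \<phi>) = V (x \<phi>)"
  by (simp add: V amp_tens[OF \<iota>])

lemma vector_trace_amp: "x \<in> clinear_ops \<Longrightarrow> vector_trace \<Omega> (amp \<iota> x) = VN_trace_pos x"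
  by (simp add: vector_trace_def VN_trace_pos_def VN_trace_def V_basis[symmetric] amp_V cinner_tens_\<omega>)

lemma E_positive:
  assumes "y \<in> positive_part M"
  shows "E y \<in> positive_part VN"
proof -
  have y: "positive_op y" "y \<in> M" using assms by (auto simp: positive_part_def)
  have "positive_op (E y)"
    unfolding positive_op_def using y(1) E_clinear[OF positive_op_clinear[OF y(1)]] by (simp add: E positive_op_def)
  then show ?thesis using E_VN[OF y(2)] by (simp add: positive_part_def)
qed

text \<open>By \<open>amp_V\<close>, both traces equal the vacuum expectation of
  \<open>y o\<^sub>L amp \<iota> x\<close>; faithfulness of the expectation is inherited from the
  trace on \<open>M\<close>.\<close>

lemma canonical_expectation: "canonical_expectation VN VN_trace_pos M (vector_trace \<Omega>) (amp \<iota>) E"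
  unfolding canonical_expectation_def
proof (intro conjI ballI impI)
  have "linear_map M VN E"
    unfolding linear_map_def using E_VN E_linear M_closed(1) by auto
  then show "normal_map M VN E"
    by (rule normal_map_compression[of _ _ _ V]) (simp_all add: E V norm_tens[OF \<iota>] norm_\<Omega>)
  show "E \<in> positive_part M \<rightarrow> positive_part VN" using E_positive by blast
  show "y = 0" if y: "y \<in> positive_part M" and 0: "E y = 0" for y
  proof -
    have "vector_trace \<Omega> y = 0" unfolding VN_trace_pos_E[symmetric] by (simp add: 0 VN_trace_pos_def VN_trace_def)
    then show ?thesis using trace y unfolding normal_semifinite_faithful_trace_def by blast
  qed
  fix y :: "'x ell2 \<Rightarrow>\<^sub>L 'x ell2" and x :: "'g ell2 \<Rightarrow>\<^sub>L 'g ell2"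
  assume y: "y \<in> M" and "x \<in> trace_ideal VN VN_trace_pos"
  then have x: "x \<in> VN"
    using trace_ideal_vector_trace[OF von_neumann_algebra_VN, where \<Omega> = "ell2_basis (0 :: 'g)"] by (simp add: VN_trace_pos_vector_trace)
  then have xc: "x \<in> clinear_ops" using von_neumann_algebra_closed(1)[OF von_neumann_algebra_VN] by blast
  have "E y o\<^sub>L x \<in> VN" using von_neumann_algebra_closed(4)[OF von_neumann_algebra_VN E_VN[OF y] x] .
  then have "trace_ext VN VN_trace_pos (E y o\<^sub>L x) = cinner (ell2_basis 0) ((E y o\<^sub>L x) (ell2_basis 0))"
    unfolding VN_trace_pos_vector_trace by (rule trace_ext_vector_trace[OF von_neumann_algebra_VN])
  also have "\<dots> = cinner \<Omega> ((y o\<^sub>L amp \<iota> x) \<Omega>)"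
    by (simp add: E V_basis[symmetric] amp_V[OF xc])
  also have "\<dots> = trace_ext M (vector_trace \<Omega>) (y o\<^sub>L amp \<iota> x)"
    by (rule trace_ext_vector_trace[OF M M_closed(4)[OF y amp_VN[OF x]], symmetric])
  finally show "trace_ext VN VN_trace_pos (E y o\<^sub>L x) = trace_ext M (vector_trace \<Omega>) (y o\<^sub>L amp \<iota> x)" .
qed

lemma amp_inj: "inj_on (amp \<iota>) VN"
proof (rule inj_onI)
  fix x y :: "'g ell2 \<Rightarrow>\<^sub>L 'g ell2" assume "x \<in> VN" "y \<in> VN" and eq: "amp \<iota> x = amp \<iota> y"
  then have c: "x \<in> clinear_ops" "y \<in> clinear_ops" using von_neumann_algebra_closed(1)[OF von_neumann_algebra_VN] by blast+
  have "norm (x \<phi> - y \<phi>) = 0" for \<phi>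
  proof -
    have "V (x \<phi>) = V (y \<phi>)" using amp_V c eq by metis
    then have "V (x \<phi> - y \<phi>) = 0" by (simp add: blinfun.diff_right)
    then have "cinner (x \<phi> - y \<phi>) (x \<phi> - y \<phi>) = 0"
      using cinner_tens_\<omega>[of "x \<phi> - y \<phi>" "x \<phi> - y \<phi>"] by simp
    then show ?thesis unfolding cinner_self by simp
  qed
  then show "x = y" by (intro blinfun_eqI) simp
qed

lemma amp_star_hom: "star_hom VN M (amp \<iota>)"
proof -
  have "VN \<subseteq> (clinear_ops :: ('g ell2 \<Rightarrow>\<^sub>L 'g ell2) set)" by (rule von_neumann_algebra_closed(1)[OF von_neumann_algebra_VN])
  then show ?thesis
    unfolding star_hom_def linear_map_def
    by (auto simp: amp_VN amp_add[OF \<iota>] amp_scaleC[OF \<iota>] amp_compose[OF \<iota>] amp_adj[OF \<iota>])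
qed

section \<open>Automorphisms from reflections and shifts\<close>

definition S :: "'i \<Rightarrow> int \<Rightarrow> 'x ell2 \<Rightarrow>\<^sub>L 'x ell2"
  where "S i m = fib (quantize (\<sigma> i m))"

lemma quantize_\<sigma>_clinear: "quantize (\<sigma> i m) \<in> clinear_ops"
  by (rule quantize(1)[OF \<sigma>_inner])

lemma S_clinear: "S i m \<in> clinear_ops"
  unfolding S_def by (rule fib_clinear[OF quantize_\<sigma>_clinear])

lemma S_tens: "S i m (tens \<iota> \<phi> x) = tens \<iota> \<phi> (quantize (\<sigma> i m) x)"
  unfolding S_def by (rule fib_tens[OF quantize_\<sigma>_clinear])

lemma quantize_\<sigma>_inverse: "quantize (\<sigma> i m) (quantize (\<sigma> i (- m)) x) = x"
  by (simp add: quantize_compose[OF \<sigma>_inner \<sigma>_inner] \<sigma>_inverse quantize_id)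

lemma S_inverse: "S i m o\<^sub>L S i (- m) = id_blinfun"
  by (rule tens_op_eqI[OF \<iota>]) (simp add: S_tens quantize_\<sigma>_inverse)

lemma adj_S: "adj (S i m) = S i (- m)"
proof -
  have "adj (quantize (\<sigma> i m)) = quantize (\<sigma> i (- m))"
    by (rule adj_eqI[OF cinner_quantize[OF \<sigma>_inner \<sigma>_inner \<sigma>_inverse] quantize_\<sigma>_clinear])
  then show ?thesis by (simp add: S_def adj_fib quantize_\<sigma>_clinear)
qed

lemma S_\<Omega>: "S i m \<Omega> = \<Omega>"
  by (simp add: \<Omega>_def S_tens quantize_vacuum[OF \<sigma>_inner])

text \<open>Shifts act on the Fock factor only, so translations are fixed; since
  \<open>\<sigma>\<close> commutes with \<open>\<pi>\<close>, the twist in \<open>L\<close> is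
  respected.\<close>

lemma S_M:
  assumes "x \<in> M"
  shows "S i m o\<^sub>L x o\<^sub>L S i (- m) \<in> M"
proof (rule conjugation_bicommutant[OF S_clinear S_clinear S_inverse _ _ assms])
  show "S i (- m) o\<^sub>L S i m = id_blinfun" using S_inverse[of i "- m"] by simp
  fix b assume "b \<in> B"
  then consider k where "b = amp \<iota> (left_regular k)" | \<eta> where "b = L \<eta>" unfolding B_def by blast
  then have "S i m o\<^sub>L b o\<^sub>L S i (- m) = b \<or> (\<exists>\<eta>. S i m o\<^sub>L b o\<^sub>L S i (- m) = L \<eta>)"
  proof cases
    case 1
    have "S i m o\<^sub>L b o\<^sub>L S i (- m) = b" unfolding 1
      by (rule tens_op_eqI[OF \<iota>]) (simp add: S_tens amp_left_tens quantize_\<sigma>_inverse)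
    then show ?thesis ..
  next
    case 2
    have "S i m o\<^sub>L b o\<^sub>L S i (- m) = L (\<sigma> i m \<eta>)" unfolding 2
      by (rule tens_op_eqI[OF \<iota>]) (simp add: S_tens L_tens quantize_s[OF \<sigma>_inner] quantize_\<sigma>_inverse \<sigma>_\<pi>)
    then show ?thesis by blast
  qed
  then show "S i m o\<^sub>L b o\<^sub>L S i (- m) \<in> B" using \<open>b \<in> B\<close> by (auto simp: B_def)
qed

abbreviation \<xi>\<^sub>0 :: "'i \<Rightarrow> 'k" where "\<xi>\<^sub>0 i \<equiv> \<xi> (i, 0, 0)"

lemma norm_\<xi>\<^sub>0: "norm (\<xi>\<^sub>0 i) = 1"
  by (simp add: norm_eq_sqrt_inner gram symbol_kernel_def r_0)

lemma L_M: "L \<eta> \<in> M"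
  using B_subset_M by (auto simp: B_def)

text \<open>The unitary implementing the automorphism. On vectors its adjoint first applies the
  generator of the zeroth copy and then shifts that copy to position -1, the order on which
  \<open>past_step\<close> relies.\<close>

definition Z :: "'i \<Rightarrow> 'x ell2 \<Rightarrow>\<^sub>L 'x ell2"
  where "Z i = L (\<xi>\<^sub>0 i) o\<^sub>L S i 1"

definition Z' :: "'i \<Rightarrow> 'x ell2 \<Rightarrow>\<^sub>L 'x ell2"
  where "Z' i = S i (- 1) o\<^sub>L L (\<xi>\<^sub>0 i)"

lemma Z_clinear: "Z i \<in> clinear_ops" "Z' i \<in> clinear_ops"
  unfolding Z_def Z'_def using L_clinear S_clinear by blast+

lemma adj_Z: "adj (Z i) = Z' i"
  unfolding Z_def Z'_def by (simp add: adj_compose L_clinear S_clinear adj_L adj_S)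

lemma S_S_apply: "S i m (S i (- m) x) = x"
  using S_inverse[of i m] by (metis blinfun_apply_blinfun_compose blinfun_apply_id_blinfun id_apply)

lemma Z_Z': "Z i (Z' i x) = x" "Z' i (Z i x) = x"
  using S_S_apply[of i 1] S_S_apply[of i "- 1"] by (simp_all add: Z_def Z'_def L_L norm_\<xi>\<^sub>0)

definition U :: "'i \<Rightarrow> ('x ell2 \<Rightarrow>\<^sub>L 'x ell2) \<Rightarrow> 'x ell2 \<Rightarrow>\<^sub>L 'x ell2"
  where "U i x = Z i o\<^sub>L x o\<^sub>L Z' i"

lemma conjugation_M:
  assumes "x \<in> M"
  shows "Z i o\<^sub>L x o\<^sub>L Z' i \<in> M" "Z' i o\<^sub>L x o\<^sub>L Z i \<in> M"
proof -
  have "L (\<xi>\<^sub>0 i) o\<^sub>L (S i 1 o\<^sub>L x o\<^sub>L S i (- 1)) o\<^sub>L L (\<xi>\<^sub>0 i) \<in> M"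
    by (intro M_closed(4) L_M S_M assms)
  then show "Z i o\<^sub>L x o\<^sub>L Z' i \<in> M" by (simp add: Z_def Z'_def blinfun_compose_assoc)
  have "S i (- 1) o\<^sub>L (L (\<xi>\<^sub>0 i) o\<^sub>L x o\<^sub>L L (\<xi>\<^sub>0 i)) o\<^sub>L S i (- (- 1)) \<in> M"
    by (intro M_closed(4) L_M S_M assms)
  then show "Z' i o\<^sub>L x o\<^sub>L Z i \<in> M" by (simp add: Z_def Z'_def blinfun_compose_assoc)
qed

lemma U_automorphism: "star_automorphism M (U i)"
  unfolding star_automorphism_def star_hom_def linear_map_def
proof (intro conjI ballI allI)
  show "U i \<in> M \<rightarrow> M" using conjugation_M(1) by (auto simp: U_def)
  show "U i (x + y) = U i x + U i y" for x y
    by (rule blinfun_eqI) (simp add: U_def blinfun.add_left blinfun.add_right)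
  show "U i (c *\<^sub>C x) = c *\<^sub>C U i x" for c x
    by (rule blinfun_eqI) (simp add: U_def scaleC_blinfun.rep_eq clinear_opsD[OF Z_clinear(1)])
  show "U i (x o\<^sub>L y) = U i x o\<^sub>L U i y" for x y
    by (rule blinfun_eqI) (simp add: U_def Z_Z')
  show "U i (adj x) = adj (U i x)" if "x \<in> M" for x
  proof -
    have "x \<in> clinear_ops" using that M_closed(1) by blast
    moreover have "adj (Z' i) = Z i" using adj_Z[of i] Z_clinear by (metis adj_adj)
    ultimately show ?thesis
      by (simp add: U_def adj_compose Z_clinear clinear_ops_compose adj_Z blinfun_compose_assoc)
  qed
  show "bij_betw (U i) M M"
  proof (rule bij_betw_byWitness[where f' = "\<lambda>x. Z' i o\<^sub>L x o\<^sub>L Z i"])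
    show "\<forall>x\<in>M. Z' i o\<^sub>L U i x o\<^sub>L Z i = x" "\<forall>x\<in>M. U i (Z' i o\<^sub>L x o\<^sub>L Z i) = x"
      by (auto simp: U_def Z_Z' intro!: blinfun_eqI)
  qed (use conjugation_M in \<open>auto simp: U_def\<close>)
qed

lemma U_unital: "unital_map (U i)"
  unfolding unital_map_def by (rule blinfun_eqI) (simp add: U_def Z_Z')

text \<open>The reflection does not fix \<open>\<Omega>\<close>, but it lies in \<open>M\<close> and
  squares to the identity, so the trace identity \<open>cinner_word\<close> removes it; the shift
  fixes \<open>\<Omega>\<close>.\<close>

lemma U_trace:
  assumes x: "x \<in> M"
  shows "vector_trace \<Omega> (U i x) = vector_trace \<Omega> x"
proof -
  let ?L = "L (\<xi>\<^sub>0 i)" and ?a = "S i 1 o\<^sub>L x o\<^sub>L S i (- 1)"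
  have a: "?a \<in> M" by (rule S_M[OF x])
  have ac: "?a \<in> clinear_ops" using a M_closed(1) by blast
  have "?L o\<^sub>L id_blinfun \<in> words B" by (rule words_step[OF _ words_id]) (simp add: B_def)
  moreover have "?L o\<^sub>L id_blinfun = ?L" by (rule blinfun_eqI) simp
  ultimately have w: "?L \<in> words B" by simp
  have "cinner \<Omega> (U i x \<Omega>) = cinner (?L \<Omega>) ((?a o\<^sub>L ?L) \<Omega>)"
    using adj_left[OF L_clinear, of "\<xi>\<^sub>0 i" \<Omega>] by (simp add: adj_L U_def Z_def Z'_def)
  also have "\<dots> = cinner (adj (?a o\<^sub>L ?L) \<Omega>) (adj ?L \<Omega>)" by (rule cinner_word[OF w M_closed(4)[OF a L_M]])
  also have "\<dots> = cinner (?L (adj ?a \<Omega>)) (?L \<Omega>)" by (simp add: adj_compose[OF ac L_clinear] adj_L)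
  also have "\<dots> = cinner (adj ?a \<Omega>) \<Omega>"
    using adj_left[OF L_clinear, of "\<xi>\<^sub>0 i"] by (simp add: adj_L L_L norm_\<xi>\<^sub>0)
  also have "\<dots> = cinner \<Omega> (?a \<Omega>)" by (rule adj_left[OF ac])
  also have "\<dots> = cinner (S i (- 1) \<Omega>) (x (S i (- 1) \<Omega>))"
    using adj_left[OF S_clinear, of i 1 \<Omega>] by (simp add: adj_S)
  finally show ?thesis by (simp add: vector_trace_def S_\<Omega>)
qed

lemma Z_tens: "Z i (tens \<iota> (ell2_basis h) x) = tens \<iota> (ell2_basis h) (s (\<xi> (i, 0, - h)) (quantize (\<sigma> i 1) x))"
  by (simp add: Z_def S_tens L_tens \<pi>_\<xi>)

lemma Z'_tens: "Z' i (tens \<iota> (ell2_basis h) x) = tens \<iota> (ell2_basis h) (quantize (\<sigma> i (- 1)) (s (\<xi> (i, 0, - h)) x))"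
  by (simp add: Z'_def S_tens L_tens \<pi>_\<xi>)

text \<open>Distinct symbols have orthogonal vectors, whose generators anticommute, and the shift of
  one symbol fixes the vectors of the other.\<close>

lemma Z_anticommute:
  assumes "i \<noteq> j"
  shows "Z i o\<^sub>L Z j = - (Z j o\<^sub>L Z i)"
proof (rule tens_op_eqI[OF \<iota>])
  fix h x
  have q: "quantize (\<sigma> i 1) (quantize (\<sigma> j 1) x) = quantize (\<sigma> j 1) (quantize (\<sigma> i 1) x)"
    by (simp add: quantize_compose \<sigma>_inner \<sigma>_\<sigma>[of i])
  have "s (\<xi> (i, 0, - h)) (s (\<xi> (j, 0, - h)) y) = - s (\<xi> (j, 0, - h)) (s (\<xi> (i, 0, - h)) y)" for y
    using car[of "\<xi> (i, 0, - h)" "\<xi> (j, 0, - h)" y] assms by (simp add: gram symbol_kernel_def eq_neg_iff_add_eq_0)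
  then have "s (\<xi> (i, 0, - h)) (quantize (\<sigma> i 1) (s (\<xi> (j, 0, - h)) (quantize (\<sigma> j 1) x))) =
      - s (\<xi> (j, 0, - h)) (quantize (\<sigma> j 1) (s (\<xi> (i, 0, - h)) (quantize (\<sigma> i 1) x)))"
    using assms by (simp add: quantize_s[OF \<sigma>_inner] \<sigma>_\<xi> q)
  moreover have "tens \<iota> \<phi> (- y) = - tens \<iota> \<phi> y" for \<phi> y
    using linear_neg[OF bounded_linear.linear[OF bounded_linear_tens_right[OF \<iota>]]] .
  ultimately show "(Z i o\<^sub>L Z j) (tens \<iota> (ell2_basis h) x) = (- (Z j o\<^sub>L Z i)) (tens \<iota> (ell2_basis h) x)"
    by (simp add: Z_tens blinfun.minus_left)
qed

text \<open>The signs from the unitaries and from their adjoints cancel under conjugation.\<close>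

lemma U_commute: "U i (U j x) = U j (U i x)"
proof (cases "i = j")
  case False
  have "adj (Z j o\<^sub>L Z i) = adj (- (Z i o\<^sub>L Z j))" by (simp only: Z_anticommute[OF False[symmetric]])
  also have "- (Z i o\<^sub>L Z j) = (- 1) *\<^sub>C (Z i o\<^sub>L Z j)"
    by (rule blinfun_eqI) (simp add: blinfun.minus_left scaleC_blinfun.rep_eq scaleC_minus_one)
  also have "adj \<dots> = - adj (Z i o\<^sub>L Z j)"
    by (rule blinfun_eqI)
      (simp add: adj_scaleC clinear_ops_compose Z_clinear blinfun.minus_left scaleC_blinfun.rep_eq scaleC_minus_one)
  finally have *: "Z' i o\<^sub>L Z' j = - (Z' j o\<^sub>L Z' i)" by (simp add: adj_compose Z_clinear adj_Z)
  have 1: "Z i (Z j y) = - Z j (Z i y)" for y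
    using arg_cong[OF Z_anticommute[OF False], of "\<lambda>T. T y"] by (simp add: blinfun.minus_left)
  have 2: "Z' j (Z' i y) = - Z' i (Z' j y)" for y
    using arg_cong[OF *, of "\<lambda>T. T y"] by (simp add: blinfun.minus_left)
  show ?thesis
    by (rule blinfun_eqI) (simp add: U_def 1 2 blinfun.minus_right)
qed simp

text \<open>The vectors annihilated by all \<open>\<xi> (i, j, h)\<close> with \<open>j\<close> nonnegative.  The inverse shift moves the
  newly created vector out of this range, so each factor of a dilated product is independent of
  the previous ones.\<close>

definition past :: "'y ell2 set"
  where "past = {P. \<forall>i j h. 0 \<le> j \<longrightarrow> s (\<xi> (i, j, h)) P = d (\<xi> (i, j, h)) P}"

lemma vacuum_past: "\<omega> \<in> past"
  by (simp add: past_def s_\<Omega>)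

lemma past_step:
  assumes P: "P \<in> past"
  shows "quantize (\<sigma> i (- 1)) (s (\<xi> (i, 0, h)) P) \<in> past"
  unfolding past_def
proof (intro CollectI allI impI)
  fix i' j h' assume j: "0 \<le> (j :: int)"
  \<comment> \<open>The copy that the inverse shift moves to index \<open>j\<close>; for the shifted
    symbol it is at least 1 and so differs from the zeroth copy just created.\<close>
  define j' where "j' = (if i' = i then j + 1 else j)"
  let ?\<eta> = "\<xi> (i', j', h')"
  have \<eta>: "\<xi> (i', j, h') = \<sigma> i (- 1) ?\<eta>" by (simp add: \<sigma>_\<xi> j'_def)
  have "s ?\<eta> (s (\<xi> (i, 0, h)) P) = d ?\<eta> (s (\<xi> (i, 0, h)) P)"
  proof (rule d_s_orthogonal)
    show "inner ?\<eta> (\<xi> (i, 0, h)) = 0" using j by (simp add: gram symbol_kernel_def j'_def)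
    show "s ?\<eta> P = d ?\<eta> P" using P j by (simp add: past_def j'_def)
  qed
  then show "s (\<xi> (i', j, h')) (quantize (\<sigma> i (- 1)) (s (\<xi> (i, 0, h)) P)) =
      d (\<xi> (i', j, h')) (quantize (\<sigma> i (- 1)) (s (\<xi> (i, 0, h)) P))"
    unfolding \<eta> by (simp add: quantize_s[OF \<sigma>_inner, symmetric] quantize_d[OF \<sigma>_inner, symmetric])
qed

text \<open>The outermost automorphism is removed first: its unitary is moved onto both vectors,
  which stay in \<open>past\<close>, and it contributes one factor. The vectors are general because
  they change with each step.\<close>

lemma matrix_U:
  assumes x: "x \<in> clinear_ops" and P: "P \<in> past" and Q: "Q \<in> past"
  shows "cinner (tens \<iota> (ell2_basis a) P) (foldr U js (amp \<iota> x) (tens \<iota> (ell2_basis b) Q)) =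
    (\<Prod>j\<leftarrow>js. complex_of_real (r j (a - b))) * cinner (ell2_basis a) (x (ell2_basis b)) * cinner P Q"
  using P Q
proof (induction js arbitrary: P Q)
  case Nil
  show ?case by (simp add: amp_tens[OF \<iota> x] cinner_tens[OF \<iota>])
next
  case (Cons j js)
  let ?P = "\<lambda>c P. quantize (\<sigma> j (- 1)) (s (\<xi> (j, 0, - c)) P)"
  \<comment> \<open>The created vectors carry the group labels \<open>- a\<close> and
    \<open>- b\<close>, whose kernel value is \<open>r j (a - b)\<close>.\<close>
  have PQ: "cinner (?P a P) (?P b Q) = complex_of_real (r j (a - b)) * cinner P Q"
  proof -
    have "cinner (?P a P) (?P b Q) = cinner (s (\<xi> (j, 0, - a)) P) (s (\<xi> (j, 0, - b)) Q)"
      using cinner_quantize[OF \<sigma>_inner[of j 1] \<sigma>_inner[of j "- 1"] \<sigma>_inverse] by (simp add: quantize_\<sigma>_inverse)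
    also have "\<dots> = complex_of_real (inner (\<xi> (j, 0, - a)) (\<xi> (j, 0, - b))) * cinner P Q"
      by (rule cinner_s_s) (use Cons.prems in \<open>simp_all add: past_def\<close>)
    finally show ?thesis by (simp add: gram symbol_kernel_def)
  qed
  have "cinner (tens \<iota> (ell2_basis a) P) (foldr U (j # js) (amp \<iota> x) (tens \<iota> (ell2_basis b) Q)) =
      cinner (Z' j (tens \<iota> (ell2_basis a) P)) (foldr U js (amp \<iota> x) (Z' j (tens \<iota> (ell2_basis b) Q)))"
    using adj_left[OF Z_clinear(1)] by (simp add: U_def adj_Z)
  also have "\<dots> = (\<Prod>j\<leftarrow>js. complex_of_real (r j (a - b))) * cinner (ell2_basis a) (x (ell2_basis b)) * cinner (?P a P) (?P b Q)"
    unfolding Z'_tens by (intro Cons.IH past_step Cons.prems)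
  finally show ?case by (simp add: PQ mult_ac)
qed

lemma matrix_E_U:
  assumes "x \<in> clinear_ops"
  shows "cinner (ell2_basis a) (E (foldr U js (amp \<iota> x)) (ell2_basis b)) =
    (\<Prod>j\<leftarrow>js. complex_of_real (r j (a - b))) * cinner (ell2_basis a) (x (ell2_basis b))"
  using matrix_U[OF assms vacuum_past vacuum_past, of a js b] by (simp add: E V cinner_self norm_\<Omega>)

end

section \<open>The dilation theorem\<close>

text \<open>Flattening the powers into one word of indices lets a single list induction treat all
  exponents.\<close>

lemma power_product_foldr:
  "power_product n F k x = foldr F (concat (map (\<lambda>i. replicate (k i) i) [1..<Suc n])) x"
proof -
  have "foldr F (replicate m i) = F i ^^ m" for m i by (induction m) (simp_all add: fun_eq_iff)
  then have "foldr (\<circ>) (map (\<lambda>i. F i ^^ k i) l) id = foldr F (concat (map (\<lambda>i. replicate (k i) i) l))" for l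
    by (induction l) (simp_all add: fun_eq_iff)
  then show ?thesis by (simp only: power_product_def)
qed

lemma matrix_fourier_multipliers:
  assumes T: "\<And>j. j \<in> set js \<Longrightarrow> fourier_multiplier (t j) (Mt j)" and x: "x \<in> VN"
  shows "foldr Mt js x \<in> VN \<and> (\<forall>a b. cinner (ell2_basis a) (foldr Mt js x (ell2_basis b)) =
    (\<Prod>j\<leftarrow>js. t j (a - b)) * cinner (ell2_basis a) (x (ell2_basis b)))"
  using T
proof (induction js)
  case (Cons j js)
  then have IH: "foldr Mt js x \<in> VN" "\<And>a b. cinner (ell2_basis a) (foldr Mt js x (ell2_basis b)) =
    (\<Prod>j\<leftarrow>js. t j (a - b)) * cinner (ell2_basis a) (x (ell2_basis b))" by auto
  have j: "fourier_multiplier (t j) (Mt j)" using Cons.prems by simp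
  then have "Mt j (foldr Mt js x) \<in> VN"
    using IH(1) by (auto simp: fourier_multiplier_def normal_map_def linear_map_def)
  then show ?case using fourier_multiplier_matrix[OF j IH(1)] by (simp add: IH(2) mult.assoc)
qed (use x in simp)

text \<open>Over the reals each basis vector contributes itself and its multiple by \<i>; this
  doubling accounts for the \<open>bool\<close> in the Fock labels.\<close>

lemma real_orthonormal_basis:
  fixes \<beta> :: "'a \<times> bool \<Rightarrow> 'a ell2"
  defines "\<beta> \<equiv> (\<lambda>(a, c). (if c then \<i> else 1) *\<^sub>C ell2_basis a)"
  shows "inner (\<beta> p) (\<beta> q) = (if p = q then 1 else 0)" "dense_span (range \<beta>)"
proof -
  show "inner (\<beta> p) (\<beta> q) = (if p = q then 1 else 0)"
    by (cases p; cases q)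
      (auto simp: \<beta>_def inner_eq_Re_cinner cinner_scaleC_left cinner_scaleC_right cinner_basis_basis)
  show "dense_span (range \<beta>)"
  proof (rule dense_span_mono[OF dense_span_basis], rule subsetI)
    fix v :: "'a ell2" assume "v \<in> {c *\<^sub>C ell2_basis a | c a. c \<in> {1, \<i>}}"
    then obtain c a where "v = c *\<^sub>C ell2_basis a" "c = 1 \<or> c = \<i>" by blast
    then have "v = \<beta> (a, c = \<i>)" by (auto simp: \<beta>_def)
    then show "v \<in> range \<beta>" by blast
  qed
qed

theorem theorem1p11:
  fixes n :: nat
    and t :: "nat \<Rightarrow> 'g::group_add \<Rightarrow> complex"
    and Mt :: "nat \<Rightarrow> ('g ell2 \<Rightarrow>\<^sub>L 'g ell2) \<Rightarrow> ('g ell2 \<Rightarrow>\<^sub>L 'g ell2)"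
  assumes "n \<ge> 1"
    and "\<And>i. i \<in> {1..n} \<Longrightarrow> fourier_multiplier (t i) (Mt i)"
    and "\<And>i. i \<in> {1..n} \<Longrightarrow> unital_map (Mt i)"
    and "\<And>i. i \<in> {1..n} \<Longrightarrow> completely_positive VN (Mt i)"
    and "\<And>i g. i \<in> {1..n} \<Longrightarrow> t i g \<in> \<real>"
  shows "\<exists>(M :: ('g dilation_index ell2 \<Rightarrow>\<^sub>L 'g dilation_index ell2) set) \<tau> U J E.
    von_neumann_algebra M \<and> normal_semifinite_faithful_trace M \<tau> \<and>
    (\<forall>i\<in>{1..n}. star_automorphism M (U i) \<and> unital_map (U i) \<and> trace_preserving M \<tau> \<tau> (U i)) \<and>
    (\<forall>i\<in>{1..n}. \<forall>j\<in>{1..n}. \<forall>x\<in>M. U i (U j x) = U j (U i x)) \<and>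
    star_hom VN M J \<and> unital_map J \<and> normal_map VN M J \<and> inj_on J VN \<and>
    trace_preserving VN VN_trace_pos \<tau> J \<and>
    canonical_expectation VN VN_trace_pos M \<tau> J E \<and> trace_preserving M \<tau> VN_trace_pos E \<and>
    (\<forall>k. \<forall>x\<in>VN. power_product n Mt k x = E (power_product n U k (J x)))"
proof -
  \<comment> \<open>Outside the range the constant symbol 1 is used, which is positive definite, so
    that the construction applies to all natural numbers.\<close>
  define r :: "nat \<Rightarrow> 'g \<Rightarrow> real" where "r i g = (if i \<in> {1..n} then Re (t i g) else 1)" for i g
  have tr: "t i g = complex_of_real (r i g)" if "i \<in> {1..n}" for i g
    using assms(5)[OF that, of g] that by (simp add: r_def)
  have r0: "r i 0 = 1" for i
  proof (cases "i \<in> {1..n}")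
    case True
    then show ?thesis using fourier_multiplier_unital[OF assms(2,3)] by (simp add: r_def)
  qed (auto simp: r_def)
  have sym: "r i (- g) = r i g" for i g
  proof (cases "i \<in> {1..n}")
    case True
    then show ?thesis using fourier_multiplier_symmetric[OF assms(2,4,5), of i g] by (simp add: r_def)
  qed (auto simp: r_def)
  have pos: "0 \<le> (\<Sum>a<(m::nat). \<Sum>b<m. c a * c b * r i (- g a + g b))" for i m c g
  proof (cases "i \<in> {1..n}")
    case True
    have "(\<Sum>a<m. \<Sum>b<m. cnj (complex_of_real (c a)) * complex_of_real (c b) * t i (- g a + g b)) \<in> \<real>\<^sub>\<ge>\<^sub>0"
      by (rule fourier_multiplier_positive[OF assms(2)[OF True] assms(4)[OF True]])
    also have "(\<Sum>a<m. \<Sum>b<m. cnj (complex_of_real (c a)) * complex_of_real (c b) * t i (- g a + g b)) =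
        complex_of_real (\<Sum>a<m. \<Sum>b<m. c a * c b * r i (- g a + g b))"
      by (simp add: tr[OF True])
    finally show ?thesis by (simp only: nonneg_Reals_of_real_iff)
  next
    case False
    have "(\<Sum>a<m. \<Sum>b<m. c a * c b * r i (- g a + g b)) = (\<Sum>a<m. c a) * (\<Sum>b<m. c b)"
      by (simp only: r_def if_not_P[OF False] sum_product mult_1_right)
    then show ?thesis by simp
  qed
  obtain \<xi> :: "nat \<times> int \<times> 'g \<Rightarrow> (nat \<times> int \<times> 'g) ell2"
    where gram: "\<forall>a b. inner (\<xi> a) (\<xi> b) = symbol_kernel r a b"
    using gram_realization[OF positive_symbol_kernel[of r, OF sym pos]] by blast
  obtain s d :: "(nat \<times> int \<times> 'g) ell2 \<Rightarrow>\<^sub>L ((nat \<times> int \<times> 'g) \<times> bool) fset ell2 \<Rightarrow>\<^sub>L ((nat \<times> int \<times> 'g) \<times> bool) fset ell2"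
    where fock: "fock s d grading (ell2_basis {||})"
    using fock_exists[OF real_orthonormal_basis] by blast
  obtain \<iota> :: "'g \<Rightarrow> ((nat \<times> int \<times> 'g) \<times> bool) fset \<Rightarrow> 'g dilation_index" where \<iota>: "pairing \<iota>"
    using dilation_pairing by blast
  interpret crossed_product s d grading "ell2_basis {||}" \<iota> \<xi> r
    using fock \<iota> gram r0 by (intro crossed_product.intro crossed_product_axioms.intro) auto
  have VN_clinear: "x \<in> clinear_ops" if "x \<in> VN" for x :: "'g ell2 \<Rightarrow>\<^sub>L 'g ell2"
    using von_neumann_algebra_closed(1)[OF von_neumann_algebra_VN] that by blast
  have power: "power_product n Mt k x = E (power_product n U k (amp \<iota> x))" if x: "x \<in> VN" for k x
  proof -
    define js where "js = concat (map (\<lambda>i. replicate (k i) i) [1..<Suc n])"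
    have js: "set js \<subseteq> {1..n}" by (auto simp: js_def)
    have Mt: "foldr Mt js x \<in> VN" "\<And>a b. cinner (ell2_basis a) (foldr Mt js x (ell2_basis b)) =
        (\<Prod>j\<leftarrow>js. t j (a - b)) * cinner (ell2_basis a) (x (ell2_basis b))"
      using matrix_fourier_multipliers[of js t Mt, OF assms(2) x] js by blast+
    have "foldr U js (amp \<iota> x) \<in> M"
      by (induction js) (auto simp: amp_VN[OF x] U_def conjugation_M(1))
    then have "E (foldr U js (amp \<iota> x)) \<in> VN" by (rule E_VN)
    moreover have "(\<Prod>j\<leftarrow>js. complex_of_real (r j g)) = (\<Prod>j\<leftarrow>js. t j g)" for g
      using js tr by (intro arg_cong[of _ _ prod_list] map_cong refl) (auto simp: subset_iff)
    ultimately have "foldr Mt js x = E (foldr U js (amp \<iota> x))"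
      using Mt by (intro ell2_op_eqI) (simp_all add: VN_clinear matrix_E_U x)
    then show ?thesis by (simp only: power_product_foldr js_def)
  qed
  show ?thesis
  proof (intro exI[of _ M] exI[of _ "vector_trace \<Omega>"] exI[of _ U] exI[of _ "amp \<iota>"] exI[of _ E] conjI ballI allI)
    show "trace_preserving M (vector_trace \<Omega>) (vector_trace \<Omega>) (U i)" for i
      by (auto simp: trace_preserving_def positive_part_def U_trace)
    show "unital_map (amp \<iota>)" by (simp add: unital_map_def amp_id[OF \<iota>])
    show "normal_map VN M (amp \<iota>)" by (rule normal_map_amp[OF \<iota> amp_VN])
    show "trace_preserving VN VN_trace_pos (vector_trace \<Omega>) (amp \<iota>)"
      by (auto simp: trace_preserving_def positive_part_def vector_trace_amp VN_clinear)
    show "trace_preserving M (vector_trace \<Omega>) VN_trace_pos E"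
      by (simp add: trace_preserving_def VN_trace_pos_E)
  qed (rule M trace U_automorphism U_unital U_commute amp_star_hom amp_inj canonical_expectation power; assumption)+
qed

end
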